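(* Let $\mathbb{W}\subseteq\mathbb{V}$ be a closed linear subspace. Suppose that $f$ satisfies the structural assumption (A) stated in the context for some $\rho>0$, and let $\Delta t>0$ satisfy $\frac{1}{\Delta t}>\kappa_f$. If the energy functional $E$ is weakly coercive, i.e. $E(v)\to+\infty$ whenever $|||v|||_\lambda\to\infty$ ($v\in\mathbb{V}$), then the sequence $\{u^n\}_n\subset\mathbb{W}$ generated, from an initial guess $u^0\in\mathbb{W}$, by the iteration \[ u^{n+1}\in\mathbb{W}:\qquad B_{\Delta t}(u^{n+1},v)=\ell_{\Delta t}(u^n;v)\qquad\forall v\in\mathbb{W},\qquad n\ge0, \] has a subsequence $\{u^{n'}\}_{n'}$ that converges weakly in $\mathbb{W}$ and strongly in $L^2(\Omega)$ to a solution of \[ u\in\mathbb{W}:\qquad\int_\Omega\nabla u\cdot\nabla v\,d\mathbf{x}=\int_\Omega f(\mathbf{x},u)v\,d\mathbf{x}\qquad\forall v\in\mathbb{W}. \]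
   Context: $\Omega\subset\mathbb{R}^d$, $d\in\{1,2,3\}$, is an open bounded polytopal domain with boundary consisting of straight faces. $\mathbb{V}:=H^1_0(\Omega)$. For $\lambda>0$, $|||v|||_\lambda:=(\lambda\|\nabla v\|_{L^2(\Omega)}^2+\|v\|_{L^2(\Omega)}^2)^{1/2}$, $v\in\mathbb{V}$ (these norms are equivalent for all $\lambda>0$). $C_P>0$ is a constant depending only on $\Omega$ such that $\|v\|_{L^2(\Omega)}^2\le C_P\|\nabla v\|_{L^2(\Omega)}^2$ for all $v\in\mathbb{V}$. $f:\Omega\times\mathbb{R}\to\mathbb{R}$ is a function, with $f(\cdot,u)$ measurable for each $u\in\mathbb{R}$. For $\lambda>0$ let $\sigma_f(\lambda):=\operatorname{ess\,sup}_{\mathbf{x}\in\Omega}\sup_{u\in\mathbb{R}}\left|\frac{\partial f}{\partial u}(\mathbf{x},u)+\frac1\lambda\right|$, and for $\rho>0$ let $\Lambda_f(\rho):=\{\lambda>0:\sigma_f(\lambda)<\rho+\frac1\lambda\}$. Assumption (A) for $\rho>0$: (i) $f(\cdot,0)\in L^2(\Omega)$; (ii) $f$ is differentiable in the second variable; (iii) the set $\Lambda_f(\rho)$ is non-empty. Define $\mu_f:=(\sup\Lambda_f(\rho))^{-1}$ if $\sup\Lambda_f(\rho)<\infty$ and $\mu_f:=0$ otherwise, and $\kappa_f:=\max\{\mu_f+\frac{\rho}{2}-\frac{1}{2C_P},0\}$. Energy functional: $E(u)=\frac12\int_\Omega|\nabla u|^2\,d\mathbf{x}-\int_\Omega\int_0^{u(\mathbf{x})}f(\mathbf{x},s)\,ds\,d\mathbf{x}$,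 $u\in\mathbb{V}$. For $\lambda>0$: $B_\lambda(u,v):=\int_\Omega(\lambda\nabla u\cdot\nabla v+uv)\,d\mathbf{x}$ for $u,v\in\mathbb{V}$, and $\ell_\lambda(y;v):=\int_\Omega(y+\lambda f(\mathbf{x},y))v\,d\mathbf{x}$ for $y\in L^2(\Omega)$, $v\in\mathbb{V}$. *)

theory Defs
  imports "HOL-Analysis.Analysis" "HOL-Probability.Essential_Supremum"
begin

definition polytopal_domain :: "'a::euclidean_space set \<Rightarrow> bool" where
  "polytopal_domain \<Omega> \<longleftrightarrow> open \<Omega> \<and> connected \<Omega> \<and> \<Omega> \<noteq> {} \<and> bounded \<Omega> \<and>
     (\<exists>F. finite F \<and> frontier \<Omega> = \<Union>F \<and>
          (\<forall>P\<in>F. polytope P \<and> aff_dim P = int DIM('a) - 1))"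

text \<open>Elements of the function spaces are represented by functions on the whole space.
  Only their values on \<open>\<Omega>\<close> matter, and two functions that agree almost everywhere on \<open>\<Omega>\<close>
  represent the same element.\<close>

definition L2_space :: "'a::euclidean_space set \<Rightarrow> ('a \<Rightarrow> 'b::euclidean_space) set" where
  "L2_space \<Omega> = {u \<in> borel_measurable (lebesgue_on \<Omega>).
                   integrable (lebesgue_on \<Omega>) (\<lambda>x. (norm (u x))\<^sup>2)}"

definition L2_norm :: "'a::euclidean_space set \<Rightarrow> ('a \<Rightarrow> 'b::euclidean_space) \<Rightarrow> real" where
  "L2_norm \<Omega> u = sqrt (LINT x|lebesgue_on \<Omega>. (norm (u x))\<^sup>2)"

definition partial_deriv ::
  "'a::euclidean_space \<Rightarrow> ('a \<Rightarrow> real) \<Rightarrow> 'a \<Rightarrow> real" where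
  "partial_deriv i \<phi> x = frechet_derivative \<phi> (at x) i"

fun C_k :: "nat \<Rightarrow> ('a::euclidean_space \<Rightarrow> real) \<Rightarrow> bool" where
  "C_k 0 \<phi> \<longleftrightarrow> continuous_on UNIV \<phi>"
| "C_k (Suc k) \<phi> \<longleftrightarrow> (\<forall>x. \<phi> differentiable (at x)) \<and> (\<forall>i\<in>Basis. C_k k (partial_deriv i \<phi>))"

text \<open>\<open>C\<^sub>c\<^sup>\<infinity>(\<Omega>)\<close>, its members being extended by zero outside \<open>\<Omega>\<close>.\<close>

definition test_functions :: "'a::euclidean_space set \<Rightarrow> ('a \<Rightarrow> real) set" where
  "test_functions \<Omega> = {\<phi>. (\<forall>k. C_k k \<phi>) \<and> compact (closure {x. \<phi> x \<noteq> 0}) \<and>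
                            closure {x. \<phi> x \<noteq> 0} \<subseteq> \<Omega>}"

definition is_weak_gradient ::
  "'a::euclidean_space set \<Rightarrow> ('a \<Rightarrow> real) \<Rightarrow> ('a \<Rightarrow> 'a) \<Rightarrow> bool" where
  "is_weak_gradient \<Omega> u g \<longleftrightarrow> g \<in> L2_space \<Omega> \<and>
     (\<forall>\<phi>\<in>test_functions \<Omega>. \<forall>i\<in>Basis.
        (LINT x|lebesgue_on \<Omega>. u x * partial_deriv i \<phi> x)
          = - (LINT x|lebesgue_on \<Omega>. (g x \<bullet> i) * \<phi> x))"

definition H1_space :: "'a::euclidean_space set \<Rightarrow> ('a \<Rightarrow> real) set" where
  "H1_space \<Omega> = {u \<in> L2_space \<Omega>. \<exists>g. is_weak_gradient \<Omega> u g}"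

text \<open>A weak gradient is unique up to a null set, and all uses of \<open>weak_grad\<close> below are under
  integrals over \<open>\<Omega>\<close>, so the choice of a representative is immaterial.\<close>

definition weak_grad :: "'a::euclidean_space set \<Rightarrow> ('a \<Rightarrow> real) \<Rightarrow> 'a \<Rightarrow> 'a" where
  "weak_grad \<Omega> u = (SOME g. is_weak_gradient \<Omega> u g)"

definition lam_norm :: "'a::euclidean_space set \<Rightarrow> real \<Rightarrow> ('a \<Rightarrow> real) \<Rightarrow> real" where
  "lam_norm \<Omega> lam v = sqrt (lam * (L2_norm \<Omega> (weak_grad \<Omega> v))\<^sup>2 + (L2_norm \<Omega> v)\<^sup>2)"

text \<open>\<open>H\<^sup>1\<^sub>0(\<Omega>)\<close> is the closure of \<open>C\<^sub>c\<^sup>\<infinity>(\<Omega>)\<close> in \<open>H\<^sup>1(\<Omega>)\<close>, whose norm is \<open>lam_norm \<Omega> 1\<close>.\<close>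

definition H10_space :: "'a::euclidean_space set \<Rightarrow> ('a \<Rightarrow> real) set" where
  "H10_space \<Omega> = {u \<in> H1_space \<Omega>.
     \<exists>\<phi> :: nat \<Rightarrow> 'a \<Rightarrow> real. (\<forall>n. \<phi> n \<in> test_functions \<Omega>) \<and>
       (\<lambda>n. lam_norm \<Omega> 1 (\<lambda>x. \<phi> n x - u x)) \<longlonglongrightarrow> 0}"

definition poincare_constant :: "'a::euclidean_space set \<Rightarrow> real \<Rightarrow> bool" where
  "poincare_constant \<Omega> C \<longleftrightarrow> C > 0 \<and>
     (\<forall>v\<in>H10_space \<Omega>. (L2_norm \<Omega> v)\<^sup>2 \<le> C * (L2_norm \<Omega> (weak_grad \<Omega> v))\<^sup>2)"

text \<open>Sequential closedness in \<open>H\<^sup>1\<^sub>0(\<Omega>)\<close> also makes \<open>W\<close> invariant under changes on null sets.\<close>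

definition closed_subspace :: "'a::euclidean_space set \<Rightarrow> ('a \<Rightarrow> real) set \<Rightarrow> bool" where
  "closed_subspace \<Omega> W \<longleftrightarrow> W \<subseteq> H10_space \<Omega> \<and>
     (\<lambda>x. 0) \<in> W \<and>
     (\<forall>v\<in>W. \<forall>w\<in>W. (\<lambda>x. v x + w x) \<in> W) \<and>
     (\<forall>c. \<forall>v\<in>W. (\<lambda>x. c * v x) \<in> W) \<and>
     (\<forall>(w :: nat \<Rightarrow> 'a \<Rightarrow> real) v. (\<forall>n. w n \<in> W) \<longrightarrow> v \<in> H10_space \<Omega> \<longrightarrow>
        (\<lambda>n. lam_norm \<Omega> 1 (\<lambda>x. w n x - v x)) \<longlonglongrightarrow> 0 \<longrightarrow> v \<in> W)"

definition bounded_functional_on ::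
  "'a::euclidean_space set \<Rightarrow> ('a \<Rightarrow> real) set \<Rightarrow> (('a \<Rightarrow> real) \<Rightarrow> real) \<Rightarrow> bool" where
  "bounded_functional_on \<Omega> W F \<longleftrightarrow>
     (\<forall>v\<in>W. \<forall>w\<in>W. F (\<lambda>x. v x + w x) = F v + F w) \<and>
     (\<forall>c. \<forall>v\<in>W. F (\<lambda>x. c * v x) = c * F v) \<and>
     (\<exists>C. \<forall>v\<in>W. \<bar>F v\<bar> \<le> C * lam_norm \<Omega> 1 v)"

definition weakly_converges_in ::
  "'a::euclidean_space set \<Rightarrow> ('a \<Rightarrow> real) set \<Rightarrow> (nat \<Rightarrow> 'a \<Rightarrow> real) \<Rightarrow> ('a \<Rightarrow> real) \<Rightarrow> bool" where
  "weakly_converges_in \<Omega> W w u \<longleftrightarrow> (\<forall>n. w n \<in> W) \<and> u \<in> W \<and>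
     (\<forall>F. bounded_functional_on \<Omega> W F \<longrightarrow> (\<lambda>n. F (w n)) \<longlonglongrightarrow> F u)"

definition strongly_converges_L2 ::
  "'a::euclidean_space set \<Rightarrow> (nat \<Rightarrow> 'a \<Rightarrow> real) \<Rightarrow> ('a \<Rightarrow> real) \<Rightarrow> bool" where
  "strongly_converges_L2 \<Omega> w u \<longleftrightarrow> (\<forall>n. w n \<in> L2_space \<Omega>) \<and> u \<in> L2_space \<Omega> \<and>
     (\<lambda>n. L2_norm \<Omega> (\<lambda>x. w n x - u x)) \<longlonglongrightarrow> 0"

text \<open>The library's \<open>esssup\<close> is \<open>\<infinity>\<close> on non-measurable arguments. This does not interfere here:
  if \<open>f\<close> is measurable in the first and differentiable in the second variable, the inner
  supremum is the least Lipschitz constant of \<open>s \<mapsto> f x s + s / lam\<close>, hence a supremum over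
  rational pairs and measurable in \<open>x\<close>.\<close>

definition sigma_f ::
  "'a::euclidean_space set \<Rightarrow> ('a \<Rightarrow> real \<Rightarrow> real) \<Rightarrow> real \<Rightarrow> ereal" where
  "sigma_f \<Omega> f lam = esssup (lebesgue_on \<Omega>) (\<lambda>x. SUP u. ereal \<bar>deriv (f x) u + 1 / lam\<bar>)"

definition Lambda_f ::
  "'a::euclidean_space set \<Rightarrow> ('a \<Rightarrow> real \<Rightarrow> real) \<Rightarrow> real \<Rightarrow> real set" where
  "Lambda_f \<Omega> f \<rho> = {lam. lam > 0 \<and> sigma_f \<Omega> f lam < ereal (\<rho> + 1 / lam)}"

definition assumption_A ::
  "'a::euclidean_space set \<Rightarrow> ('a \<Rightarrow> real \<Rightarrow> real) \<Rightarrow> real \<Rightarrow> bool" where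
  "assumption_A \<Omega> f \<rho> \<longleftrightarrow> (\<lambda>x. f x 0) \<in> L2_space \<Omega> \<and>
     (\<forall>x\<in>\<Omega>. \<forall>u. f x differentiable (at u)) \<and>
     Lambda_f \<Omega> f \<rho> \<noteq> {}"

definition mu_f ::
  "'a::euclidean_space set \<Rightarrow> ('a \<Rightarrow> real \<Rightarrow> real) \<Rightarrow> real \<Rightarrow> real" where
  "mu_f \<Omega> f \<rho> =
     (if bdd_above (Lambda_f \<Omega> f \<rho>) then inverse (Sup (Lambda_f \<Omega> f \<rho>)) else 0)"

definition kappa_f ::
  "'a::euclidean_space set \<Rightarrow> ('a \<Rightarrow> real \<Rightarrow> real) \<Rightarrow> real \<Rightarrow> real \<Rightarrow> real" where
  "kappa_f \<Omega> f \<rho> C\<^sub>P = max (mu_f \<Omega> f \<rho> + \<rho> / 2 - 1 / (2 * C\<^sub>P)) 0"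

definition energy ::
  "'a::euclidean_space set \<Rightarrow> ('a \<Rightarrow> real \<Rightarrow> real) \<Rightarrow> ('a \<Rightarrow> real) \<Rightarrow> real" where
  "energy \<Omega> f u =
     1 / 2 * (LINT x|lebesgue_on \<Omega>. (norm (weak_grad \<Omega> u x))\<^sup>2)
     - (LINT x|lebesgue_on \<Omega>. (LBINT s=ereal 0..ereal (u x). f x s))"

definition weakly_coercive ::
  "'a::euclidean_space set \<Rightarrow> real \<Rightarrow> (('a \<Rightarrow> real) \<Rightarrow> real) \<Rightarrow> bool" where
  "weakly_coercive \<Omega> lam E \<longleftrightarrow>
     (\<forall>M. \<exists>R. \<forall>v\<in>H10_space \<Omega>. lam_norm \<Omega> lam v \<ge> R \<longrightarrow> E v \<ge> M)"

definition B_form ::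
  "'a::euclidean_space set \<Rightarrow> real \<Rightarrow> ('a \<Rightarrow> real) \<Rightarrow> ('a \<Rightarrow> real) \<Rightarrow> real" where
  "B_form \<Omega> lam u v =
     (LINT x|lebesgue_on \<Omega>. lam * (weak_grad \<Omega> u x \<bullet> weak_grad \<Omega> v x) + u x * v x)"

definition ell_form ::
  "'a::euclidean_space set \<Rightarrow> ('a \<Rightarrow> real \<Rightarrow> real) \<Rightarrow> real \<Rightarrow> ('a \<Rightarrow> real) \<Rightarrow> ('a \<Rightarrow> real) \<Rightarrow> real" where
  "ell_form \<Omega> f lam y v = (LINT x|lebesgue_on \<Omega>. (y x + lam * f x (y x)) * v x)"

definition is_weak_solution_in ::
  "'a::euclidean_space set \<Rightarrow> ('a \<Rightarrow> real \<Rightarrow> real) \<Rightarrow> ('a \<Rightarrow> real) set \<Rightarrow> ('a \<Rightarrow> real) \<Rightarrow> bool" where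
  "is_weak_solution_in \<Omega> f W u \<longleftrightarrow> u \<in> W \<and>
     (\<forall>v\<in>W. (LINT x|lebesgue_on \<Omega>. weak_grad \<Omega> u x \<bullet> weak_grad \<Omega> v x)
             = (LINT x|lebesgue_on \<Omega>. f x (u x) * v x))"

end

(* Testing the scheme with the increment u^(n+1) - u^n, the Lipschitz bound on f and the Poincare
   inequality show that every step lowers the energy by at least a multiple of the squared L2 norm of
   the increment. Coercivity then bounds the iterates in H^1_0, and since the energies are bounded
   below, the increments tend to 0 in L2. By Rellich's theorem a subsequence u^(n') is Cauchy in L2.
   Subtracting two instances of the scheme, tested with the difference of the new iterates, shows that
   the shifted subsequence u^(n'+1) is even Cauchy in H^1. It therefore converges strongly in W, and
   the limit solves the equation because u^(n') and u^(n'+1) have the same limit. *)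

theory Submission
  imports Defs "HOL-Library.Diagonal_Subsequence"
begin

section \<open>The space \<open>L\<^sup>2(\<Omega>)\<close>\<close>

text \<open>Origin of the step size condition: if L bounds the derivative of f, the explicit
  treatment of f costs L/2 times the squared L2 increment. The implicit step pays back 1/\<Delta>t,
  and the gradient energy of the increment, through the Poincare inequality, another 1/2 times
  1/\<open>C\<^sub>P\<close>. An element l of \<open>Lambda_f\<close> gives L = \<rho> + 2/l, and
  \<open>mu_f\<close> is the infimum of 1/l, so a step below the threshold leaves a positive margin
  for a suitable l. The shift from u^(n') to u^(n'+1) is forced by the scheme: a step bounds the
  gradient of its output by L2 data of its input. The elements of the spaces are functions rather
  than classes and \<open>weak_grad\<close> is an arbitrary choice, so its linearity holds only
  almost everywhere. That rests on the uniqueness of weak gradients, hence on the fundamental lemma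
  of the calculus of variations, which is why explicit smooth bumps are constructed. Compactness
  comes from grid averages, whose error is governed by the L2 modulus of continuity.\<close>

lemma L2_spaceD:
  assumes "u \<in> L2_space \<Omega>"
  shows "u \<in> borel_measurable (lebesgue_on \<Omega>)" "integrable (lebesgue_on \<Omega>) (\<lambda>x. (norm (u x))\<^sup>2)"
  using assms by (auto simp: L2_space_def)

lemma L2_norm_power2: "(L2_norm \<Omega> u)\<^sup>2 = (LINT x|lebesgue_on \<Omega>. (norm (u x))\<^sup>2)"
  by (simp add: L2_norm_def)

lemma L2_norm_nonneg [simp]: "0 \<le> L2_norm \<Omega> u"
  by (simp add: L2_norm_def)

lemma L2_space_inner_integrable:
  assumes "u \<in> L2_space \<Omega>" "v \<in> L2_space \<Omega>"
  shows "integrable (lebesgue_on \<Omega>) (\<lambda>x. u x \<bullet> v x)"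
proof (rule Bochner_Integration.integrable_bound)
  note [measurable] = L2_spaceD(1)[OF assms(1)] L2_spaceD(1)[OF assms(2)]
  show "integrable (lebesgue_on \<Omega>) (\<lambda>x. (norm (u x))\<^sup>2 + (norm (v x))\<^sup>2)"
    by (intro Bochner_Integration.integrable_add L2_spaceD assms)
  show "(\<lambda>x. u x \<bullet> v x) \<in> borel_measurable (lebesgue_on \<Omega>)"
    by measurable
  have "norm (u x \<bullet> v x) \<le> norm ((norm (u x))\<^sup>2 + (norm (v x))\<^sup>2)" for x
  proof -
    have "\<bar>u x \<bullet> v x\<bar> \<le> norm (u x) * norm (v x)" by (rule Cauchy_Schwarz_ineq2)
    moreover have "2 * (norm (u x) * norm (v x)) \<le> (norm (u x))\<^sup>2 + (norm (v x))\<^sup>2"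
      using sum_squares_bound[of "norm (u x)" "norm (v x)"] by simp
    moreover have "0 \<le> norm (u x) * norm (v x)" by simp
    ultimately show ?thesis by (simp add: abs_of_nonneg)
  qed
  then show "AE x in lebesgue_on \<Omega>. norm (u x \<bullet> v x) \<le> norm ((norm (u x))\<^sup>2 + (norm (v x))\<^sup>2)"
    by simp
qed

lemma norm_add_power2: "(norm (a + b))\<^sup>2 = (norm a)\<^sup>2 + 2 * (a \<bullet> b) + (norm b)\<^sup>2"
  for a b :: "'a::real_inner"
  by (simp add: power2_norm_eq_inner inner_commute algebra_simps)

lemma
  assumes "u \<in> L2_space \<Omega>" "v \<in> L2_space \<Omega>"
  shows L2_space_add: "(\<lambda>x. u x + v x) \<in> L2_space \<Omega>"
    and L2_norm_add_power2: "(L2_norm \<Omega> (\<lambda>x. u x + v x))\<^sup>2 =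
      (L2_norm \<Omega> u)\<^sup>2 + 2 * (LINT x|lebesgue_on \<Omega>. u x \<bullet> v x) + (L2_norm \<Omega> v)\<^sup>2"
proof -
  note [measurable] = L2_spaceD(1)[OF assms(1)] L2_spaceD(1)[OF assms(2)]
  note int = L2_spaceD(2)[OF assms(1)] L2_spaceD(2)[OF assms(2)] L2_space_inner_integrable[OF assms]
  show "(\<lambda>x. u x + v x) \<in> L2_space \<Omega>"
    unfolding L2_space_def using int by (simp add: norm_add_power2)
  show "(L2_norm \<Omega> (\<lambda>x. u x + v x))\<^sup>2 =
      (L2_norm \<Omega> u)\<^sup>2 + 2 * (LINT x|lebesgue_on \<Omega>. u x \<bullet> v x) + (L2_norm \<Omega> v)\<^sup>2"
    unfolding L2_norm_power2 norm_add_power2 using int by simp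
qed

lemma L2_space_scaleR:
  assumes "u \<in> L2_space \<Omega>"
  shows "(\<lambda>x. c *\<^sub>R u x) \<in> L2_space \<Omega>"
  using L2_spaceD[OF assms] by (auto simp: L2_space_def power_mult_distrib)

lemma L2_norm_scaleR: "L2_norm \<Omega> (\<lambda>x. c *\<^sub>R u x) = \<bar>c\<bar> * L2_norm \<Omega> u"
  by (simp add: L2_norm_def power_mult_distrib real_sqrt_mult)

lemma L2_space_uminus: "u \<in> L2_space \<Omega> \<Longrightarrow> (\<lambda>x. - u x) \<in> L2_space \<Omega>"
  using L2_space_scaleR[of u \<Omega> "-1"] by simp

lemma L2_space_diff:
  "u \<in> L2_space \<Omega> \<Longrightarrow> v \<in> L2_space \<Omega> \<Longrightarrow> (\<lambda>x. u x - v x) \<in> L2_space \<Omega>"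
  using L2_space_add[of u \<Omega> "\<lambda>x. - v x"] L2_space_uminus[of v \<Omega>] by simp

lemma L2_norm_minus_commute: "L2_norm \<Omega> (\<lambda>x. u x - v x) = L2_norm \<Omega> (\<lambda>x. v x - u x)"
  by (simp add: L2_norm_def norm_minus_commute)

lemma L2_norm_zero [simp]: "L2_norm \<Omega> (\<lambda>x. 0) = 0"
  by (simp add: L2_norm_def)

text \<open>The squared norm of u + t v is a nonnegative quadratic in t; evaluating it at a
  well-chosen t bounds the mixed term.\<close>

lemma L2_Cauchy_Schwarz:
  assumes "u \<in> L2_space \<Omega>" "v \<in> L2_space \<Omega>"
  shows "\<bar>LINT x|lebesgue_on \<Omega>. u x \<bullet> v x\<bar> \<le> L2_norm \<Omega> u * L2_norm \<Omega> v"
proof -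
  define a b I where "a = L2_norm \<Omega> u" and "b = L2_norm \<Omega> v"
    and "I = (LINT x|lebesgue_on \<Omega>. u x \<bullet> v x)"
  have "(L2_norm \<Omega> (\<lambda>x. u x + t *\<^sub>R v x))\<^sup>2 = a\<^sup>2 + 2 * t * I + t\<^sup>2 * b\<^sup>2" for t
    using L2_norm_add_power2[OF assms(1) L2_space_scaleR[OF assms(2), of t]]
    by (simp add: L2_norm_scaleR a_def b_def I_def power_mult_distrib)
  then have *: "0 \<le> a\<^sup>2 + 2 * t * I + t\<^sup>2 * b\<^sup>2" for t
    by (metis zero_le_power2)
  have "I\<^sup>2 \<le> (a * b)\<^sup>2"
  proof (cases "b = 0")
    case True
    have "I = 0"
    proof (rule ccontr)
      assume "I \<noteq> 0"
      \<comment> \<open>With b = 0 the quadratic is affine in t, and this t gives it the value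
        -1.\<close>
      with *[of "- (a\<^sup>2 + 1) / (2 * I)"] True show False by (simp add: field_simps)
    qed
    then show ?thesis by simp
  next
    case False
    \<comment> \<open>This t is the minimiser of the quadratic, which gives the sharp
      constant.\<close>
    have "0 \<le> a\<^sup>2 + 2 * (- I / b\<^sup>2) * I + (- I / b\<^sup>2)\<^sup>2 * b\<^sup>2" by (rule *)
    also have "\<dots> = a\<^sup>2 - I\<^sup>2 / b\<^sup>2"
      using False by (simp add: power_divide power2_eq_square field_simps)
    finally show ?thesis
      using False by (simp add: field_simps)
  qed
  then have "\<bar>I\<bar> \<le> a * b"
    by (simp add: abs_le_square_iff[symmetric] a_def b_def)
  then show ?thesis by (simp add: a_def b_def I_def)
qed

lemma L2_norm_triangle:
  assumes "u \<in> L2_space \<Omega>" "v \<in> L2_space \<Omega>"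
  shows "L2_norm \<Omega> (\<lambda>x. u x + v x) \<le> L2_norm \<Omega> u + L2_norm \<Omega> v"
proof (rule power2_le_imp_le)
  show "(L2_norm \<Omega> (\<lambda>x. u x + v x))\<^sup>2 \<le> (L2_norm \<Omega> u + L2_norm \<Omega> v)\<^sup>2"
    using L2_norm_add_power2[OF assms] L2_Cauchy_Schwarz[OF assms]
    by (simp add: power2_sum)
qed simp

lemma L2_norm_diff_triangle:
  assumes "u \<in> L2_space \<Omega>" "v \<in> L2_space \<Omega>" "w \<in> L2_space \<Omega>"
  shows "L2_norm \<Omega> (\<lambda>x. u x - w x) \<le> L2_norm \<Omega> (\<lambda>x. u x - v x) + L2_norm \<Omega> (\<lambda>x. v x - w x)"
  using L2_norm_triangle[OF L2_space_diff[OF assms(1,2)] L2_space_diff[OF assms(2,3)]] by simp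

lemma L2_norm_le_add_diff:
  assumes "u \<in> L2_space \<Omega>" "v \<in> L2_space \<Omega>"
  shows "L2_norm \<Omega> u \<le> L2_norm \<Omega> v + L2_norm \<Omega> (\<lambda>x. u x - v x)"
  using L2_norm_triangle[OF assms(2) L2_space_diff[OF assms]] by simp

lemma L2_norm_cong_AE:
  assumes "u \<in> borel_measurable (lebesgue_on \<Omega>)" "v \<in> borel_measurable (lebesgue_on \<Omega>)"
    and "AE x in lebesgue_on \<Omega>. u x = v x"
  shows "L2_norm \<Omega> u = L2_norm \<Omega> v"
  unfolding L2_norm_def using assms
  by (intro arg_cong[where f=sqrt] integral_cong_AE) auto

lemma L2_norm_mono_AE:
  assumes "u \<in> borel_measurable (lebesgue_on \<Omega>)" "v \<in> L2_space \<Omega>"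
    and "AE x in lebesgue_on \<Omega>. norm (u x) \<le> norm (v x)"
  shows "u \<in> L2_space \<Omega>" "L2_norm \<Omega> u \<le> L2_norm \<Omega> v"
proof -
  note [measurable] = assms(1) L2_spaceD(1)[OF assms(2)]
  have *: "AE x in lebesgue_on \<Omega>. (norm (u x))\<^sup>2 \<le> (norm (v x))\<^sup>2"
    using assms(3) by eventually_elim (simp add: power_mono)
  have "integrable (lebesgue_on \<Omega>) (\<lambda>x. (norm (u x))\<^sup>2)"
    by (rule Bochner_Integration.integrable_bound[OF L2_spaceD(2)[OF assms(2)]]) (use * in auto)
  then show "u \<in> L2_space \<Omega>" by (simp add: L2_space_def assms)
  show "L2_norm \<Omega> u \<le> L2_norm \<Omega> v"
    unfolding L2_norm_def using \<open>integrable (lebesgue_on \<Omega>) (\<lambda>x. (norm (u x))\<^sup>2)\<close> L2_spaceD(2)[OF assms(2)] *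
    by (intro real_sqrt_le_mono integral_mono_AE)
qed

lemma L2_space_bounded:
  assumes "\<Omega> \<in> lmeasurable" "u \<in> borel_measurable (lebesgue_on \<Omega>)" "\<And>x. x \<in> \<Omega> \<Longrightarrow> norm (u x) \<le> B"
  shows "u \<in> L2_space \<Omega>"
proof -
  interpret finite_measure "lebesgue_on \<Omega>"
    by (rule finite_measure_lebesgue_on) fact
  note [measurable] = assms(2)
  have "integrable (lebesgue_on \<Omega>) (\<lambda>x. (norm (u x))\<^sup>2)"
    by (rule integrable_const_bound[of _ "B\<^sup>2"]) (auto intro!: AE_I2 power_mono assms)
  then show ?thesis by (simp add: L2_space_def assms)
qed

text \<open>With u = a + p and v = b + q the inner products differ by (p, q) + (p, b) + (a, q), and
  Cauchy-Schwarz bounds each term by a null sequence.\<close>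

lemma L2_inner_tendsto:
  assumes "\<And>n. u n \<in> L2_space \<Omega>" "\<And>n. v n \<in> L2_space \<Omega>" "a \<in> L2_space \<Omega>" "b \<in> L2_space \<Omega>"
    and u: "(\<lambda>n. L2_norm \<Omega> (\<lambda>x. u n x - a x)) \<longlonglongrightarrow> 0"
    and v: "(\<lambda>n. L2_norm \<Omega> (\<lambda>x. v n x - b x)) \<longlonglongrightarrow> 0"
  shows "(\<lambda>n. LINT x|lebesgue_on \<Omega>. u n x \<bullet> v n x) \<longlonglongrightarrow> (LINT x|lebesgue_on \<Omega>. a x \<bullet> b x)"
proof -
  let ?I = "\<lambda>u v. LINT x|lebesgue_on \<Omega>. u x \<bullet> v x"
  let ?p = "\<lambda>n x. u n x - a x" and ?q = "\<lambda>n x. v n x - b x"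
  have p: "?p n \<in> L2_space \<Omega>" "?q n \<in> L2_space \<Omega>" for n
    by (intro L2_space_diff assms)+
  have eq: "?I (u n) (v n) - ?I a b = ?I (?p n) (?q n) + ?I (?p n) b + ?I a (?q n)" for n
  proof -
    have "?I (u n) (v n) - ?I a b = (LINT x|lebesgue_on \<Omega>. u n x \<bullet> v n x - a x \<bullet> b x)"
      by (intro Bochner_Integration.integral_diff[symmetric] L2_space_inner_integrable assms)
    also have "\<dots> = (LINT x|lebesgue_on \<Omega>. (?p n x \<bullet> ?q n x + ?p n x \<bullet> b x) + a x \<bullet> ?q n x)"
      by (intro Bochner_Integration.integral_cong) (simp_all add: algebra_simps)
    also have "\<dots> = (LINT x|lebesgue_on \<Omega>. ?p n x \<bullet> ?q n x + ?p n x \<bullet> b x) + ?I a (?q n)"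
      by (intro Bochner_Integration.integral_add Bochner_Integration.integrable_add
          L2_space_inner_integrable assms p)
    also have "(LINT x|lebesgue_on \<Omega>. ?p n x \<bullet> ?q n x + ?p n x \<bullet> b x) = ?I (?p n) (?q n) + ?I (?p n) b"
      by (intro Bochner_Integration.integral_add L2_space_inner_integrable assms p)
    finally show ?thesis .
  qed
  have "norm (?I (u n) (v n) - ?I a b) \<le> L2_norm \<Omega> (?p n) * L2_norm \<Omega> (?q n)
      + L2_norm \<Omega> (?p n) * L2_norm \<Omega> b + L2_norm \<Omega> a * L2_norm \<Omega> (?q n)" for n
    unfolding eq real_norm_def
    using L2_Cauchy_Schwarz[OF p(1,2), of n n] L2_Cauchy_Schwarz[OF p(1)[of n] assms(4)]
      L2_Cauchy_Schwarz[OF assms(3) p(2)[of n]] by linarith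
  then have bound: "\<forall>\<^sub>F n in sequentially. norm (?I (u n) (v n) - ?I a b) \<le> L2_norm \<Omega> (?p n) * L2_norm \<Omega> (?q n)
      + L2_norm \<Omega> (?p n) * L2_norm \<Omega> b + L2_norm \<Omega> a * L2_norm \<Omega> (?q n)"
    by (intro always_eventually allI)
  have "(\<lambda>n. L2_norm \<Omega> (?p n) * L2_norm \<Omega> (?q n)
      + L2_norm \<Omega> (?p n) * L2_norm \<Omega> b + L2_norm \<Omega> a * L2_norm \<Omega> (?q n))
      \<longlonglongrightarrow> 0 * 0 + 0 * L2_norm \<Omega> b + L2_norm \<Omega> a * 0"
    by (intro tendsto_add tendsto_mult tendsto_const u v)
  then have "(\<lambda>n. L2_norm \<Omega> (?p n) * L2_norm \<Omega> (?q n)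
      + L2_norm \<Omega> (?p n) * L2_norm \<Omega> b + L2_norm \<Omega> a * L2_norm \<Omega> (?q n)) \<longlonglongrightarrow> 0"
    by simp
  then have "(\<lambda>n. ?I (u n) (v n) - ?I a b) \<longlonglongrightarrow> 0"
    by (rule Lim_null_comparison[OF bound])
  then show ?thesis by (simp add: LIM_zero_iff)
qed

section \<open>Riesz-Fischer: completeness of L2\<close>

definition L2_Cauchy :: "'a::euclidean_space set \<Rightarrow> (nat \<Rightarrow> 'a \<Rightarrow> 'b::euclidean_space) \<Rightarrow> bool" where
  "L2_Cauchy \<Omega> u \<longleftrightarrow> (\<forall>e>0. \<exists>N. \<forall>m\<ge>N. \<forall>n\<ge>N. L2_norm \<Omega> (\<lambda>x. u m x - u n x) < e)"

text \<open>Fatou's lemma makes the L2 norm lower semicontinuous under almost everywhere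
  convergence. The bounds start at N because the Cauchy property supplies them only from some index
  on.\<close>

lemma L2_norm_le_Fatou:
  assumes [measurable]: "\<And>n. v n \<in> borel_measurable (lebesgue_on \<Omega>)" "w \<in> borel_measurable (lebesgue_on \<Omega>)"
    and v: "\<And>n. n \<ge> N \<Longrightarrow> v n \<in> L2_space \<Omega>" "\<And>n. n \<ge> N \<Longrightarrow> L2_norm \<Omega> (v n) \<le> e"
    and lim: "AE x in lebesgue_on \<Omega>. (\<lambda>n. v n x) \<longlonglongrightarrow> w x"
  shows "w \<in> L2_space \<Omega> \<and> L2_norm \<Omega> w \<le> e"
proof -
  have e: "0 \<le> e" using v(2)[of N] L2_norm_nonneg[of \<Omega> "v N"] by linarith
  have nn: "(\<integral>\<^sup>+x. ennreal ((norm (v n x))\<^sup>2) \<partial>lebesgue_on \<Omega>) \<le> ennreal (e\<^sup>2)" if "n \<ge> N" for n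
  proof -
    have "(\<integral>\<^sup>+x. ennreal ((norm (v n x))\<^sup>2) \<partial>lebesgue_on \<Omega>) = ennreal ((L2_norm \<Omega> (v n))\<^sup>2)"
      unfolding L2_norm_power2 by (rule nn_integral_eq_integral[OF L2_spaceD(2)[OF v(1)[OF that]]]) simp
    also have "\<dots> \<le> ennreal (e\<^sup>2)"
      by (intro ennreal_leI power_mono v(2) that) simp
    finally show ?thesis .
  qed
  have "(\<integral>\<^sup>+x. ennreal ((norm (w x))\<^sup>2) \<partial>lebesgue_on \<Omega>)
      = (\<integral>\<^sup>+x. liminf (\<lambda>n. ennreal ((norm (v n x))\<^sup>2)) \<partial>lebesgue_on \<Omega>)"
  proof (rule nn_integral_cong_AE, use lim in eventually_elim)
    fix x assume "(\<lambda>n. v n x) \<longlonglongrightarrow> w x"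
    then have "(\<lambda>n. ennreal ((norm (v n x))\<^sup>2)) \<longlonglongrightarrow> ennreal ((norm (w x))\<^sup>2)"
      by (intro tendsto_ennrealI tendsto_power tendsto_norm)
    then show "ennreal ((norm (w x))\<^sup>2) = liminf (\<lambda>n. ennreal ((norm (v n x))\<^sup>2))"
      by (intro lim_imp_Liminf[symmetric]) auto
  qed
  also have "\<dots> \<le> liminf (\<lambda>n. \<integral>\<^sup>+x. ennreal ((norm (v n x))\<^sup>2) \<partial>lebesgue_on \<Omega>)"
    by (rule nn_integral_liminf) measurable
  \<comment> \<open>An eventual bound on the integrals bounds their upper limit directly.\<close>
  also have "\<dots> \<le> limsup (\<lambda>n. \<integral>\<^sup>+x. ennreal ((norm (v n x))\<^sup>2) \<partial>lebesgue_on \<Omega>)"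
    by (rule Liminf_le_Limsup) simp
  also have "\<dots> \<le> ennreal (e\<^sup>2)"
    by (rule Limsup_bounded) (auto simp: eventually_sequentially intro!: exI[of _ N] nn)
  finally have le: "(\<integral>\<^sup>+x. ennreal ((norm (w x))\<^sup>2) \<partial>lebesgue_on \<Omega>) \<le> ennreal (e\<^sup>2)" .
  then have int: "integrable (lebesgue_on \<Omega>) (\<lambda>x. (norm (w x))\<^sup>2)"
    by (intro integrableI_bounded) (auto simp: le_less_trans)
  have "(L2_norm \<Omega> w)\<^sup>2 \<le> e\<^sup>2"
    using le nn_integral_eq_integral[OF int] unfolding L2_norm_power2 by simp
  then show ?thesis
    using int e by (auto simp: L2_space_def intro: power2_le_imp_le)
qed

text \<open>Along a subsequence whose k-th increment has L2 norm at most 2^-k, the increments are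
  summable in L1 because the measure is finite. Their pointwise sum is then finite almost
  everywhere, and the telescoping series converges there.\<close>

lemma L2_Cauchy_subseq_AE:
  assumes fin: "\<Omega> \<in> lmeasurable" and u: "\<And>n. u n \<in> L2_space \<Omega>" and C: "L2_Cauchy \<Omega> u"
  shows "\<exists>r. strict_mono r \<and> (AE x in lebesgue_on \<Omega>. convergent (\<lambda>n. u (r n) x))"
proof -
  interpret finite_measure "lebesgue_on \<Omega>"
    by (rule finite_measure_lebesgue_on) fact
  note [measurable] = L2_spaceD(1)[OF u]
  have "\<exists>N. \<forall>m\<ge>N. \<forall>n\<ge>N. L2_norm \<Omega> (\<lambda>x. u m x - u n x) < (1/2)^k" for k
    using C unfolding L2_Cauchy_def by simp
  then obtain N where N: "\<And>k m n. m \<ge> N k \<Longrightarrow> n \<ge> N k \<Longrightarrow> L2_norm \<Omega> (\<lambda>x. u m x - u n x) < (1/2)^k"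
    by metis
  have "\<exists>r. strict_mono r \<and> (\<forall>k. r k \<ge> N k)"
  proof -
    \<comment> \<open>Each new index passes its predecessor as well as the threshold of its own
      level, so one recursion yields monotonicity and \<open>N k \<le> r k\<close>.\<close>
    define r where "r = rec_nat (N 0) (\<lambda>k s. Suc (max s (N (Suc k))))"
    have "r k < r (Suc k)" for k by (simp add: r_def)
    moreover have "N k \<le> r k" for k by (cases k) (simp_all add: r_def)
    ultimately show ?thesis by (auto simp: strict_mono_Suc_iff)
  qed
  then obtain r where r: "strict_mono r" "\<And>k. r k \<ge> N k" by auto
  define d where "d k x = norm (u (r (Suc k)) x - u (r k) x)" for k x
  have dL2: "d k \<in> L2_space \<Omega>" for k
    using L2_space_diff[OF u u, of "r (Suc k)" "r k"] unfolding d_def[abs_def] by (simp add: L2_space_def)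
  have dn: "L2_norm \<Omega> (d k) \<le> (1/2)^k" for k
  proof -
    have "r (Suc k) \<ge> r k" using r(1) by (simp add: strict_mono_less_eq)
    then have "L2_norm \<Omega> (\<lambda>x. u (r (Suc k)) x - u (r k) x) \<le> (1/2)^k"
      using N[of k "r (Suc k)" "r k"] r(2)[of k] by simp
    then show ?thesis by (simp add: d_def L2_norm_def)
  qed
  \<comment> \<open>Pairing with the constant 1 turns L2 bounds into L1 bounds.\<close>
  have one: "(\<lambda>x. 1::real) \<in> L2_space \<Omega>"
    by (rule L2_space_bounded[OF fin, of _ 1]) auto
  have dint: "integrable (lebesgue_on \<Omega>) (d k)" for k
    using L2_space_inner_integrable[OF dL2 one, of k] by simp
  have dL1: "(LINT x|lebesgue_on \<Omega>. d k x) \<le> (1/2)^k * L2_norm \<Omega> (\<lambda>x::'a. 1::real)" for k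
  proof -
    have "(LINT x|lebesgue_on \<Omega>. d k x) \<le> L2_norm \<Omega> (d k) * L2_norm \<Omega> (\<lambda>x::'a. 1::real)"
      using L2_Cauchy_Schwarz[OF dL2[of k] one] by simp
    also have "\<dots> \<le> (1/2)^k * L2_norm \<Omega> (\<lambda>x::'a. 1::real)"
      by (intro mult_right_mono dn) simp
    finally show ?thesis .
  qed
  note [measurable] = L2_spaceD(1)[OF dL2]
  have sm: "summable (\<lambda>k. (1/2::real)^k * L2_norm \<Omega> (\<lambda>x::'a. 1::real))"
    by (intro summable_mult2 summable_geometric) simp
  have "(\<integral>\<^sup>+x. (\<Sum>k. ennreal (d k x)) \<partial>lebesgue_on \<Omega>) = (\<Sum>k. \<integral>\<^sup>+x. ennreal (d k x) \<partial>lebesgue_on \<Omega>)"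
    by (rule nn_integral_suminf) measurable
  also have "\<dots> = (\<Sum>k. ennreal (LINT x|lebesgue_on \<Omega>. d k x))"
    by (intro suminf_cong nn_integral_eq_integral dint) (simp add: d_def)
  also have "\<dots> \<le> (\<Sum>k. ennreal ((1/2)^k * L2_norm \<Omega> (\<lambda>x::'a. 1::real)))"
    by (intro suminf_le ennreal_leI dL1) auto
  also have "\<dots> < \<infinity>"
    by (subst suminf_ennreal2[OF _ sm]) auto
  finally have "(\<integral>\<^sup>+x. (\<Sum>k. ennreal (d k x)) \<partial>lebesgue_on \<Omega>) \<noteq> \<infinity>" by simp
  then have "AE x in lebesgue_on \<Omega>. (\<Sum>k. ennreal (d k x)) \<noteq> \<infinity>"
    by (intro nn_integral_noteq_infinite) measurable
  then have "AE x in lebesgue_on \<Omega>. convergent (\<lambda>n. u (r n) x)"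
  proof eventually_elim
    fix x assume "(\<Sum>k. ennreal (d k x)) \<noteq> \<infinity>"
    then have "summable (\<lambda>k. norm (u (r (Suc k)) x - u (r k) x))"
      using summable_suminf_not_top[of "\<lambda>k. d k x"] by (simp add: d_def)
    then have "summable (\<lambda>k. u (r (Suc k)) x - u (r k) x)"
      by (rule summable_norm_cancel)
    then have "convergent (\<lambda>n. u (r n) x - u (r 0) x)"
      by (simp add: summable_iff_convergent sum_lessThan_telescope[of "\<lambda>k. u (r k) x"])
    from convergent_add[OF this convergent_const[of "u (r 0) x"]]
    show "convergent (\<lambda>n. u (r n) x)" by simp
  qed
  with r(1) show ?thesis by blast
qed

theorem L2_complete:
  assumes fin: "\<Omega> \<in> lmeasurable" and u: "\<And>n. u n \<in> L2_space \<Omega>" and C: "L2_Cauchy \<Omega> u"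
  shows "\<exists>w\<in>L2_space \<Omega>. (\<lambda>n. L2_norm \<Omega> (\<lambda>x. u n x - w x)) \<longlonglongrightarrow> 0"
proof -
  obtain r where r: "strict_mono r" and conv: "AE x in lebesgue_on \<Omega>. convergent (\<lambda>n. u (r n) x)"
    using L2_Cauchy_subseq_AE[OF assms] by blast
  note [measurable] = L2_spaceD(1)[OF u]
  \<comment> \<open>Where the sequence diverges, \<open>lim\<close> has an unspecified value; that
    set is null, and \<open>w\<close> is measurable all the same.\<close>
  define w where "w x = lim (\<lambda>n. u (r n) x)" for x
  have [measurable]: "w \<in> borel_measurable (lebesgue_on \<Omega>)"
    unfolding w_def by measurable
  have lim: "AE x in lebesgue_on \<Omega>. (\<lambda>n. u (r n) x) \<longlonglongrightarrow> w x"
    using conv by eventually_elim (simp add: w_def convergent_LIMSEQ_iff)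
  \<comment> \<open>The index m stays fixed while the other one runs to infinity along
    \<open>r\<close>; the strict Cauchy bound becomes a weak one in the limit.\<close>
  have key: "(\<lambda>x. u m x - w x) \<in> L2_space \<Omega> \<and> L2_norm \<Omega> (\<lambda>x. u m x - w x) \<le> e"
    if N: "\<And>m n. m \<ge> N \<Longrightarrow> n \<ge> N \<Longrightarrow> L2_norm \<Omega> (\<lambda>x. u m x - u n x) < e" and m: "m \<ge> N" for m N e
  proof (rule L2_norm_le_Fatou[where v="\<lambda>n x. u m x - u (r n) x" and N=N])
    show "L2_norm \<Omega> (\<lambda>x. u m x - u (r n) x) \<le> e" if "n \<ge> N" for n
      using N[OF m, of "r n"] seq_suble[OF r, of n] that by simp
    show "AE x in lebesgue_on \<Omega>. (\<lambda>n. u m x - u (r n) x) \<longlonglongrightarrow> u m x - w x"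
      using lim by eventually_elim (intro tendsto_diff tendsto_const)
  qed (auto intro!: L2_space_diff u)
  have cau: "\<exists>N. \<forall>m\<ge>N. \<forall>n\<ge>N. L2_norm \<Omega> (\<lambda>x. u m x - u n x) < e" if "e > 0" for e
    using C that unfolding L2_Cauchy_def by blast
  obtain N1 where "\<forall>m\<ge>N1. \<forall>n\<ge>N1. L2_norm \<Omega> (\<lambda>x. u m x - u n x) < 1"
    using cau[of 1] by auto
  then have "(\<lambda>x. u N1 x - w x) \<in> L2_space \<Omega>"
    using key[of N1 1 N1] by blast
  then have w: "w \<in> L2_space \<Omega>"
    using L2_space_diff[OF u[of N1], of "\<lambda>x. u N1 x - w x"] by simp
  have "(\<lambda>n. L2_norm \<Omega> (\<lambda>x. u n x - w x)) \<longlonglongrightarrow> 0"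
  proof (rule LIMSEQ_I)
    fix e :: real assume "e > 0"
    then obtain N where N: "\<forall>m\<ge>N. \<forall>n\<ge>N. L2_norm \<Omega> (\<lambda>x. u m x - u n x) < e/2"
      using cau[of "e/2"] by auto
    show "\<exists>no. \<forall>n\<ge>no. norm (L2_norm \<Omega> (\<lambda>x. u n x - w x) - 0) < e"
    proof (intro exI[of _ N] allI impI)
      fix n assume "n \<ge> N"
      then have "L2_norm \<Omega> (\<lambda>x. u n x - w x) \<le> e/2"
        using key[of N "e/2" n] N by blast
      then show "norm (L2_norm \<Omega> (\<lambda>x. u n x - w x) - 0) < e"
        using \<open>e > 0\<close> by simp
    qed
  qed
  with w show ?thesis by blast
qed

section \<open>Test functions\<close>

lemma has_derivative_partial_deriv:
  "\<phi> differentiable (at x) \<Longrightarrow> (\<phi> has_derivative (\<lambda>h. \<Sum>i\<in>Basis. (h \<bullet> i) * partial_deriv i \<phi> x)) (at x)"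
proof -
  assume "\<phi> differentiable (at x)"
  then have d: "(\<phi> has_derivative frechet_derivative \<phi> (at x)) (at x)"
    by (simp add: frechet_derivative_works)
  then interpret linear "frechet_derivative \<phi> (at x)"
    by (rule has_derivative_linear)
  have "frechet_derivative \<phi> (at x) h = (\<Sum>i\<in>Basis. (h \<bullet> i) * partial_deriv i \<phi> x)" for h
  proof -
    have "frechet_derivative \<phi> (at x) h = frechet_derivative \<phi> (at x) (\<Sum>i\<in>Basis. (h \<bullet> i) *\<^sub>R i)"
      by (simp add: euclidean_representation)
    also have "\<dots> = (\<Sum>i\<in>Basis. (h \<bullet> i) * partial_deriv i \<phi> x)"
      by (simp add: sum scale partial_deriv_def)
    finally show ?thesis .
  qed
  then have "frechet_derivative \<phi> (at x) = (\<lambda>h. \<Sum>i\<in>Basis. (h \<bullet> i) * partial_deriv i \<phi> x)"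
    by (rule ext)
  with d show ?thesis by simp
qed

section \<open>Calculus in the classes C^k\<close>

lemma partial_deriv_eq:
  "(\<phi> has_derivative D) (at x) \<Longrightarrow> partial_deriv i \<phi> x = D i"
  by (simp add: partial_deriv_def frechet_derivative_at[symmetric])

lemma C_k_continuous: "C_k k \<phi> \<Longrightarrow> continuous_on UNIV \<phi>"
  by (cases k) (auto intro!: continuous_at_imp_continuous_on differentiable_imp_continuous_within)

text \<open>The recursion speaks only of derivatives, so lowering the order takes an induction whose
  base is that differentiability implies continuity. The product rule below needs it for the
  undifferentiated factors.\<close>

lemma C_k_SucD: "C_k (Suc k) \<phi> \<Longrightarrow> C_k k \<phi>"
proof (induction k arbitrary: \<phi>)
  case 0
  then show ?case using C_k_continuous[of "Suc 0" \<phi>] by (simp del: C_k.simps(2))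
next
  case (Suc k)
  then show ?case by (metis C_k.simps(2))
qed

lemma C_k_const: "C_k k (\<lambda>x. c)"
proof (induction k arbitrary: c)
  case (Suc k)
  have "partial_deriv i (\<lambda>x. c) = (\<lambda>x. 0)" for i :: 'a
    by (rule ext, subst partial_deriv_eq[OF has_derivative_const]) simp
  with Suc show ?case by simp
qed simp

lemma C_k_add: "C_k k \<phi> \<Longrightarrow> C_k k \<psi> \<Longrightarrow> C_k k (\<lambda>x. \<phi> x + \<psi> x)"
proof (induction k arbitrary: \<phi> \<psi>)
  case 0
  then show ?case by (auto intro: continuous_intros)
next
  case (Suc k)
  have "partial_deriv i (\<lambda>x. \<phi> x + \<psi> x) = (\<lambda>x. partial_deriv i \<phi> x + partial_deriv i \<psi> x)" for i
  proof
    fix x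
    have "(\<phi> has_derivative frechet_derivative \<phi> (at x)) (at x)" "(\<psi> has_derivative frechet_derivative \<psi> (at x)) (at x)"
      using Suc.prems by (simp_all add: frechet_derivative_works)
    from partial_deriv_eq[OF has_derivative_add[OF this]]
    show "partial_deriv i (\<lambda>x. \<phi> x + \<psi> x) x = partial_deriv i \<phi> x + partial_deriv i \<psi> x"
      by (simp add: partial_deriv_def)
  qed
  with Suc show ?case by simp
qed

lemma partial_deriv_mult:
  assumes "\<phi> differentiable (at x)" "\<psi> differentiable (at x)"
  shows "partial_deriv i (\<lambda>x. \<phi> x * \<psi> x) x = \<phi> x * partial_deriv i \<psi> x + partial_deriv i \<phi> x * \<psi> x"
proof -
  have "(\<phi> has_derivative frechet_derivative \<phi> (at x)) (at x)" "(\<psi> has_derivative frechet_derivative \<psi> (at x)) (at x)"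
    using assms by (simp_all add: frechet_derivative_works)
  from partial_deriv_eq[OF has_derivative_mult[OF this]] show ?thesis
    by (simp add: partial_deriv_def)
qed

lemma C_k_mult: "C_k k \<phi> \<Longrightarrow> C_k k \<psi> \<Longrightarrow> C_k k (\<lambda>x. \<phi> x * \<psi> x)"
proof (induction k arbitrary: \<phi> \<psi>)
  case 0
  then show ?case by (auto intro: continuous_intros)
next
  case (Suc k)
  have "partial_deriv i (\<lambda>x. \<phi> x * \<psi> x) = (\<lambda>x. \<phi> x * partial_deriv i \<psi> x + partial_deriv i \<phi> x * \<psi> x)" for i
    using Suc.prems by (intro ext partial_deriv_mult) auto
  moreover have "C_k k \<phi>" "C_k k \<psi>" using Suc.prems C_k_SucD by blast+
  ultimately show ?case using Suc by (auto intro!: C_k_add)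
qed

lemma C_k_prod: "(\<And>i. i \<in> I \<Longrightarrow> C_k k (\<phi> i)) \<Longrightarrow> C_k k (\<lambda>x. \<Prod>i\<in>I. \<phi> i x)"
  by (induction I rule: infinite_finite_induct) (simp_all add: C_k_const C_k_mult)

text \<open>The family h is closed under differentiation, so a partial derivative of a member
  composed with an affine map is the next member times a constant, and the induction on k closes for
  all m at once.\<close>

lemma C_k_compose_affine:
  assumes "\<And>m t. (h m has_real_derivative h (Suc m) t) (at t)"
  shows "C_k k (\<lambda>x. h m (a * (x \<bullet> v) + b))"
proof (induction k arbitrary: m)
  have d: "((\<lambda>x. h m (a * (x \<bullet> v) + b)) has_derivative (\<lambda>y. h (Suc m) (a * (x \<bullet> v) + b) * (a * (y \<bullet> v)))) (at x)" for m x
  proof -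
    have "((\<lambda>x. a * (x \<bullet> v) + b) has_derivative (\<lambda>y. a * (y \<bullet> v))) (at x)"
      by (auto intro!: derivative_eq_intros)
    from has_derivative_compose[OF this assms[of m, unfolded has_field_derivative_def]]
    show ?thesis .
  qed
  {
    case 0
    show ?case
      by (auto intro!: continuous_at_imp_continuous_on has_derivative_continuous[OF d])
  next
    case (Suc k)
    have "partial_deriv i (\<lambda>x. h m (a * (x \<bullet> v) + b)) = (\<lambda>x. h (Suc m) (a * (x \<bullet> v) + b) * (a * (i \<bullet> v)))" for i
      by (rule ext, subst partial_deriv_eq[OF d]) simp
    with Suc d show ?case
      by (auto simp: differentiable_def intro!: C_k_mult C_k_const)
  }
qed

text \<open>\<open>exp_recip m\<close> is the \<open>m\<close>-th derivative of \<open>exp_recip 0\<close>: since \<open>(1 / t)' = - (1 / t)\<^sup>2\<close>,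
  differentiating \<open>p (1 / t) * exp (- 1 / t)\<close> replaces \<open>p\<close> by \<open>X\<^sup>2 * (p - p')\<close>.\<close>

definition exp_recip :: "nat \<Rightarrow> real \<Rightarrow> real" where
  "exp_recip m t = (if t > 0 then
     poly (((\<lambda>p. [:0, 0, 1:] * (p - pderiv p)) ^^ m) 1) (1 / t) * exp (- (1 / t)) else 0)"

text \<open>Used at y = 1 / t, where it makes the difference quotients of \<open>exp_recip m\<close>
  at 0 tend to 0 from the right.\<close>

lemma poly_times_exp_neg_tendsto_0: "((\<lambda>y. poly p y * exp (- y)) \<longlongrightarrow> (0::real)) at_top"
proof -
  have "((\<lambda>y. \<Sum>i\<le>degree p. coeff p i * (y ^ i / exp y)) \<longlongrightarrow> (\<Sum>i\<le>degree p. coeff p i * 0)) at_top"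
    by (intro tendsto_sum tendsto_mult tendsto_const tendsto_power_div_exp_0)
  then show ?thesis
    by (simp add: poly_altdef sum_distrib_right exp_minus divide_inverse mult.assoc)
qed

lemma exp_recip_has_derivative: "(exp_recip m has_real_derivative exp_recip (Suc m) t) (at t)"
proof -
  define P where "P = (\<lambda>m. ((\<lambda>p::real poly. [:0, 0, 1:] * (p - pderiv p)) ^^ m) 1)"
  have P: "P (Suc m) = [:0, 0, 1:] * (P m - pderiv (P m))" for m by (simp add: P_def)
  have e: "exp_recip m t = (if t > 0 then poly (P m) (1 / t) * exp (- (1 / t)) else 0)" for m t
    by (simp add: exp_recip_def P_def)
  consider "t > 0" | "t < 0" | "t = 0" by linarith
  then show ?thesis
  proof cases
    case 1
    have "((\<lambda>t. poly (P m) (1 / t) * exp (- (1 / t))) has_real_derivative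
        poly (P (Suc m)) (1 / t) * exp (- (1 / t))) (at t)"
      using 1 unfolding P
      by (auto intro!: derivative_eq_intros DERIV_chain2[OF poly_DERIV]
          simp: field_simps power2_eq_square)
    then show ?thesis
      by (rule DERIV_cong_ev[OF refl _ _, THEN iffD1, rotated 2])
         (use 1 in \<open>auto simp: e eventually_nhds intro!: exI[of _ "{0<..}"]\<close>)
  next
    case 2
    have "((\<lambda>t. 0) has_real_derivative 0) (at t)" by simp
    then show ?thesis
      by (rule DERIV_cong_ev[OF refl _ _, THEN iffD1, rotated 2])
         (use 2 in \<open>auto simp: e eventually_nhds intro!: exI[of _ "{..<0}"]\<close>)
  next
    case 3
    have "((\<lambda>h. exp_recip m h / h) \<longlongrightarrow> 0) (at 0)"
    proof (rule filterlim_split_at)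
      show "((\<lambda>h. exp_recip m h / h) \<longlongrightarrow> 0) (at_left 0)"
        by (rule tendsto_eventually) (auto simp: e eventually_at_filter intro!: always_eventually)
      \<comment> \<open>Dividing by h multiplies the polynomial in 1 / h by its variable, hence the
        \<open>pCons 0\<close>.\<close>
      have "((\<lambda>h. poly (pCons 0 (P m)) (inverse h) * exp (- inverse h)) \<longlongrightarrow> 0) (at_right (0::real))"
        by (rule filterlim_compose[OF poly_times_exp_neg_tendsto_0 filterlim_inverse_at_top_right])
      then show "((\<lambda>h. exp_recip m h / h) \<longlongrightarrow> 0) (at_right 0)"
        by (rule Lim_transform_eventually)
           (auto simp: e eventually_at_filter field_simps intro!: always_eventually)
    qed
    then show ?thesis using 3 by (simp add: DERIV_def e)
  qed
qed

text \<open>Scaling the argument by \<open>c\<close> takes the \<open>c\<close>-th root of \<open>exp_recip 0\<close>, so the bumps increase to the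
  indicator of the open box as \<open>c \<rightarrow> \<infinity>\<close>.\<close>

definition box_bump :: "real \<Rightarrow> 'a::euclidean_space \<Rightarrow> 'a \<Rightarrow> 'a \<Rightarrow> real" where
  "box_bump c a b x = (\<Prod>i\<in>Basis. exp_recip 0 (c * (x \<bullet> i - a \<bullet> i)) * exp_recip 0 (c * (b \<bullet> i - x \<bullet> i)))"

lemma exp_recip_0: "exp_recip 0 t = (if t > 0 then exp (- (1 / t)) else 0)"
  by (simp add: exp_recip_def)

lemma C_k_box_bump: "C_k k (box_bump c a b)"
proof -
  have "C_k k (\<lambda>x. exp_recip 0 (c * (x \<bullet> i) + (- c * (a \<bullet> i))))"
       "C_k k (\<lambda>x. exp_recip 0 (- c * (x \<bullet> i) + c * (b \<bullet> i)))" for i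
    by (intro C_k_compose_affine exp_recip_has_derivative)+
  then show ?thesis unfolding box_bump_def[abs_def]
    by (intro C_k_prod C_k_mult) (simp_all add: algebra_simps)
qed

lemma box_bump_eq_0_iff: "c > 0 \<Longrightarrow> box_bump c a b x = 0 \<longleftrightarrow> x \<notin> box a b"
proof -
  assume "c > 0"
  then have "exp_recip 0 (c * (x \<bullet> i - a \<bullet> i)) * exp_recip 0 (c * (b \<bullet> i - x \<bullet> i)) = 0
      \<longleftrightarrow> \<not> (a \<bullet> i < x \<bullet> i \<and> x \<bullet> i < b \<bullet> i)" for i
    by (auto simp: exp_recip_0 zero_less_mult_iff)
  then show ?thesis by (simp add: box_bump_def mem_box)
qed

lemma box_bump_bounds: "0 \<le> box_bump c a b x" "box_bump c a b x \<le> 1"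
  by (auto simp: box_bump_def exp_recip_0 intro!: prod_nonneg prod_le_1 mult_nonneg_nonneg mult_le_one)

lemma box_bump_tendsto_indicator:
  "(\<lambda>n. box_bump (real (Suc n)) a b x) \<longlonglongrightarrow> indicator (box a b) x"
proof (cases "x \<in> box a b")
  case True
  have *: "(\<lambda>n. exp_recip 0 (real (Suc n) * t)) \<longlonglongrightarrow> 1" if "t > 0" for t
  proof -
    have "(\<lambda>n. exp (- (inverse (real (Suc n)) * (1 / t)))) \<longlonglongrightarrow> exp (- (0 * (1 / t)))"
      by (intro tendsto_intros LIMSEQ_inverse_real_of_nat)
    moreover have "exp_recip 0 (s * t) = exp (- (inverse s * (1 / t)))" if "s > 0" for s
      using that \<open>t > 0\<close> by (simp add: exp_recip_0 field_simps)
    ultimately show ?thesis by (simp del: of_nat_Suc)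
  qed
  have "(\<lambda>n. box_bump (real (Suc n)) a b x) \<longlonglongrightarrow> (\<Prod>i\<in>(Basis::'a set). 1 * 1)"
    unfolding box_bump_def
    by (intro tendsto_prod tendsto_mult *) (use True in \<open>auto simp: mem_box\<close>)
  with True show ?thesis by simp
next
  case False
  then have "box_bump (real (Suc n)) a b x = 0" for n
    by (subst box_bump_eq_0_iff) auto
  with False show ?thesis by simp
qed

text \<open>The bump is nonzero on the whole open box, so it is the closed box that has to fit into
  \<Omega>.\<close>

lemma box_bump_test_function:
  assumes "c > 0" "cbox a b \<subseteq> \<Omega>"
  shows "box_bump c a b \<in> test_functions \<Omega>"
proof -
  have "{x. box_bump c a b x \<noteq> 0} = box a b"
    using box_bump_eq_0_iff[OF assms(1)] by auto
  moreover have "closure (box a b) \<subseteq> cbox a b"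
    by (intro closure_minimal box_subset_cbox closed_cbox)
  moreover have "compact (closure (box a b))"
    by (simp add: bounded_box compact_closure)
  ultimately show ?thesis
    using assms C_k_box_bump by (auto simp: test_functions_def)
qed

section \<open>Compactly supported \<open>C\<^sup>1\<close> functions\<close>

definition grad :: "('a::euclidean_space \<Rightarrow> real) \<Rightarrow> 'a \<Rightarrow> 'a" where
  "grad \<phi> x = (\<Sum>i\<in>Basis. partial_deriv i \<phi> x *\<^sub>R i)"

lemma grad_inner_Basis: "i \<in> Basis \<Longrightarrow> grad \<phi> x \<bullet> i = partial_deriv i \<phi> x"
  by (simp add: grad_def inner_sum_left_Basis)

lemma has_derivative_grad:
  "\<phi> differentiable (at x) \<Longrightarrow> (\<phi> has_derivative (\<lambda>h. h \<bullet> grad \<phi> x)) (at x)"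
  using has_derivative_partial_deriv[of \<phi> x]
  by (simp add: grad_def inner_sum_right mult.commute)

lemma has_real_derivative_along_line:
  assumes "\<And>x. \<phi> differentiable (at x)"
  shows "((\<lambda>t. \<phi> (x + t *\<^sub>R v)) has_real_derivative (v \<bullet> grad \<phi> (x + t *\<^sub>R v))) (at t within S)"
proof -
  have "((\<lambda>t. x + t *\<^sub>R v) has_derivative (\<lambda>h. h *\<^sub>R v)) (at t within S)"
    by (auto intro!: derivative_eq_intros)
  from has_derivative_compose[OF this has_derivative_grad[OF assms]]
  show ?thesis by (simp add: has_field_derivative_def mult.commute[of "v \<bullet> _"] mult_commute_abs)
qed

text \<open>K may be larger than the support, which lets a product keep the K of its first factor.
  One derivative suffices for integration by parts and for the translation estimate.\<close>

definition C1_supp :: "'a::euclidean_space set \<Rightarrow> ('a \<Rightarrow> real) \<Rightarrow> bool" where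
  "C1_supp K \<phi> \<longleftrightarrow> compact K \<and> C_k 1 \<phi> \<and> (\<forall>x. x \<notin> K \<longrightarrow> \<phi> x = 0)"

lemma test_function_C1_supp:
  "\<phi> \<in> test_functions \<Omega> \<Longrightarrow> C1_supp (closure {x. \<phi> x \<noteq> 0}) \<phi>"
proof -
  assume *: "\<phi> \<in> test_functions \<Omega>"
  have "\<phi> x = 0" if "x \<notin> closure {x. \<phi> x \<noteq> 0}" for x
    using that closure_subset[of "{x. \<phi> x \<noteq> 0}"] by auto
  moreover from * have "C_k 1 \<phi>" "compact (closure {x. \<phi> x \<noteq> 0})"
    unfolding test_functions_def by blast+
  ultimately show ?thesis
    unfolding C1_supp_def by blast
qed

lemma C1_supp_mult: "C1_supp K \<phi> \<Longrightarrow> C1_supp K' \<psi> \<Longrightarrow> C1_supp K (\<lambda>x. \<phi> x * \<psi> x)"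
  by (auto simp: C1_supp_def simp del: C_k.simps intro: C_k_mult)

lemma C1_suppD:
  assumes "C1_supp K \<phi>"
  shows "\<phi> differentiable (at x)" "continuous_on UNIV \<phi>" "continuous_on UNIV (grad \<phi>)"
    "i \<in> Basis \<Longrightarrow> continuous_on UNIV (partial_deriv i \<phi>)"
    "x \<notin> K \<Longrightarrow> \<phi> x = 0" "x \<notin> K \<Longrightarrow> partial_deriv i \<phi> x = 0" "x \<notin> K \<Longrightarrow> grad \<phi> x = 0"
proof -
  show 1: "\<phi> differentiable (at x)" "x \<notin> K \<Longrightarrow> \<phi> x = 0"
    "i \<in> Basis \<Longrightarrow> continuous_on UNIV (partial_deriv i \<phi>)" for x i
    using assms by (auto simp: C1_supp_def)
  show "continuous_on UNIV \<phi>"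
    using assms C_k_continuous[of 1 \<phi>] by (auto simp: C1_supp_def)
  show "continuous_on UNIV (grad \<phi>)"
    unfolding grad_def[abs_def] by (intro continuous_intros 1)
  show 2: "x \<notin> K \<Longrightarrow> partial_deriv i \<phi> x = 0" for i
  proof -
    assume "x \<notin> K"
    moreover have "open (- K)" using assms by (simp add: C1_supp_def compact_imp_closed open_Compl)
    ultimately have "(\<phi> has_derivative (\<lambda>h. 0)) (at x)"
      using 1 by (intro has_derivative_transform_within_open[OF has_derivative_const, of "- K"]) auto
    then show ?thesis by (rule partial_deriv_eq)
  qed
  then show "x \<notin> K \<Longrightarrow> grad \<phi> x = 0" by (simp add: grad_def)
qed

lemma continuous_compact_support_bounded:
  fixes g :: "'a::euclidean_space \<Rightarrow> 'b::real_normed_vector"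
  assumes "compact K" "continuous_on UNIV g" "\<And>x. x \<notin> K \<Longrightarrow> g x = 0"
  obtains B where "B \<ge> 0" "\<And>x. norm (g x) \<le> B"
proof -
  have "bounded (g ` K)"
    using assms by (intro compact_imp_bounded compact_continuous_image) (auto intro: continuous_on_subset)
  then obtain B where "B > 0" "\<And>x. x \<in> K \<Longrightarrow> norm (g x) \<le> B"
    by (auto simp: bounded_pos)
  then show ?thesis using assms(3) by (intro that[of B]) (force, metis less_imp_le norm_zero)
qed

lemma continuous_compact_support_integrable:
  fixes g :: "'a::euclidean_space \<Rightarrow> 'b::{banach, second_countable_topology}"
  assumes "compact K" "continuous_on UNIV g" "\<And>x. x \<notin> K \<Longrightarrow> g x = 0"
  shows "integrable lborel g"
proof -
  have "integrable lborel (\<lambda>x. indicator K x *\<^sub>R g x)"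
    using assms by (intro borel_integrable_compact) (auto intro: continuous_on_subset)
  moreover have "(\<lambda>x. indicator K x *\<^sub>R g x) = g"
    using assms(3) by (auto simp: fun_eq_iff indicator_def)
  ultimately show ?thesis by simp
qed

section \<open>Translation invariance and integrals of derivatives\<close>

lemma lborel_integral_translate:
  fixes g :: "'a::euclidean_space \<Rightarrow> 'b::{banach, second_countable_topology}"
  assumes "g \<in> borel_measurable borel"
  shows "(LINT x|lborel. g (x + z)) = (LINT x|lborel. g x)"
proof -
  have "(LINT x|lborel. g x) = (LINT x|distr lborel borel ((+) z). g x)"
    by (simp add: lborel_distr_plus)
  also have "\<dots> = (LINT x|lborel. g (z + x))"
    using assms by (intro integral_distr) auto
  finally show ?thesis by (simp add: add.commute)
qed

lemma lborel_nn_integral_translate: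
  fixes g :: "'a::euclidean_space \<Rightarrow> ennreal"
  assumes "g \<in> borel_measurable borel"
  shows "(\<integral>\<^sup>+x. g (x + z) \<partial>lborel) = (\<integral>\<^sup>+x. g x \<partial>lborel)"
proof -
  have "(\<integral>\<^sup>+x. g x \<partial>lborel) = (\<integral>\<^sup>+x. g x \<partial>distr lborel borel ((+) z))"
    by (simp add: lborel_distr_plus)
  also have "\<dots> = (\<integral>\<^sup>+x. g (z + x) \<partial>lborel)"
    using assms by (intro nn_integral_distr) auto
  finally show ?thesis by (simp add: add.commute)
qed

text \<open>By translation invariance every difference quotient integrates to 0, and the quotients
  converge to the derivative under a common integrable bound.\<close>

lemma integral_partial_deriv_eq_0:
  assumes "C1_supp K h" "i \<in> Basis"
  shows "(LINT x|lborel. partial_deriv i h x) = 0"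
proof -
  note D = C1_suppD[OF assms(1)]
  have K: "compact K" using assms(1) by (simp add: C1_supp_def)
  obtain B where B: "B \<ge> 0" "\<And>x. norm (grad h x) \<le> B"
    using continuous_compact_support_bounded[OF K D(3,7)] by blast
  obtain R where R: "\<And>x. x \<in> K \<Longrightarrow> norm x \<le> R"
    using compact_imp_bounded[OF K] by (auto simp: bounded_iff)
  have [measurable]: "h \<in> borel_measurable borel" "partial_deriv i h \<in> borel_measurable borel"
    using D(2,4) assms(2) by (auto intro: borel_measurable_continuous_onI)
  \<comment> \<open>Steps of size at most 1 keep all quotients supported in one ball, of radius R +
    1.\<close>
  define s where "s n = 1 / real (Suc n)" for n
  have s: "0 < s n" "s n \<le> 1" for n by (auto simp: s_def)
  have s0: "s \<longlonglongrightarrow> 0"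
    unfolding s_def[abs_def] using LIMSEQ_inverse_real_of_nat by (simp add: inverse_eq_divide)
  define q where "q n x = (h (x + s n *\<^sub>R i) - h x) / s n" for n x
  have int0: "(LINT x|lborel. q n x) = 0" for n
  proof -
    have "integrable lborel h"
      by (rule continuous_compact_support_integrable[OF K D(2,5)])
    moreover have "integrable lborel (\<lambda>x. h (x + s n *\<^sub>R i))"
    proof -
      have "integrable (distr lborel borel ((+) (s n *\<^sub>R i))) h"
        using \<open>integrable lborel h\<close> by (simp add: lborel_distr_plus)
      then show ?thesis
        by (subst (asm) integrable_distr_eq) (auto simp: add.commute)
    qed
    ultimately show ?thesis
      using lborel_integral_translate[of h "s n *\<^sub>R i"] by (simp add: q_def)
  qed
  have "(\<lambda>n. LINT x|lborel. q n x) \<longlonglongrightarrow> (LINT x|lborel. partial_deriv i h x)"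
  proof (rule integral_dominated_convergence)
    show "partial_deriv i h \<in> borel_measurable lborel" "\<And>n. q n \<in> borel_measurable lborel"
      unfolding q_def[abs_def] by measurable
    show "integrable lborel (\<lambda>x. indicator (cball 0 (R + 1)) x *\<^sub>R B)"
      by (intro borel_integrable_compact) auto
    show "AE x in lborel. (\<lambda>n. q n x) \<longlonglongrightarrow> partial_deriv i h x"
    proof (rule AE_I2)
      fix x
      have "((\<lambda>t. h (x + t *\<^sub>R i)) has_real_derivative (i \<bullet> grad h (x + 0 *\<^sub>R i))) (at 0)"
        by (rule has_real_derivative_along_line[OF D(1)])
      then have "((\<lambda>t. (h (x + t *\<^sub>R i) - h x) / t) \<longlongrightarrow> partial_deriv i h x) (at 0)"
        using grad_inner_Basis[OF assms(2), of h x] by (simp add: DERIV_def inner_commute)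
      moreover have "filterlim s (at 0) sequentially"
        using s0 s(1) by (simp add: filterlim_at less_imp_neq[THEN not_sym])
      ultimately show "(\<lambda>n. q n x) \<longlonglongrightarrow> partial_deriv i h x"
        unfolding q_def by (rule filterlim_compose)
    qed
    show "AE x in lborel. norm (q n x) \<le> indicator (cball 0 (R + 1)) x *\<^sub>R B" for n
    proof (rule AE_I2)
      fix x
      show "norm (q n x) \<le> indicator (cball 0 (R + 1)) x *\<^sub>R B"
      proof (cases "norm x \<le> R + 1")
        case True
        define k where "k t = h (x + t *\<^sub>R i)" for t
        \<comment> \<open>Mean value inequality along the segment, with B bounding the
          gradient.\<close>
        have "norm (k (s n) - k 0) \<le> B * norm (s n - 0)"
        proof (rule field_differentiable_bound[where S=UNIV])
          show "(k has_field_derivative (i \<bullet> grad h (x + t *\<^sub>R i))) (at t within UNIV)" for t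
            unfolding k_def[abs_def] by (rule has_real_derivative_along_line[OF D(1)])
          show "norm (i \<bullet> grad h (x + t *\<^sub>R i)) \<le> B" for t
            using Cauchy_Schwarz_ineq2[of i "grad h (x + t *\<^sub>R i)"] B(2)[of "x + t *\<^sub>R i"] assms(2) by simp
        qed auto
        then show ?thesis using True s(1)[of n] by (simp add: q_def k_def field_simps)
      next
        case False
        have "x \<notin> K" using R[of x] False by auto
        moreover have "x + s n *\<^sub>R i \<notin> K"
        proof
          assume "x + s n *\<^sub>R i \<in> K"
          then have "norm (x + s n *\<^sub>R i) \<le> R" by (rule R)
          moreover have "norm x \<le> norm (x + s n *\<^sub>R i) + norm (s n *\<^sub>R i)"
            using norm_triangle_ineq4[of "x + s n *\<^sub>R i" "s n *\<^sub>R i"] by simp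
          moreover have "norm (s n *\<^sub>R i) \<le> 1" using s[of n] assms(2) by simp
          ultimately show False using False by simp
        qed
        ultimately show ?thesis using D(5) False by (simp add: q_def)
      qed
    qed
  qed
  then show ?thesis using int0 by (simp add: LIMSEQ_const_iff)
qed

text \<open>Bridge from the measure on \<Omega> in the definitions to the Lebesgue-Borel measure on
  the whole space, where translations and Tonelli are available.\<close>

lemma integral_lebesgue_on_eq_lborel:
  fixes h :: "'a::euclidean_space \<Rightarrow> 'b::{banach, second_countable_topology}"
  assumes "\<Omega> \<in> sets lebesgue" "h \<in> borel_measurable borel" "\<And>x. x \<notin> \<Omega> \<Longrightarrow> h x = 0"
  shows "(LINT x|lebesgue_on \<Omega>. h x) = (LINT x|lborel. h x)"
proof -
  have "(LINT x|lebesgue_on \<Omega>. h x) = (LINT x|lebesgue. indicator \<Omega> x *\<^sub>R h x)"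
    using assms(1) by (intro integral_restrict_space) auto
  also have "\<dots> = (LINT x|lebesgue. h x)"
    by (intro Bochner_Integration.integral_cong refl) (use assms(3) in \<open>auto simp: indicator_def\<close>)
  finally show ?thesis using assms(2) by (simp add: integral_completion)
qed

lemma borel_measurable_lebesgue_onI:
  "h \<in> borel_measurable borel \<Longrightarrow> h \<in> borel_measurable (lebesgue_on \<Omega>)"
  by (intro measurable_restrict_space1 measurable_completion) simp

lemma L2_norm_eq_lborel:
  fixes h :: "'a::euclidean_space \<Rightarrow> 'b::euclidean_space"
  assumes "\<Omega> \<in> sets lebesgue" "h \<in> borel_measurable borel" "\<And>x. x \<notin> \<Omega> \<Longrightarrow> h x = 0"
  shows "(L2_norm \<Omega> h)\<^sup>2 = (LINT x|lborel. (norm (h x))\<^sup>2)"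
  unfolding L2_norm_power2 using assms
  by (intro integral_lebesgue_on_eq_lborel) auto

section \<open>L2 modulus of continuity of C^1 functions\<close>

lemma power2_LINT_unit_interval_le:
  fixes g :: "real \<Rightarrow> real"
  assumes "continuous_on UNIV g"
  shows "(LINT t|lebesgue_on {0..1}. g t)\<^sup>2 \<le> (LINT t|lebesgue_on {0..1}. (g t)\<^sup>2)"
proof -
  have g: "g \<in> L2_space {0..1}"
  proof -
    have "integrable (lebesgue_on {0..1}) (\<lambda>t. (g t)\<^sup>2)"
      by (rule continuous_imp_integrable_real)
         (intro continuous_intros continuous_on_subset[OF assms], auto)
    moreover have "g \<in> borel_measurable borel"
      by (rule borel_measurable_continuous_onI[OF assms])
    ultimately show ?thesis by (simp add: L2_space_def borel_measurable_lebesgue_onI)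
  qed
  have one: "(\<lambda>t. 1::real) \<in> L2_space {0..1::real}"
    by (rule L2_space_bounded[of _ _ 1]) auto
  \<comment> \<open>Cauchy-Schwarz against the constant 1, whose norm on the unit interval is
    1.\<close>
  have "\<bar>LINT t|lebesgue_on {0..1}. g t\<bar> \<le> L2_norm {0..1} g * L2_norm {0..1::real} (\<lambda>t. 1::real)"
    using L2_Cauchy_Schwarz[OF g one] by simp
  also have "L2_norm {0..1::real} (\<lambda>t. 1::real) = 1"
    by (simp add: L2_norm_def measure_restrict_space)
  finally have "\<bar>LINT t|lebesgue_on {0..1}. g t\<bar> \<le> \<bar>L2_norm {0..1} g\<bar>" by simp
  then show ?thesis by (simp only: abs_le_square_iff L2_norm_power2 real_norm_def power2_abs)
qed

text \<open>The fundamental theorem of calculus along the segment from x to x + z, with the square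
  moved inside. The right side is an extended nonnegative integral so that Tonelli applies to it
  next.\<close>

lemma power2_diff_le_nn_integral:
  assumes "C1_supp K \<phi>"
  shows "ennreal ((\<phi> (x + z) - \<phi> x)\<^sup>2) \<le>
    (\<integral>\<^sup>+t. ennreal (indicator {0..1} t * (z \<bullet> grad \<phi> (x + t *\<^sub>R z))\<^sup>2) \<partial>lborel)"
proof -
  note D = C1_suppD[OF assms]
  let ?g = "\<lambda>t. z \<bullet> grad \<phi> (x + t *\<^sub>R z)"
  have c: "continuous_on UNIV ?g"
    by (intro continuous_intros continuous_on_compose2[OF D(3)]) auto
  have "(?g has_integral (\<phi> (x + 1 *\<^sub>R z) - \<phi> (x + 0 *\<^sub>R z))) {0..1}"
    by (intro fundamental_theorem_of_calculus)
       (use has_real_derivative_along_line[OF D(1)] in \<open>auto simp: has_real_derivative_iff_has_vector_derivative\<close>)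
  then have "integral {0..1} ?g = \<phi> (x + z) - \<phi> x" by (simp add: integral_unique)
  moreover have "(LINT t|lebesgue_on {0..1}. ?g t) = integral {0..1} ?g"
    by (intro lebesgue_integral_eq_integral continuous_imp_integrable_real)
       (auto intro: continuous_on_subset[OF c])
  ultimately have "(\<phi> (x + z) - \<phi> x)\<^sup>2 \<le> (LINT t|lebesgue_on {0..1}. (?g t)\<^sup>2)"
    using power2_LINT_unit_interval_le[OF c] by simp
  also have "\<dots> = (LINT t|lborel. indicator {0..1} t * (?g t)\<^sup>2)"
  proof -
    have [measurable]: "?g \<in> borel_measurable borel" by (rule borel_measurable_continuous_onI[OF c])
    have "(LINT t|lebesgue_on {0..1}. (?g t)\<^sup>2) = (LINT t|lebesgue_on {0..1}. indicator {0..1} t * (?g t)\<^sup>2)"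
      by (intro Bochner_Integration.integral_cong) auto
    also have "\<dots> = (LINT t|lborel. indicator {0..1} t * (?g t)\<^sup>2)"
      by (intro integral_lebesgue_on_eq_lborel) auto
    finally show ?thesis .
  qed
  also have "ennreal \<dots> = (\<integral>\<^sup>+t. ennreal (indicator {0..1} t * (?g t)\<^sup>2) \<partial>lborel)"
  proof (rule nn_integral_eq_integral[symmetric])
    have "integrable lborel (\<lambda>t. indicator {0..1} t *\<^sub>R (?g t)\<^sup>2)"
      by (intro borel_integrable_compact continuous_intros continuous_on_subset[OF c]) auto
    then show "integrable lborel (\<lambda>t. indicator {0..1} t * (?g t)\<^sup>2)" by simp
  qed auto
  finally show ?thesis by (simp add: ennreal_leI)
qed

text \<open>The pointwise bound is integrated over x and the integrals are exchanged. Translation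
  invariance then removes the shift t z for each t, and t ranges over an interval of length
  1.\<close>

lemma translation_estimate:
  assumes "C1_supp K \<phi>"
  shows "(\<integral>\<^sup>+x. ennreal ((\<phi> (x + z) - \<phi> x)\<^sup>2) \<partial>lborel) \<le>
    ennreal ((norm z)\<^sup>2 * (LINT x|lborel. (norm (grad \<phi> x))\<^sup>2))"
proof -
  note D = C1_suppD[OF assms]
  have K: "compact K" using assms(1) by (simp add: C1_supp_def)
  let ?G = "\<lambda>x. z \<bullet> grad \<phi> x"
  have [measurable]: "?G \<in> borel_measurable borel"
    by (intro borel_measurable_continuous_onI continuous_intros D)
  have m: "(\<lambda>(t::real, x). ennreal (indicator {0..1} t * (?G (x + t *\<^sub>R z))\<^sup>2)) \<in> borel_measurable (lborel \<Otimes>\<^sub>M lborel)"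
    by measurable
  have "(\<integral>\<^sup>+x. ennreal ((\<phi> (x + z) - \<phi> x)\<^sup>2) \<partial>lborel) \<le>
      (\<integral>\<^sup>+x. \<integral>\<^sup>+t. ennreal (indicator {0..1} t * (?G (x + t *\<^sub>R z))\<^sup>2) \<partial>lborel \<partial>lborel)"
    by (intro nn_integral_mono power2_diff_le_nn_integral[OF assms])
  also have "\<dots> = (\<integral>\<^sup>+t. \<integral>\<^sup>+x. ennreal (indicator {0..1} t * (?G (x + t *\<^sub>R z))\<^sup>2) \<partial>lborel \<partial>lborel)"
    using lborel_pair.Fubini'[OF m] by simp
  also have "\<dots> = (\<integral>\<^sup>+t. \<integral>\<^sup>+x. ennreal (indicator {0..1} (t::real) * (?G x)\<^sup>2) \<partial>lborel \<partial>lborel)"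
  proof (rule nn_integral_cong)
    fix t :: real
    have "(\<lambda>x. ennreal (indicator {0..1} t * (?G x)\<^sup>2)) \<in> borel_measurable borel" by measurable
    then show "(\<integral>\<^sup>+x. ennreal (indicator {0..1} t * (?G (x + t *\<^sub>R z))\<^sup>2) \<partial>lborel)
        = (\<integral>\<^sup>+x. ennreal (indicator {0..1} t * (?G x)\<^sup>2) \<partial>lborel)"
      by (rule lborel_nn_integral_translate)
  qed
  also have "\<dots> = (\<integral>\<^sup>+t. indicator {0..1} (t::real) * (\<integral>\<^sup>+x. ennreal ((?G x)\<^sup>2) \<partial>lborel) \<partial>lborel)"
    by (intro nn_integral_cong) (simp add: ennreal_mult' nn_integral_cmult ennreal_indicator)
  also have "\<dots> = (\<integral>\<^sup>+x. ennreal ((?G x)\<^sup>2) \<partial>lborel)"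
    by (simp add: nn_integral_multc)
  also have "\<dots> \<le> (\<integral>\<^sup>+x. ennreal ((norm z)\<^sup>2 * (norm (grad \<phi> x))\<^sup>2) \<partial>lborel)"
    by (intro nn_integral_mono ennreal_leI)
       (metis Cauchy_Schwarz_ineq power2_norm_eq_inner)
  also have "\<dots> = ennreal (LINT x|lborel. (norm z)\<^sup>2 * (norm (grad \<phi> x))\<^sup>2)"
    by (intro nn_integral_eq_integral continuous_compact_support_integrable[OF K] continuous_intros D(3))
       (auto simp: D(7))
  finally show ?thesis by simp
qed

section \<open>Weak gradients\<close>

lemma lmeasurable_imp_lebesgue: "\<Omega> \<in> lmeasurable \<Longrightarrow> \<Omega> \<in> sets lebesgue"
  by (rule fmeasurableD)

lemma L2_space_component:
  assumes "g \<in> L2_space \<Omega>" "i \<in> Basis"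
  shows "(\<lambda>x. g x \<bullet> i) \<in> L2_space \<Omega>"
  using L2_spaceD(1)[OF assms(1)] Basis_le_norm[OF assms(2)]
  by (intro L2_norm_mono_AE(1)[OF _ assms(1)]) auto

lemma L2_mult_integrable:
  fixes u v :: "'a::euclidean_space \<Rightarrow> real"
  shows "u \<in> L2_space \<Omega> \<Longrightarrow> v \<in> L2_space \<Omega> \<Longrightarrow> integrable (lebesgue_on \<Omega>) (\<lambda>x. u x * v x)"
  using L2_space_inner_integrable[of u \<Omega> v] by simp

lemma
  assumes "\<Omega> \<in> lmeasurable" "C1_supp K \<phi>"
  shows C1_supp_L2: "\<phi> \<in> L2_space \<Omega>"
    and C1_supp_grad_L2: "grad \<phi> \<in> L2_space \<Omega>"
    and C1_supp_partial_deriv_L2: "i \<in> Basis \<Longrightarrow> partial_deriv i \<phi> \<in> L2_space \<Omega>"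
proof -
  note D = C1_suppD[OF assms(2)]
  have K: "compact K" using assms(2) by (simp add: C1_supp_def)
  obtain B where "0 \<le> B" "\<And>x. norm (\<phi> x) \<le> B"
    by (rule continuous_compact_support_bounded[OF K D(2,5)]) auto
  then show "\<phi> \<in> L2_space \<Omega>"
    by (intro L2_space_bounded[OF assms(1)] borel_measurable_lebesgue_onI borel_measurable_continuous_onI D)
  obtain B where "0 \<le> B" "\<And>x. norm (grad \<phi> x) \<le> B"
    by (rule continuous_compact_support_bounded[OF K D(3,7)]) auto
  then show g: "grad \<phi> \<in> L2_space \<Omega>"
    by (intro L2_space_bounded[OF assms(1)] borel_measurable_lebesgue_onI borel_measurable_continuous_onI D)
  show "partial_deriv i \<phi> \<in> L2_space \<Omega>" if "i \<in> Basis"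
    using L2_space_component[OF g that] grad_inner_Basis[OF that, of \<phi>] by simp
qed

text \<open>A partial derivative of the product with another test function integrates to 0, and the
  product rule splits it into the two sides of the identity.\<close>

lemma test_function_weak_gradient:
  assumes \<Omega>: "\<Omega> \<in> lmeasurable" and \<phi>: "\<phi> \<in> test_functions \<Omega>"
  shows "is_weak_gradient \<Omega> \<phi> (grad \<phi>)"
  unfolding is_weak_gradient_def
proof (intro conjI ballI)
  note s\<phi> = test_function_C1_supp[OF \<phi>]
  show "grad \<phi> \<in> L2_space \<Omega>" by (rule C1_supp_grad_L2[OF \<Omega> s\<phi>])
  fix \<psi> and i :: 'a assume \<psi>: "\<psi> \<in> test_functions \<Omega>" and i: "i \<in> Basis"
  note s\<psi> = test_function_C1_supp[OF \<psi>]
  let ?h = "\<lambda>x. \<phi> x * \<psi> x"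
  have pd: "partial_deriv i ?h x = \<phi> x * partial_deriv i \<psi> x + partial_deriv i \<phi> x * \<psi> x" for x
    by (intro partial_deriv_mult C1_suppD(1)[OF s\<phi>] C1_suppD(1)[OF s\<psi>])
  have sh: "C1_supp (closure {x. \<phi> x \<noteq> 0}) ?h" by (rule C1_supp_mult[OF s\<phi> s\<psi>])
  have sub: "closure {x. \<phi> x \<noteq> 0} \<subseteq> \<Omega>" using \<phi> unfolding test_functions_def by blast
  \<comment> \<open>The product vanishes off the support of \<open>\<phi>\<close>, which lies in
    \<Omega>.\<close>
  have "(LINT x|lebesgue_on \<Omega>. partial_deriv i ?h x) = (LINT x|lborel. partial_deriv i ?h x)"
  proof (rule integral_lebesgue_on_eq_lborel[OF lmeasurable_imp_lebesgue[OF \<Omega>]])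
    show "partial_deriv i ?h \<in> borel_measurable borel"
      by (intro borel_measurable_continuous_onI C1_suppD(4)[OF sh i])
    show "partial_deriv i ?h x = 0" if "x \<notin> \<Omega>" for x
      using that sub by (intro C1_suppD(6)[OF sh]) auto
  qed
  then have "(LINT x|lebesgue_on \<Omega>. \<phi> x * partial_deriv i \<psi> x + partial_deriv i \<phi> x * \<psi> x) = 0"
    unfolding pd using integral_partial_deriv_eq_0[OF sh i] by (simp add: pd)
  moreover have "integrable (lebesgue_on \<Omega>) (\<lambda>x. \<phi> x * partial_deriv i \<psi> x)"
    "integrable (lebesgue_on \<Omega>) (\<lambda>x. partial_deriv i \<phi> x * \<psi> x)"
    by (rule L2_mult_integrable C1_supp_L2[OF \<Omega> s\<phi>] C1_supp_L2[OF \<Omega> s\<psi>]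
        C1_supp_partial_deriv_L2[OF \<Omega> s\<phi> i] C1_supp_partial_deriv_L2[OF \<Omega> s\<psi> i])+
  ultimately show "(LINT x|lebesgue_on \<Omega>. \<phi> x * partial_deriv i \<psi> x)
      = - (LINT x|lebesgue_on \<Omega>. (grad \<phi> x \<bullet> i) * \<psi> x)"
    by (simp add: grad_inner_Basis[OF i])
qed

section \<open>The fundamental lemma of the calculus of variations\<close>

lemma set_integral_sets_eq_0_from_boxes:
  fixes h :: "'a::euclidean_space \<Rightarrow> real"
  assumes h: "integrable (lebesgue_on \<Omega>) h" and \<Omega>: "\<Omega> \<in> sets lebesgue"
    and univ: "(LINT x|lebesgue_on \<Omega>. h x) = 0"
    and box: "\<And>a b. (LINT x|lebesgue_on \<Omega>. indicator (box a b) x * h x) = 0"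
    and A: "A \<in> sets borel"
  shows "(LINT x|lebesgue_on \<Omega>. indicator A x * h x) = 0"
proof -
  have I: "integrable (lebesgue_on \<Omega>) (\<lambda>x. indicator A x * h x)" if "A \<in> sets borel" for A
  proof (rule Bochner_Integration.integrable_bound[OF h])
    have "indicator A \<in> borel_measurable (lebesgue_on \<Omega>)"
      using that by (intro borel_measurable_lebesgue_onI) auto
    then show "(\<lambda>x. indicator A x * h x) \<in> borel_measurable (lebesgue_on \<Omega>)"
      using h by measurable
  qed (auto simp: indicator_def)
  \<comment> \<open>Dynkin's argument: the open boxes are an intersection-stable generator of the
    Borel sets. The complement case is where \<open>univ\<close> enters.\<close>
  let ?G = "range (\<lambda>(a, b). box a b :: 'a set)"
  have "Int_stable ?G"
    by (auto simp: Int_stable_def box_Int_box)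
  moreover have "?G \<subseteq> Pow UNIV" by simp
  moreover have "A \<in> sigma_sets UNIV ?G"
    using A by (simp add: borel_eq_box sets_measure_of)
  ultimately show ?thesis
  proof (induction rule: sigma_sets_induct_disjoint)
    case (basic A)
    then show ?case using box by auto
  next
    case empty
    then show ?case by simp
  next
    case (compl A)
    then have "A \<in> sets borel" by (simp add: borel_eq_box sets_measure_of)
    have "(LINT x|lebesgue_on \<Omega>. indicator (UNIV - A) x * h x) = (LINT x|lebesgue_on \<Omega>. h x - indicator A x * h x)"
      by (intro Bochner_Integration.integral_cong) (auto simp: indicator_def)
    then show ?case using h I[OF \<open>A \<in> sets borel\<close>] compl univ by simp
  next
    case (union A)
    then have A: "A n \<in> sets borel" for n by (auto simp: borel_eq_box sets_measure_of)
    \<comment> \<open>The sets are cut with \<Omega> to become measurable subsets of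
      \<open>lebesgue_on \<Omega>\<close>, as countable additivity of the integral requires.\<close>
    have "(LINT x:(\<Union>i. A i \<inter> \<Omega>)|lebesgue_on \<Omega>. h x) = (\<Sum>i. LINT x:(A i \<inter> \<Omega>)|lebesgue_on \<Omega>. h x)"
    proof (rule lebesgue_integral_countable_add)
      show S: "A i \<inter> \<Omega> \<in> sets (lebesgue_on \<Omega>)" for i
        using A[of i] by (auto simp: sets_restrict_space)
      show "A i \<inter> \<Omega> \<inter> (A j \<inter> \<Omega>) = {}" if "i \<noteq> j" for i j
        using union that by (auto simp: disjoint_family_on_def)
      show "set_integrable (lebesgue_on \<Omega>) (\<Union>i. A i \<inter> \<Omega>) h"
        unfolding set_integrable_def by (intro integrable_mult_indicator sets.countable_UN h) (use S in auto)
    qed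
    moreover have "(LINT x:(\<Union>i. A i \<inter> \<Omega>)|lebesgue_on \<Omega>. h x) = (LINT x|lebesgue_on \<Omega>. indicator (\<Union>i. A i) x * h x)"
      unfolding set_lebesgue_integral_def
      by (intro Bochner_Integration.integral_cong) (auto simp: indicator_def)
    moreover have "(LINT x:(A i \<inter> \<Omega>)|lebesgue_on \<Omega>. h x) = (LINT x|lebesgue_on \<Omega>. indicator (A i) x * h x)" for i
      unfolding set_lebesgue_integral_def
      by (intro Bochner_Integration.integral_cong) (auto simp: indicator_def)
    ultimately show ?case using union by simp
  qed
qed

lemma AE_lebesgue_onI:
  "\<Omega> \<in> sets lebesgue \<Longrightarrow> AE x in lebesgue. P x \<Longrightarrow> AE x in lebesgue_on \<Omega>. P x"
  by (subst AE_restrict_space_iff) auto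

lemma AE_eq_0_from_boxes:
  fixes h :: "'a::euclidean_space \<Rightarrow> real"
  assumes h: "integrable (lebesgue_on \<Omega>) h" and \<Omega>: "\<Omega> \<in> lmeasurable"
    and univ: "(LINT x|lebesgue_on \<Omega>. h x) = 0"
    and box: "\<And>a b. (LINT x|lebesgue_on \<Omega>. indicator (box a b) x * h x) = 0"
  shows "AE x in lebesgue_on \<Omega>. h x = 0"
proof -
  interpret finite_measure "lebesgue_on \<Omega>"
    by (rule finite_measure_lebesgue_on) fact
  have \<Omega>': "\<Omega> \<in> sets lebesgue" by (rule lmeasurable_imp_lebesgue[OF \<Omega>])
  show ?thesis
  proof (rule density_zero[OF h])
    fix A assume A: "A \<in> sets (lebesgue_on \<Omega>)"
    then have A': "A \<in> sets lebesgue"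
      using \<Omega>' by (auto simp: sets_restrict_space)
    \<comment> \<open>A Lebesgue measurable set differs from its Borel main part by a null set, so
      the vanishing of integrals over Borel sets carries over to it.\<close>
    let ?B = "main_part lborel A"
    have B: "?B \<in> sets borel" using main_part_sets[OF A'] by simp
    have "AE x in lebesgue. x \<in> ?B \<longleftrightarrow> x \<in> A"
      by (rule AE_completion[OF AE_in_main_part[OF A']])
    then have *: "AE x in lebesgue_on \<Omega>. x \<in> ?B \<longleftrightarrow> x \<in> A"
      by (rule AE_lebesgue_onI[OF \<Omega>'])
    have [measurable]: "indicator ?B \<in> borel_measurable (lebesgue_on \<Omega>)"
      using B by (intro borel_measurable_lebesgue_onI) auto
    have [measurable]: "A \<in> sets (lebesgue_on \<Omega>)" "h \<in> borel_measurable (lebesgue_on \<Omega>)"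
      using A h by auto
    have "set_lebesgue_integral (lebesgue_on \<Omega>) A h = (LINT x|lebesgue_on \<Omega>. indicator ?B x * h x)"
      unfolding set_lebesgue_integral_def
    proof (rule integral_cong_AE)
      show "AE x in lebesgue_on \<Omega>. indicat_real A x *\<^sub>R h x = indicat_real ?B x * h x"
        using * by eventually_elim (auto simp: indicator_def)
    qed measurable
    also have "\<dots> = 0"
      by (rule set_integral_sets_eq_0_from_boxes[OF h \<Omega>' univ box B])
    finally show "set_lebesgue_integral (lebesgue_on \<Omega>) A h = 0" .
  qed
qed

text \<open>Dominated convergence along the bumps that tend to the indicator of the box: they take
  values between 0 and 1, so |g| dominates.\<close>

lemma integral_box_eq_0_from_test_functions:
  assumes \<Omega>: "\<Omega> \<in> lmeasurable" and g: "integrable (lebesgue_on \<Omega>) g"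
    and test: "\<And>\<phi>. \<phi> \<in> test_functions \<Omega> \<Longrightarrow> (LINT x|lebesgue_on \<Omega>. g x * \<phi> x) = 0"
    and sub: "cbox a b \<subseteq> \<Omega>"
  shows "(LINT x|lebesgue_on \<Omega>. g x * indicator (box a b) x) = 0"
proof -
  let ?\<phi> = "\<lambda>n. box_bump (real (Suc n)) a b"
  have [measurable]: "g \<in> borel_measurable (lebesgue_on \<Omega>)" using g by auto
  have [measurable]: "?\<phi> n \<in> borel_measurable (lebesgue_on \<Omega>)" for n
    by (intro borel_measurable_lebesgue_onI borel_measurable_continuous_onI C_k_continuous[OF C_k_box_bump])
  have [measurable]: "indicator (box a b) \<in> borel_measurable (lebesgue_on \<Omega>)"
    by (intro borel_measurable_lebesgue_onI) auto
  have "(\<lambda>n. LINT x|lebesgue_on \<Omega>. g x * ?\<phi> n x) \<longlonglongrightarrow> (LINT x|lebesgue_on \<Omega>. g x * indicator (box a b) x)"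
  proof (rule integral_dominated_convergence)
    show "integrable (lebesgue_on \<Omega>) (\<lambda>x. norm (g x))" using g by simp
    show "AE x in lebesgue_on \<Omega>. (\<lambda>n. g x * ?\<phi> n x) \<longlonglongrightarrow> g x * indicator (box a b) x"
      by (intro AE_I2 tendsto_mult tendsto_const box_bump_tendsto_indicator)
    show "AE x in lebesgue_on \<Omega>. norm (g x * ?\<phi> n x) \<le> norm (g x)" for n
      by (intro AE_I2) (auto simp: abs_mult box_bump_bounds abs_of_nonneg intro: mult_left_le)
  qed measurable
  moreover have "(LINT x|lebesgue_on \<Omega>. g x * ?\<phi> n x) = 0" for n
    by (intro test box_bump_test_function sub) simp
  ultimately show ?thesis by (simp add: LIMSEQ_const_iff)
qed

text \<open>On a box whose closure lies in \<Omega>, g integrates to 0 over every smaller box and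
  hence vanishes almost everywhere; countably many such boxes cover \<Omega>.\<close>

theorem fundamental_lemma_calculus_of_variations:
  assumes \<Omega>: "open \<Omega>" "bounded \<Omega>" and g: "integrable (lebesgue_on \<Omega>) g"
    and test: "\<And>\<phi>. \<phi> \<in> test_functions \<Omega> \<Longrightarrow> (LINT x|lebesgue_on \<Omega>. g x * \<phi> x) = 0"
  shows "AE x in lebesgue_on \<Omega>. g x = 0"
proof -
  have \<Omega>m: "\<Omega> \<in> lmeasurable" using \<Omega> by (intro lmeasurable_open)
  note * = integral_box_eq_0_from_test_functions[OF \<Omega>m g test]
  have AE_box: "AE x in lebesgue_on \<Omega>. g x * indicator (box a b) x = 0" if sub: "cbox a b \<subseteq> \<Omega>" for a b
  proof (rule AE_eq_0_from_boxes[OF _ \<Omega>m])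
    have "indicator (box a b) \<in> borel_measurable (lebesgue_on \<Omega>)"
      by (intro borel_measurable_lebesgue_onI) auto
    then have "(\<lambda>x. g x * indicator (box a b) x) \<in> borel_measurable (lebesgue_on \<Omega>)"
      using g by measurable
    then show "integrable (lebesgue_on \<Omega>) (\<lambda>x. g x * indicator (box a b) x)"
      by (rule Bochner_Integration.integrable_bound[OF g]) (auto simp: indicator_def)
    show "(LINT x|lebesgue_on \<Omega>. g x * indicator (box a b) x) = 0" by (rule *[OF _ sub])
    fix c d :: 'a
    \<comment> \<open>Corners of the intersection of the two boxes; the closed box with these
      corners stays inside \<open>cbox a b\<close>, hence inside \<Omega>.\<close>
    let ?e = "\<Sum>i\<in>Basis. max (a\<bullet>i) (c\<bullet>i) *\<^sub>R i" and ?f = "\<Sum>i\<in>Basis. min (b\<bullet>i) (d\<bullet>i) *\<^sub>R i"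
    have "cbox ?e ?f \<subseteq> \<Omega>" using sub Int_interval[of a b c d] by auto
    then have "(LINT x|lebesgue_on \<Omega>. g x * indicator (box ?e ?f) x) = 0" by (rule *[rotated])
    moreover have "indicator (box c d) x * (g x * indicator (box a b) x) = g x * indicator (box ?e ?f) x" for x
      unfolding box_Int_box[symmetric] by (auto simp: indicator_def)
    ultimately show "(LINT x|lebesgue_on \<Omega>. indicator (box c d) x * (g x * indicator (box a b) x)) = 0"
      by (simp only:)
  qed
  let ?F = "{box a b |a b. cbox a b \<subseteq> \<Omega>}"
  \<comment> \<open>A countable subfamily with the same union keeps the union of the exceptional
    sets null.\<close>
  obtain F where F: "F \<subseteq> ?F" "countable F" "\<Union>F = \<Union>?F"
    using Lindelof[of ?F] by auto
  have cover: "\<Omega> \<subseteq> \<Union>?F"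
  proof
    fix x assume "x \<in> \<Omega>"
    then obtain a b where "cbox a b \<subseteq> \<Omega>" "x \<in> box a b"
      using \<Omega>(1) open_contains_cbox by metis
    then show "x \<in> \<Union>?F" by blast
  qed
  have "AE x in lebesgue_on \<Omega>. \<forall>S\<in>F. g x * indicator S x = 0"
  proof (rule AE_ball_countable'[OF _ F(2)])
    fix S assume "S \<in> F"
    then obtain a b where "S = box a b" "cbox a b \<subseteq> \<Omega>" using F(1) by blast
    then show "AE x in lebesgue_on \<Omega>. g x * indicator S x = 0" using AE_box by simp
  qed
  then show ?thesis
  proof (rule AE_mp, intro AE_I2 impI)
    fix x assume "x \<in> space (lebesgue_on \<Omega>)" and z: "\<forall>S\<in>F. g x * indicator S x = 0"
    then have "x \<in> \<Union>?F" using cover by (simp add: subset_iff)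
    then have "x \<in> \<Union>F" by (simp only: F(3))
    then obtain S where "S \<in> F" "x \<in> S" by blast
    with z show "g x = 0" by force
  qed
qed

section \<open>Uniqueness, linearity and limits of weak gradients\<close>

lemma weak_gradient_unique:
  assumes \<Omega>: "open \<Omega>" "bounded \<Omega>" and g: "is_weak_gradient \<Omega> u g" and h: "is_weak_gradient \<Omega> u h"
  shows "AE x in lebesgue_on \<Omega>. g x = h x"
proof -
  have \<Omega>m: "\<Omega> \<in> lmeasurable" using \<Omega> by (intro lmeasurable_open)
  have L: "g \<in> L2_space \<Omega>" "h \<in> L2_space \<Omega>" using g h by (auto simp: is_weak_gradient_def)
  have one: "(\<lambda>x. 1::real) \<in> L2_space \<Omega>"
    by (rule L2_space_bounded[OF \<Omega>m, of _ 1]) auto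
  have "AE x in lebesgue_on \<Omega>. g x \<bullet> i - h x \<bullet> i = 0" if i: "i \<in> Basis" for i
  proof (rule fundamental_lemma_calculus_of_variations[OF \<Omega>])
    note c = L2_space_component[OF L(1) i] L2_space_component[OF L(2) i]
    show "integrable (lebesgue_on \<Omega>) (\<lambda>x. g x \<bullet> i - h x \<bullet> i)"
      using L2_mult_integrable[OF L2_space_diff[OF c] one] by simp
    fix \<phi> assume \<phi>: "\<phi> \<in> test_functions \<Omega>"
    have \<phi>L: "\<phi> \<in> L2_space \<Omega>" by (rule C1_supp_L2[OF \<Omega>m test_function_C1_supp[OF \<phi>]])
    have "(LINT x|lebesgue_on \<Omega>. (g x \<bullet> i) * \<phi> x) = (LINT x|lebesgue_on \<Omega>. (h x \<bullet> i) * \<phi> x)"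
      using g h \<phi> i unfolding is_weak_gradient_def by fastforce
    then show "(LINT x|lebesgue_on \<Omega>. (g x \<bullet> i - h x \<bullet> i) * \<phi> x) = 0"
      using L2_mult_integrable[OF c(1) \<phi>L] L2_mult_integrable[OF c(2) \<phi>L]
      by (simp add: left_diff_distrib)
  qed
  then have "AE x in lebesgue_on \<Omega>. \<forall>i\<in>Basis. g x \<bullet> i - h x \<bullet> i = 0"
    by (intro AE_finite_allI) auto
  then show ?thesis by eventually_elim (auto intro: euclidean_eqI)
qed

lemma is_weak_gradient_lincomb:
  assumes \<Omega>: "\<Omega> \<in> lmeasurable" and u: "u \<in> L2_space \<Omega>" "is_weak_gradient \<Omega> u g"
    and v: "v \<in> L2_space \<Omega>" "is_weak_gradient \<Omega> v h"
  shows "is_weak_gradient \<Omega> (\<lambda>x. a * u x + b * v x) (\<lambda>x. a *\<^sub>R g x + b *\<^sub>R h x)"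
  unfolding is_weak_gradient_def
proof (intro conjI ballI)
  have L: "g \<in> L2_space \<Omega>" "h \<in> L2_space \<Omega>" using u v by (auto simp: is_weak_gradient_def)
  then show "(\<lambda>x. a *\<^sub>R g x + b *\<^sub>R h x) \<in> L2_space \<Omega>"
    by (intro L2_space_add L2_space_scaleR)
  fix \<phi> and i :: 'a assume \<phi>: "\<phi> \<in> test_functions \<Omega>" and i: "i \<in> Basis"
  note s = test_function_C1_supp[OF \<phi>]
  note c = L2_space_component[OF L(1) i] L2_space_component[OF L(2) i]
  note \<phi>L = C1_supp_L2[OF \<Omega> s] C1_supp_partial_deriv_L2[OF \<Omega> s i]
  have "(LINT x|lebesgue_on \<Omega>. (a * u x + b * v x) * partial_deriv i \<phi> x)
      = a * (LINT x|lebesgue_on \<Omega>. u x * partial_deriv i \<phi> x) + b * (LINT x|lebesgue_on \<Omega>. v x * partial_deriv i \<phi> x)"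
    using L2_mult_integrable[OF u(1) \<phi>L(2)] L2_mult_integrable[OF v(1) \<phi>L(2)]
    by (simp add: distrib_right mult.assoc)
  moreover have "(LINT x|lebesgue_on \<Omega>. ((a *\<^sub>R g x + b *\<^sub>R h x) \<bullet> i) * \<phi> x)
      = a * (LINT x|lebesgue_on \<Omega>. (g x \<bullet> i) * \<phi> x) + b * (LINT x|lebesgue_on \<Omega>. (h x \<bullet> i) * \<phi> x)"
    using L2_mult_integrable[OF c(1) \<phi>L(1)] L2_mult_integrable[OF c(2) \<phi>L(1)]
    by (simp add: inner_add_left distrib_right mult.assoc)
  ultimately show "(LINT x|lebesgue_on \<Omega>. (a * u x + b * v x) * partial_deriv i \<phi> x)
      = - (LINT x|lebesgue_on \<Omega>. ((a *\<^sub>R g x + b *\<^sub>R h x) \<bullet> i) * \<phi> x)"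
    using u(2) v(2) \<phi> i by (simp add: is_weak_gradient_def)
qed

text \<open>The defining identity pairs the function and its gradient with fixed L2 functions, so
  both of its sides pass to the limit under L2 convergence.\<close>

lemma is_weak_gradient_limit:
  assumes \<Omega>: "\<Omega> \<in> lmeasurable"
    and u: "\<And>n. u n \<in> L2_space \<Omega>" "\<And>n. is_weak_gradient \<Omega> (u n) (g n)"
    and w: "w \<in> L2_space \<Omega>" "(\<lambda>n. L2_norm \<Omega> (\<lambda>x. u n x - w x)) \<longlonglongrightarrow> 0"
    and h: "h \<in> L2_space \<Omega>" "(\<lambda>n. L2_norm \<Omega> (\<lambda>x. g n x - h x)) \<longlonglongrightarrow> 0"
  shows "is_weak_gradient \<Omega> w h"
  unfolding is_weak_gradient_def
proof (intro conjI ballI h(1))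
  fix \<phi> and i :: 'a assume \<phi>: "\<phi> \<in> test_functions \<Omega>" and i: "i \<in> Basis"
  note s = test_function_C1_supp[OF \<phi>]
  note \<phi>L = C1_supp_L2[OF \<Omega> s] C1_supp_partial_deriv_L2[OF \<Omega> s i]
  have gL: "g n \<in> L2_space \<Omega>" for n using u(2) by (simp add: is_weak_gradient_def)
  \<comment> \<open>Moving the basis vector to the test function turns the right side of the
    identity into an inner product of two vector-valued L2 functions.\<close>
  have \<phi>i: "(\<lambda>x. \<phi> x *\<^sub>R i) \<in> L2_space \<Omega>"
    using L2_space_scaleR[OF \<phi>L(1)] C1_supp_L2[OF \<Omega> s] i
    by (intro L2_norm_mono_AE(1)[OF _ \<phi>L(1)]) (auto dest: L2_spaceD)
  have "(\<lambda>n. LINT x|lebesgue_on \<Omega>. u n x \<bullet> partial_deriv i \<phi> x) \<longlonglongrightarrow> (LINT x|lebesgue_on \<Omega>. w x \<bullet> partial_deriv i \<phi> x)"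
    using L2_inner_tendsto[OF u(1) \<phi>L(2) w(1) \<phi>L(2) w(2)] by simp
  moreover have "(\<lambda>n. - (LINT x|lebesgue_on \<Omega>. g n x \<bullet> (\<phi> x *\<^sub>R i))) \<longlonglongrightarrow> - (LINT x|lebesgue_on \<Omega>. h x \<bullet> (\<phi> x *\<^sub>R i))"
    using L2_inner_tendsto[OF gL \<phi>i h(1) \<phi>i h(2)] by (intro tendsto_minus) simp
  moreover have "(LINT x|lebesgue_on \<Omega>. u n x \<bullet> partial_deriv i \<phi> x) = - (LINT x|lebesgue_on \<Omega>. g n x \<bullet> (\<phi> x *\<^sub>R i))" for n
    using u(2)[of n] \<phi> i by (simp add: is_weak_gradient_def mult.commute)
  ultimately show "(LINT x|lebesgue_on \<Omega>. w x * partial_deriv i \<phi> x) = - (LINT x|lebesgue_on \<Omega>. (h x \<bullet> i) * \<phi> x)"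
    using LIMSEQ_unique by (simp add: mult.commute) fastforce
qed

section \<open>The spaces \<open>H\<^sup>1\<close> and \<open>H\<^sup>1\<^sub>0\<close>\<close>

lemma H1_spaceI: "u \<in> L2_space \<Omega> \<Longrightarrow> is_weak_gradient \<Omega> u g \<Longrightarrow> u \<in> H1_space \<Omega>"
  by (auto simp: H1_space_def)

lemma H1_spaceD:
  assumes "u \<in> H1_space \<Omega>"
  shows "u \<in> L2_space \<Omega>" "is_weak_gradient \<Omega> u (weak_grad \<Omega> u)" "weak_grad \<Omega> u \<in> L2_space \<Omega>"
proof -
  show "u \<in> L2_space \<Omega>" using assms by (simp add: H1_space_def)
  show "is_weak_gradient \<Omega> u (weak_grad \<Omega> u)"
  proof -
    obtain g where "is_weak_gradient \<Omega> u g" using assms unfolding H1_space_def by blast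
    then show ?thesis unfolding weak_grad_def by (rule someI[where P="is_weak_gradient \<Omega> u"])
  qed
  then show "weak_grad \<Omega> u \<in> L2_space \<Omega>" by (simp add: is_weak_gradient_def)
qed

text \<open>Access to the \<open>SOME\<close> in \<open>weak_grad\<close>: a weak gradient found by
  other means may replace the chosen one under integrals.\<close>

lemma weak_grad_AE_eq:
  assumes "open \<Omega>" "bounded \<Omega>" "u \<in> L2_space \<Omega>" "is_weak_gradient \<Omega> u g"
  shows "AE x in lebesgue_on \<Omega>. weak_grad \<Omega> u x = g x"
  by (rule weak_gradient_unique[OF assms(1,2) H1_spaceD(2)[OF H1_spaceI[OF assms(3,4)]] assms(4)])

lemma L2_norm_weak_grad:
  assumes "open \<Omega>" "bounded \<Omega>" "u \<in> L2_space \<Omega>" "is_weak_gradient \<Omega> u g"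
  shows "L2_norm \<Omega> (weak_grad \<Omega> u) = L2_norm \<Omega> g"
  using weak_grad_AE_eq[OF assms] assms(4) H1_spaceD(3)[OF H1_spaceI[OF assms(3,4)]]
  by (intro L2_norm_cong_AE) (auto simp: is_weak_gradient_def dest: L2_spaceD)

lemma
  assumes \<Omega>: "open \<Omega>" "bounded \<Omega>" and u: "u \<in> H1_space \<Omega>" and v: "v \<in> H1_space \<Omega>"
  shows H1_diff: "(\<lambda>x. u x - v x) \<in> H1_space \<Omega>"
    and weak_grad_diff: "AE x in lebesgue_on \<Omega>. weak_grad \<Omega> (\<lambda>x. u x - v x) x = weak_grad \<Omega> u x - weak_grad \<Omega> v x"
    and L2_norm_weak_grad_diff: "L2_norm \<Omega> (weak_grad \<Omega> (\<lambda>x. u x - v x)) = L2_norm \<Omega> (\<lambda>x. weak_grad \<Omega> u x - weak_grad \<Omega> v x)"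
proof -
  have g: "is_weak_gradient \<Omega> (\<lambda>x. u x - v x) (\<lambda>x. weak_grad \<Omega> u x - weak_grad \<Omega> v x)"
    using is_weak_gradient_lincomb[OF lmeasurable_open[OF \<Omega>(2,1)] H1_spaceD(1,2)[OF u] H1_spaceD(1,2)[OF v], of 1 "-1"]
    by simp
  have L: "(\<lambda>x. u x - v x) \<in> L2_space \<Omega>"
    by (intro L2_space_diff H1_spaceD u v)
  show "(\<lambda>x. u x - v x) \<in> H1_space \<Omega>" by (rule H1_spaceI[OF L g])
  show "AE x in lebesgue_on \<Omega>. weak_grad \<Omega> (\<lambda>x. u x - v x) x = weak_grad \<Omega> u x - weak_grad \<Omega> v x"
    by (rule weak_grad_AE_eq[OF \<Omega> L g])
  show "L2_norm \<Omega> (weak_grad \<Omega> (\<lambda>x. u x - v x)) = L2_norm \<Omega> (\<lambda>x. weak_grad \<Omega> u x - weak_grad \<Omega> v x)"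
    by (rule L2_norm_weak_grad[OF \<Omega> L g])
qed

lemma L2_norm_le_lam_norm:
  "lam \<ge> 0 \<Longrightarrow> L2_norm \<Omega> u \<le> lam_norm \<Omega> lam u"
  "lam \<ge> 0 \<Longrightarrow> sqrt lam * L2_norm \<Omega> (weak_grad \<Omega> u) \<le> lam_norm \<Omega> lam u"
  unfolding lam_norm_def by (auto intro!: real_le_rsqrt simp: power_mult_distrib)

lemma lam_norm_diff_tendsto_0_iff:
  assumes \<Omega>: "open \<Omega>" "bounded \<Omega>" and u: "\<And>n. u n \<in> H1_space \<Omega>" and w: "w \<in> H1_space \<Omega>"
  shows "(\<lambda>n. lam_norm \<Omega> 1 (\<lambda>x. u n x - w x)) \<longlonglongrightarrow> 0 \<longleftrightarrow>
    (\<lambda>n. L2_norm \<Omega> (\<lambda>x. u n x - w x)) \<longlonglongrightarrow> 0 \<and>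
    (\<lambda>n. L2_norm \<Omega> (\<lambda>x. weak_grad \<Omega> (u n) x - weak_grad \<Omega> w x)) \<longlonglongrightarrow> 0"
    (is "?a \<longleftrightarrow> ?b \<and> ?c")
proof safe
  have 0: "sqrt (1 * 0\<^sup>2 + 0\<^sup>2) = (0::real)" by simp
  show ?a if ?b ?c
    unfolding lam_norm_def L2_norm_weak_grad_diff[OF \<Omega> u w]
    using that by (subst 0[symmetric]) (intro tendsto_intros)
  assume a: ?a
  show ?b
    by (rule tendsto_sandwich[OF _ _ tendsto_const a]) (auto intro!: always_eventually L2_norm_le_lam_norm)
  show ?c
    unfolding L2_norm_weak_grad_diff[OF \<Omega> u w, symmetric]
    by (rule tendsto_sandwich[OF _ _ tendsto_const a])
       (use L2_norm_le_lam_norm(2)[of 1] in \<open>auto intro!: always_eventually\<close>)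
qed

lemma test_function_H1:
  assumes \<Omega>: "open \<Omega>" "bounded \<Omega>" and \<phi>: "\<phi> \<in> test_functions \<Omega>"
  shows "\<phi> \<in> H1_space \<Omega>"
proof -
  note m = lmeasurable_open[OF \<Omega>(2,1)]
  show ?thesis
    by (rule H1_spaceI[OF C1_supp_L2[OF m test_function_C1_supp[OF \<phi>]] test_function_weak_gradient[OF m \<phi>]])
qed

lemma H10_spaceD: "u \<in> H10_space \<Omega> \<Longrightarrow> u \<in> H1_space \<Omega>"
  by (simp add: H10_space_def)

text \<open>In this epsilon form, approximations of approximations combine by the triangle
  inequality alone.\<close>

lemma H10_space_iff:
  assumes \<Omega>: "open \<Omega>" "bounded \<Omega>" and u: "u \<in> H1_space \<Omega>"
  shows "u \<in> H10_space \<Omega> \<longleftrightarrow> (\<forall>e>0. \<exists>\<phi>\<in>test_functions \<Omega>.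
    L2_norm \<Omega> (\<lambda>x. \<phi> x - u x) < e \<and> L2_norm \<Omega> (\<lambda>x. weak_grad \<Omega> \<phi> x - weak_grad \<Omega> u x) < e)"
proof
  assume "u \<in> H10_space \<Omega>"
  then obtain \<phi> where \<phi>: "\<And>n. \<phi> n \<in> test_functions \<Omega>" "(\<lambda>n. lam_norm \<Omega> 1 (\<lambda>x. \<phi> n x - u x)) \<longlonglongrightarrow> 0"
    unfolding H10_space_def by blast
  have "\<phi> n \<in> H1_space \<Omega>" for n by (rule test_function_H1[OF \<Omega> \<phi>(1)])
  then have lim: "(\<lambda>n. L2_norm \<Omega> (\<lambda>x. \<phi> n x - u x)) \<longlonglongrightarrow> 0"
    "(\<lambda>n. L2_norm \<Omega> (\<lambda>x. weak_grad \<Omega> (\<phi> n) x - weak_grad \<Omega> u x)) \<longlonglongrightarrow> 0"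
    using lam_norm_diff_tendsto_0_iff[OF \<Omega> _ u, of \<phi>] \<phi>(2) by auto
  show "\<forall>e>0. \<exists>\<phi>\<in>test_functions \<Omega>. L2_norm \<Omega> (\<lambda>x. \<phi> x - u x) < e \<and>
      L2_norm \<Omega> (\<lambda>x. weak_grad \<Omega> \<phi> x - weak_grad \<Omega> u x) < e"
  proof (intro allI impI)
    fix e :: real assume "e > 0"
    have "\<forall>\<^sub>F n in sequentially. L2_norm \<Omega> (\<lambda>x. \<phi> n x - u x) < e \<and>
        L2_norm \<Omega> (\<lambda>x. weak_grad \<Omega> (\<phi> n) x - weak_grad \<Omega> u x) < e"
      by (intro eventually_conj order_tendstoD(2)[OF lim(1) \<open>e > 0\<close>] order_tendstoD(2)[OF lim(2) \<open>e > 0\<close>])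
    then obtain n where "L2_norm \<Omega> (\<lambda>x. \<phi> n x - u x) < e \<and>
        L2_norm \<Omega> (\<lambda>x. weak_grad \<Omega> (\<phi> n) x - weak_grad \<Omega> u x) < e"
      unfolding eventually_sequentially by blast
    with \<phi>(1) show "\<exists>\<phi>\<in>test_functions \<Omega>. L2_norm \<Omega> (\<lambda>x. \<phi> x - u x) < e \<and>
        L2_norm \<Omega> (\<lambda>x. weak_grad \<Omega> \<phi> x - weak_grad \<Omega> u x) < e" by blast
  qed
next
  assume R: "\<forall>e>0. \<exists>\<phi>\<in>test_functions \<Omega>. L2_norm \<Omega> (\<lambda>x. \<phi> x - u x) < e \<and>
      L2_norm \<Omega> (\<lambda>x. weak_grad \<Omega> \<phi> x - weak_grad \<Omega> u x) < e"
  have "\<exists>\<phi>. \<phi> \<in> test_functions \<Omega> \<and> L2_norm \<Omega> (\<lambda>x. \<phi> x - u x) < inverse (real (Suc n)) \<and>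
      L2_norm \<Omega> (\<lambda>x. weak_grad \<Omega> \<phi> x - weak_grad \<Omega> u x) < inverse (real (Suc n))" for n
    using R[rule_format, of "inverse (real (Suc n))"] by auto
  then obtain \<phi> where \<phi>: "\<And>n. \<phi> n \<in> test_functions \<Omega>"
    "\<And>n. L2_norm \<Omega> (\<lambda>x. \<phi> n x - u x) < inverse (real (Suc n))"
    "\<And>n. L2_norm \<Omega> (\<lambda>x. weak_grad \<Omega> (\<phi> n) x - weak_grad \<Omega> u x) < inverse (real (Suc n))"
    by metis
  have "(\<lambda>n. L2_norm \<Omega> (\<lambda>x. \<phi> n x - u x)) \<longlonglongrightarrow> 0"
    by (rule tendsto_sandwich[OF _ _ tendsto_const LIMSEQ_inverse_real_of_nat])
       (auto intro!: always_eventually less_imp_le[OF \<phi>(2)] simp del: of_nat_Suc)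
  moreover have "(\<lambda>n. L2_norm \<Omega> (\<lambda>x. weak_grad \<Omega> (\<phi> n) x - weak_grad \<Omega> u x)) \<longlonglongrightarrow> 0"
    by (rule tendsto_sandwich[OF _ _ tendsto_const LIMSEQ_inverse_real_of_nat])
       (auto intro!: always_eventually less_imp_le[OF \<phi>(3)] simp del: of_nat_Suc)
  moreover have "\<phi> n \<in> H1_space \<Omega>" for n by (rule test_function_H1[OF \<Omega> \<phi>(1)])
  ultimately have "(\<lambda>n. lam_norm \<Omega> 1 (\<lambda>x. \<phi> n x - u x)) \<longlonglongrightarrow> 0"
    using lam_norm_diff_tendsto_0_iff[OF \<Omega> _ u, of \<phi>] by auto
  with \<phi>(1) u show "u \<in> H10_space \<Omega>" unfolding H10_space_def by blast
qed

text \<open>The L2 limits of the functions and of the gradients belong together because weak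
  gradients are stable under limits. The limit is in H^1_0 since a test function close to a late
  \<open>u n\<close> is also close to it.\<close>

theorem H10_complete:
  assumes \<Omega>: "open \<Omega>" "bounded \<Omega>" and u: "\<And>n. u n \<in> H10_space \<Omega>"
    and C: "L2_Cauchy \<Omega> u" "L2_Cauchy \<Omega> (\<lambda>n. weak_grad \<Omega> (u n))"
  shows "\<exists>w\<in>H10_space \<Omega>. (\<lambda>n. lam_norm \<Omega> 1 (\<lambda>x. u n x - w x)) \<longlonglongrightarrow> 0"
proof -
  note m = lmeasurable_open[OF \<Omega>(2,1)]
  note u1 = H10_spaceD[OF u]
  note uL = H1_spaceD[OF u1]
  obtain w where w: "w \<in> L2_space \<Omega>" "(\<lambda>n. L2_norm \<Omega> (\<lambda>x. u n x - w x)) \<longlonglongrightarrow> 0"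
    using L2_complete[OF m uL(1) C(1)] by blast
  obtain g where g: "g \<in> L2_space \<Omega>" "(\<lambda>n. L2_norm \<Omega> (\<lambda>x. weak_grad \<Omega> (u n) x - g x)) \<longlonglongrightarrow> 0"
    using L2_complete[OF m uL(3) C(2)] by blast
  have wg: "is_weak_gradient \<Omega> w g"
    by (rule is_weak_gradient_limit[OF m uL(1,2) w g])
  have w1: "w \<in> H1_space \<Omega>" by (rule H1_spaceI[OF w(1) wg])
  have AE: "AE x in lebesgue_on \<Omega>. weak_grad \<Omega> w x = g x"
    by (rule weak_grad_AE_eq[OF \<Omega> w(1) wg])
  have [measurable]: "weak_grad \<Omega> w \<in> borel_measurable (lebesgue_on \<Omega>)" "g \<in> borel_measurable (lebesgue_on \<Omega>)"
    "\<And>n. weak_grad \<Omega> (u n) \<in> borel_measurable (lebesgue_on \<Omega>)"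
    using L2_spaceD(1) H1_spaceD(3)[OF w1] g(1) uL(3) by auto
  have "L2_norm \<Omega> (\<lambda>x. weak_grad \<Omega> (u n) x - weak_grad \<Omega> w x) = L2_norm \<Omega> (\<lambda>x. weak_grad \<Omega> (u n) x - g x)" for n
    by (rule L2_norm_cong_AE) (use AE in auto)
  then have lim: "(\<lambda>n. L2_norm \<Omega> (\<lambda>x. weak_grad \<Omega> (u n) x - weak_grad \<Omega> w x)) \<longlonglongrightarrow> 0"
    using g(2) by simp
  have "w \<in> H10_space \<Omega>"
    unfolding H10_space_iff[OF \<Omega> w1]
  proof (intro allI impI)
    fix e :: real assume "e > 0"
    then have "e / 2 > 0" by simp
    have "\<forall>\<^sub>F n in sequentially. L2_norm \<Omega> (\<lambda>x. u n x - w x) < e / 2 \<and>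
        L2_norm \<Omega> (\<lambda>x. weak_grad \<Omega> (u n) x - weak_grad \<Omega> w x) < e / 2"
      by (intro eventually_conj order_tendstoD(2)[OF w(2) \<open>e / 2 > 0\<close>] order_tendstoD(2)[OF lim \<open>e / 2 > 0\<close>])
    then obtain n where n: "L2_norm \<Omega> (\<lambda>x. u n x - w x) < e / 2"
        "L2_norm \<Omega> (\<lambda>x. weak_grad \<Omega> (u n) x - weak_grad \<Omega> w x) < e / 2"
      unfolding eventually_sequentially by blast
    obtain \<phi> where \<phi>: "\<phi> \<in> test_functions \<Omega>" "L2_norm \<Omega> (\<lambda>x. \<phi> x - u n x) < e / 2"
      "L2_norm \<Omega> (\<lambda>x. weak_grad \<Omega> \<phi> x - weak_grad \<Omega> (u n) x) < e / 2"
      using u[of n] \<open>e / 2 > 0\<close> unfolding H10_space_iff[OF \<Omega> u1] by blast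
    note \<phi>1 = H1_spaceD[OF test_function_H1[OF \<Omega> \<phi>(1)]]
    show "\<exists>\<phi>\<in>test_functions \<Omega>. L2_norm \<Omega> (\<lambda>x. \<phi> x - w x) < e \<and>
        L2_norm \<Omega> (\<lambda>x. weak_grad \<Omega> \<phi> x - weak_grad \<Omega> w x) < e"
      using L2_norm_diff_triangle[OF \<phi>1(1) uL(1)[of n] w(1)]
        L2_norm_diff_triangle[OF \<phi>1(3) uL(3)[of n] H1_spaceD(3)[OF w1]] n \<phi>
      by (intro bexI[OF _ \<phi>(1)]) auto
  qed
  then show ?thesis
    using lam_norm_diff_tendsto_0_iff[where u=u, OF \<Omega> u1 w1] w(2) lim by blast
qed

section \<open>Rellich compactness\<close>

lemma diagonal_convergent_subseq:
  fixes a :: "nat \<Rightarrow> 'd \<Rightarrow> real"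
  assumes D: "countable D" and bdd: "\<And>d. d \<in> D \<Longrightarrow> bounded (range (\<lambda>n. a n d))"
  shows "\<exists>r. strict_mono r \<and> (\<forall>d\<in>D. convergent (\<lambda>n. a (r n) d))"
proof (cases "D = {}")
  case True
  then show ?thesis using strict_mono_id by auto
next
  case False
  define d where "d = from_nat_into D"
  have dD: "d k \<in> D" for k using from_nat_into[OF False] by (simp add: d_def)
  \<comment> \<open>Stage k asks for convergence at the k-th element of D; Bolzano-Weierstrass
    provides each refinement.\<close>
  define P where "P k s \<longleftrightarrow> convergent (\<lambda>n. a (s n) (d k))" for k and s :: "nat \<Rightarrow> nat"
  interpret subseqs P
  proof
    fix k and s :: "nat \<Rightarrow> nat" assume "strict_mono s"
    have "bounded (range (\<lambda>n. a (s n) (d k)))"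
      by (rule bounded_subset[OF bdd[OF dD[of k]]]) auto
    then obtain l r where "strict_mono r" "((\<lambda>n. a (s n) (d k)) \<circ> r) \<longlonglongrightarrow> l"
      using bounded_imp_convergent_subsequence by blast
    then show "\<exists>r'. strict_mono r' \<and> P k (s \<circ> r')"
      by (auto simp: P_def o_def convergent_def)
  qed
  have "convergent (\<lambda>n. a (diagseq n) x)" if xD: "x \<in> D" for x
  proof -
    obtain k where k: "x = d k" using from_nat_into_surj[OF D xD] by (auto simp: d_def)
    \<comment> \<open>The diagonal sequence is a subsequence of stage k only after its initial
      terms, which do not affect convergence.\<close>
    have "P k (diagseq \<circ> (+) (Suc k))"
    proof (rule diagseq_holds)
      fix s r :: "nat \<Rightarrow> nat" and m assume "strict_mono r" "P m s"
      then show "P m (s \<circ> r)"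
        using convergent_subseq_convergent[of "\<lambda>n. a (s n) (d m)" r] by (simp add: P_def o_def)
    qed
    then have "convergent (\<lambda>n. a (diagseq (n + Suc k)) x)"
      by (simp add: P_def k add.commute)
    then show ?thesis by (subst (asm) convergent_ignore_initial_segment)
  qed
  then show ?thesis using subseq_diagseq by blast
qed

text \<open>Averages over the cells of a grid of width \<open>h\<close> approximate a function in \<open>L\<^sup>2\<close> at rate \<open>h\<close>,
  uniformly on bounded sets of gradients. There are only countably many averages for the grids
  of width \<open>1 / Suc k\<close>, so a diagonal subsequence makes all of them converge, and the Cauchy property
  follows. No weak compactness is needed.\<close>

definition same_cell :: "real \<Rightarrow> 'a::euclidean_space \<Rightarrow> 'a \<Rightarrow> bool" where
  "same_cell h x y \<longleftrightarrow> (\<forall>i\<in>Basis. \<lfloor>x \<bullet> i / h\<rfloor> = \<lfloor>y \<bullet> i / h\<rfloor>)"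

text \<open>The uniform probability density on the cell of x. Being jointly measurable in x and y,
  it opens the averages to Tonelli.\<close>

definition cell_kernel :: "real \<Rightarrow> 'a::euclidean_space \<Rightarrow> 'a \<Rightarrow> real" where
  "cell_kernel h x y = of_bool (same_cell h x y) / h ^ DIM('a)"

definition cell_average :: "real \<Rightarrow> ('a::euclidean_space \<Rightarrow> real) \<Rightarrow> 'a \<Rightarrow> real" where
  "cell_average h \<phi> x = (LINT y|lborel. cell_kernel h x y * \<phi> y)"

lemma same_cell_measurable [measurable]:
  "Measurable.pred (borel \<Otimes>\<^sub>M borel) (\<lambda>(x, y). same_cell h x y)"
  unfolding same_cell_def by measurable

lemma cell_kernel_measurable [measurable]:
  "(\<lambda>(x, y). cell_kernel h x y) \<in> borel_measurable (borel \<Otimes>\<^sub>M borel)"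
  unfolding cell_kernel_def by measurable

lemma cell_kernel_measurable_snd [measurable]: "cell_kernel h x \<in> borel_measurable borel"
proof -
  have "(\<lambda>y. case (x, y) of (x, y) \<Rightarrow> cell_kernel h x y) \<in> borel_measurable borel"
    by (rule measurable_compose[OF measurable_Pair1' cell_kernel_measurable]) simp
  then show ?thesis by simp
qed

lemma cell_average_measurable:
  assumes [measurable]: "\<phi> \<in> borel_measurable borel"
  shows "cell_average h \<phi> \<in> borel_measurable borel"
proof -
  have "(\<lambda>(x, y). cell_kernel h x y * \<phi> y) \<in> borel_measurable (borel \<Otimes>\<^sub>M lborel)"
    by measurable
  then show ?thesis unfolding cell_average_def[abs_def]
    by (rule lborel.borel_measurable_lebesgue_integral)
qed

lemma floor_divide_eq_iff:
  fixes h t s :: real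
  assumes "h > 0"
  shows "\<lfloor>s / h\<rfloor> = \<lfloor>t / h\<rfloor> \<longleftrightarrow> h * of_int \<lfloor>s / h\<rfloor> \<le> t \<and> t < h * of_int \<lfloor>s / h\<rfloor> + h"
proof -
  have "\<lfloor>t / h\<rfloor> = k \<longleftrightarrow> h * of_int k \<le> t \<and> t < h * of_int k + h" for k
    using assms by (simp add: floor_eq_iff field_simps)
  from this[of "\<lfloor>s / h\<rfloor>"] show ?thesis by (metis)
qed

text \<open>A canonical representative of the cell of x. Averages depend on x only through it, and
  it takes countably many values.\<close>

definition cell_corner :: "real \<Rightarrow> 'a::euclidean_space \<Rightarrow> 'a" where
  "cell_corner h x = (\<Sum>i\<in>Basis. (h * of_int \<lfloor>x \<bullet> i / h\<rfloor>) *\<^sub>R i)"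

lemma cell_corner_inner: "i \<in> Basis \<Longrightarrow> cell_corner h x \<bullet> i = h * of_int \<lfloor>x \<bullet> i / h\<rfloor>"
  by (simp add: cell_corner_def inner_sum_left_Basis)

lemma same_cell_iff_corner:
  assumes "h > 0"
  shows "same_cell h x y \<longleftrightarrow>
    (\<forall>i\<in>Basis. cell_corner h x \<bullet> i \<le> y \<bullet> i \<and> y \<bullet> i < cell_corner h x \<bullet> i + h)"
  unfolding same_cell_def floor_divide_eq_iff[OF assms] by (auto simp: cell_corner_inner)

lemma countable_range_cell_corner: "countable (range (cell_corner h :: 'a::euclidean_space \<Rightarrow> 'a))"
proof (rule countable_subset)
  show "range (cell_corner h :: 'a \<Rightarrow> 'a) \<subseteq>
      (\<lambda>k. \<Sum>i\<in>Basis. (h * of_int (k i)) *\<^sub>R i) ` (Basis \<rightarrow>\<^sub>E (UNIV :: int set))"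
  proof
    fix c :: 'a assume "c \<in> range (cell_corner h)"
    then obtain x where "c = cell_corner h x" by blast
    then have "c = (\<lambda>k. \<Sum>i\<in>Basis. (h * of_int (k i)) *\<^sub>R i) (\<lambda>i\<in>Basis. \<lfloor>x \<bullet> i / h\<rfloor>)"
      by (simp add: cell_corner_def)
    then show "c \<in> (\<lambda>k. \<Sum>i\<in>Basis. (h * of_int (k i)) *\<^sub>R i) ` (Basis \<rightarrow>\<^sub>E (UNIV :: int set))"
      by (intro image_eqI[where x="\<lambda>i\<in>Basis. \<lfloor>x \<bullet> i / h\<rfloor>"]) auto
  qed
  show "countable ((\<lambda>k. \<Sum>i\<in>Basis. (h * of_int (k i)) *\<^sub>R i) ` ((Basis::'a set) \<rightarrow>\<^sub>E (UNIV :: int set)))"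
    by (intro countable_image countable_PiE) auto
qed

lemma cell_average_corner:
  assumes "h > 0"
  shows "cell_average h \<phi> x = cell_average h \<phi> (cell_corner h x)"
proof -
  have "\<lfloor>cell_corner h x \<bullet> i / h\<rfloor> = \<lfloor>x \<bullet> i / h\<rfloor>" if "i \<in> Basis" for i
    using assms by (simp add: cell_corner_inner[OF that])
  then have "same_cell h (cell_corner h x) y \<longleftrightarrow> same_cell h x y" for y
    by (simp add: same_cell_def)
  then show ?thesis by (simp add: cell_average_def cell_kernel_def)
qed

text \<open>The half-open cell lies between the open and the closed box with the same corners, which
  differ by a null set.\<close>

lemma cell_kernel_integral:
  fixes x :: "'a::euclidean_space"
  assumes h: "h > 0"
  shows "integrable lborel (cell_kernel h x)" "(LINT y|lborel. cell_kernel h x y) = 1"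
proof -
  let ?c = "cell_corner h x"
  let ?B = "cbox ?c (?c + h *\<^sub>R One)"
  have AE: "AE y in lborel. cell_kernel h x y = indicator ?B y / h ^ DIM('a)"
  proof -
    have "AE y in lborel. y \<notin> ?B - box ?c (?c + h *\<^sub>R One)"
    proof (rule AE_not_in)
      have "negligible (?B - box ?c (?c + h *\<^sub>R One))" by (rule negligible_frontier_interval)
      then show "?B - box ?c (?c + h *\<^sub>R One) \<in> null_sets lborel"
        by (subst (asm) negligible_iff_null_sets, subst (asm) null_sets_completion_iff) auto
    qed
    then show ?thesis
    proof eventually_elim
      fix y assume "y \<notin> ?B - box ?c (?c + h *\<^sub>R One)"
      moreover have "same_cell h x y \<Longrightarrow> y \<in> ?B"
        unfolding same_cell_iff_corner[OF h] by (auto simp: mem_box inner_add_left intro: less_imp_le)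
      moreover have "y \<in> box ?c (?c + h *\<^sub>R One) \<Longrightarrow> same_cell h x y"
        unfolding same_cell_iff_corner[OF h] by (auto simp: mem_box inner_add_left intro: less_imp_le)
      ultimately show "cell_kernel h x y = indicator ?B y / h ^ DIM('a)"
        by (auto simp: cell_kernel_def indicator_def)
    qed
  qed
  have int: "integrable lborel (\<lambda>y. indicator ?B y / h ^ DIM('a))"
    by (intro integrable_divide_zero integrable_real_indicator) (use emeasure_lborel_cbox_finite[of ?c "?c + h *\<^sub>R One"] in auto)
  show "integrable lborel (cell_kernel h x)"
    using int AE by (subst integrable_cong_AE[OF _ _ AE]) auto
  have "measure lborel ?B = h ^ DIM('a)"
    using h by (subst content_cbox) (auto simp: inner_add_left)
  then have "(LINT y|lborel. indicator ?B y / h ^ DIM('a)) = 1"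
    using h by simp
  moreover have "(LINT y|lborel. cell_kernel h x y) = (LINT y|lborel. indicator ?B y / h ^ DIM('a))"
    by (rule integral_cong_AE[OF _ _ AE]) auto
  ultimately show "(LINT y|lborel. cell_kernel h x y) = 1"
    by (simp only:)
qed

lemma cell_kernel_bounds:
  fixes x y :: "'a::euclidean_space"
  assumes "h > 0"
  shows "0 \<le> cell_kernel h x y" "cell_kernel h x y \<le> 1 / h ^ DIM('a)"
  using assms by (auto simp: cell_kernel_def divide_right_mono)

text \<open>Jensen's inequality for the probability density \<open>cell_kernel h x\<close>.\<close>

lemma cell_average_error_le:
  assumes h: "h > 0" and s: "C1_supp K \<phi>"
  shows "ennreal ((\<phi> x - cell_average h \<phi> x)\<^sup>2) \<le> (\<integral>\<^sup>+y. ennreal (cell_kernel h x y * (\<phi> x - \<phi> y)\<^sup>2) \<partial>lborel)"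
proof -
  note D = C1_suppD[OF s]
  have K: "compact K" using s by (simp add: C1_supp_def)
  obtain B where B: "B \<ge> 0" "\<And>x. norm (\<phi> x) \<le> B"
    using continuous_compact_support_bounded[OF K D(2,5)] by blast
  have [measurable]: "\<phi> \<in> borel_measurable borel" by (rule borel_measurable_continuous_onI[OF D(2)])
  note k = cell_kernel_integral[OF h, of x]
  have I: "integrable lborel (\<lambda>y. cell_kernel h x y * g y)"
    if [measurable]: "g \<in> borel_measurable borel" and "\<And>y. norm (g y) \<le> C" for g :: "'a \<Rightarrow> real" and C
  proof (rule Bochner_Integration.integrable_bound)
    show "integrable lborel (\<lambda>y. cell_kernel h x y * C)" using k(1) by simp
    show "AE y in lborel. norm (cell_kernel h x y * g y) \<le> norm (cell_kernel h x y * C)"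
      using that(2) cell_kernel_bounds[OF h, of x]
      by (intro AE_I2) (auto simp: abs_mult intro!: mult_left_mono order_trans[OF that(2), simplified])
  qed simp
  have bd: "norm (\<phi> x - \<phi> y) \<le> 2 * B" for y
    using norm_triangle_ineq4[of "\<phi> x" "\<phi> y"] B(2)[of x] B(2)[of y] by linarith
  have bd2: "norm ((\<phi> x - \<phi> y)\<^sup>2) \<le> (2 * B)\<^sup>2" for y
    using power_mono[OF bd[of y], of 2] by simp
  have I1: "integrable lborel (\<lambda>y. cell_kernel h x y * \<phi> y)" by (rule I[OF _ B(2)]) simp
  have I3: "integrable lborel (\<lambda>y. cell_kernel h x y * (\<phi> x - \<phi> y))" by (rule I[OF _ bd]) simp
  have I2: "integrable lborel (\<lambda>y. cell_kernel h x y * (\<phi> x - \<phi> y)\<^sup>2)" by (rule I[OF _ bd2]) simp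
  define m where "m = \<phi> x - cell_average h \<phi> x"
  have m: "m = (LINT y|lborel. cell_kernel h x y * (\<phi> x - \<phi> y))"
    using I1 k by (simp add: m_def cell_average_def right_diff_distrib)
  \<comment> \<open>The variance of \<open>\<phi> x - \<phi> y\<close> about its mean m is
    nonnegative; expanding the square leaves the second moment minus
    \<open>m\<^sup>2\<close>.\<close>
  have "0 \<le> (LINT y|lborel. cell_kernel h x y * ((\<phi> x - \<phi> y) - m)\<^sup>2)"
    by (intro integral_nonneg_AE AE_I2 mult_nonneg_nonneg cell_kernel_bounds(1)[OF h]) simp
  also have "\<dots> = (LINT y|lborel. cell_kernel h x y * (\<phi> x - \<phi> y)\<^sup>2 - 2 * m * (cell_kernel h x y * (\<phi> x - \<phi> y)) + m\<^sup>2 * cell_kernel h x y)"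
    by (intro Bochner_Integration.integral_cong) (auto simp: power2_eq_square algebra_simps)
  also have "\<dots> = (LINT y|lborel. cell_kernel h x y * (\<phi> x - \<phi> y)\<^sup>2) - 2 * m * m + m\<^sup>2"
    using I2 I3 k by (simp add: m[symmetric])
  finally have "m\<^sup>2 \<le> (LINT y|lborel. cell_kernel h x y * (\<phi> x - \<phi> y)\<^sup>2)"
    by (simp add: power2_eq_square)
  also have "ennreal \<dots> = (\<integral>\<^sup>+y. ennreal (cell_kernel h x y * (\<phi> x - \<phi> y)\<^sup>2) \<partial>lborel)"
    by (intro nn_integral_eq_integral[symmetric] I2 AE_I2 mult_nonneg_nonneg cell_kernel_bounds(1)[OF h]) simp
  finally show ?thesis by (simp add: m_def ennreal_leI)
qed

text \<open>Two points of one cell differ by at most h in each coordinate. The bound depends on the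
  shift z alone, which lets the translation estimate be applied for each fixed z.\<close>

lemma cell_kernel_shift_le:
  fixes x z :: "'a::euclidean_space"
  assumes h: "h > 0"
  shows "cell_kernel h x (x + z) \<le> indicator (cbox (- (h *\<^sub>R One)) (h *\<^sub>R One)) z / h ^ DIM('a)"
proof (cases "same_cell h x (x + z)")
  case True
  have "- h \<le> z \<bullet> i \<and> z \<bullet> i \<le> h" if i: "i \<in> Basis" for i
  proof -
    let ?c = "cell_corner h x"
    have "?c \<bullet> i \<le> (x + z) \<bullet> i" "(x + z) \<bullet> i < ?c \<bullet> i + h"
      using True i unfolding same_cell_iff_corner[OF h] by auto
    moreover have "same_cell h x x" by (simp add: same_cell_def)
    then have "?c \<bullet> i \<le> x \<bullet> i" "x \<bullet> i < ?c \<bullet> i + h"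
      using i unfolding same_cell_iff_corner[OF h] by auto
    ultimately show ?thesis by (auto simp: inner_add_left)
  qed
  then have "z \<in> cbox (- (h *\<^sub>R One)) (h *\<^sub>R One)" by (auto simp: mem_box)
  then show ?thesis using True by (simp add: cell_kernel_def)
qed (use h in \<open>simp add: cell_kernel_def\<close>)

lemma norm_power2_le_cube:
  fixes z :: "'a::euclidean_space"
  assumes "z \<in> cbox (- (h *\<^sub>R One)) (h *\<^sub>R One)"
  shows "(norm z)\<^sup>2 \<le> real DIM('a) * h\<^sup>2"
proof -
  have "(norm z)\<^sup>2 = (\<Sum>i\<in>Basis. (z \<bullet> i)\<^sup>2)"
    unfolding power2_norm_eq_inner by (subst euclidean_inner) (simp add: power2_eq_square)
  also have "\<dots> \<le> (\<Sum>i\<in>(Basis::'a set). h\<^sup>2)"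
  proof (rule sum_mono)
    fix i :: 'a assume "i \<in> Basis"
    then have "\<bar>z \<bullet> i\<bar> \<le> \<bar>h\<bar>" using assms by (auto simp: mem_box)
    then show "(z \<bullet> i)\<^sup>2 \<le> h\<^sup>2" by (simp add: abs_le_square_iff)
  qed
  finally show ?thesis by simp
qed

text \<open>After Jensen and the substitution y = x + z, the kernel is replaced by its bound in z
  and the translation estimate is averaged over a cube of side 2 h. In dimension d one has |z|^2
  \<le> d h^2 there, and the volume ratio (2 h)^d / h^d contributes 2^d.\<close>

lemma cell_average_L2_error:
  fixes \<phi> :: "'a::euclidean_space \<Rightarrow> real"
  assumes h: "h > 0" and s: "C1_supp K \<phi>"
  shows "(\<integral>\<^sup>+x. ennreal ((\<phi> x - cell_average h \<phi> x)\<^sup>2) \<partial>lborel) \<le>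
    ennreal (2 ^ DIM('a) * real DIM('a) * h\<^sup>2 * (LINT x|lborel. (norm (grad \<phi> x))\<^sup>2))"
proof -
  note D = C1_suppD[OF s]
  have [measurable]: "\<phi> \<in> borel_measurable borel" by (rule borel_measurable_continuous_onI[OF D(2)])
  define G where "G = (LINT x|lborel. (norm (grad \<phi> x))\<^sup>2)"
  have G: "G \<ge> 0" by (simp add: G_def)
  let ?Q = "cbox (- (h *\<^sub>R One)) (h *\<^sub>R One) :: 'a set"
  let ?k = "\<lambda>z. indicator ?Q z / h ^ DIM('a)"
  have k0: "0 \<le> ?k z" for z using h by simp
  have [measurable]: "?Q \<in> sets borel" by simp
  have "(\<integral>\<^sup>+x. ennreal ((\<phi> x - cell_average h \<phi> x)\<^sup>2) \<partial>lborel)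
      \<le> (\<integral>\<^sup>+x. \<integral>\<^sup>+y. ennreal (cell_kernel h x y * (\<phi> x - \<phi> y)\<^sup>2) \<partial>lborel \<partial>lborel)"
    by (intro nn_integral_mono cell_average_error_le[OF h s])
  also have "\<dots> = (\<integral>\<^sup>+x. \<integral>\<^sup>+z. ennreal (cell_kernel h x (x + z) * (\<phi> x - \<phi> (x + z))\<^sup>2) \<partial>lborel \<partial>lborel)"
  proof (rule nn_integral_cong)
    fix x
    have "(\<lambda>y. ennreal (cell_kernel h x y * (\<phi> x - \<phi> y)\<^sup>2)) \<in> borel_measurable borel" by measurable
    from lborel_nn_integral_translate[OF this, of x]
    show "(\<integral>\<^sup>+y. ennreal (cell_kernel h x y * (\<phi> x - \<phi> y)\<^sup>2) \<partial>lborel)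
        = (\<integral>\<^sup>+z. ennreal (cell_kernel h x (x + z) * (\<phi> x - \<phi> (x + z))\<^sup>2) \<partial>lborel)"
      by (simp add: add.commute)
  qed
  also have "\<dots> \<le> (\<integral>\<^sup>+x. \<integral>\<^sup>+z. ennreal (?k z * (\<phi> (x + z) - \<phi> x)\<^sup>2) \<partial>lborel \<partial>lborel)"
    by (intro nn_integral_mono ennreal_leI)
       (subst power2_commute, intro mult_right_mono cell_kernel_shift_le[OF h], simp)
  also have "\<dots> = (\<integral>\<^sup>+z. \<integral>\<^sup>+x. ennreal (?k z * (\<phi> (x + z) - \<phi> x)\<^sup>2) \<partial>lborel \<partial>lborel)"
  proof -
    have "(\<lambda>(z, x). ennreal (?k z * (\<phi> (x + z) - \<phi> x)\<^sup>2)) \<in> borel_measurable (lborel \<Otimes>\<^sub>M lborel)"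
      by measurable
    from lborel_pair.Fubini'[OF this] show ?thesis by simp
  qed
  also have "\<dots> = (\<integral>\<^sup>+z. ennreal (?k z) * (\<integral>\<^sup>+x. ennreal ((\<phi> (x + z) - \<phi> x)\<^sup>2) \<partial>lborel) \<partial>lborel)"
    unfolding ennreal_mult'[OF k0] by (intro nn_integral_cong nn_integral_cmult) measurable
  also have "\<dots> \<le> (\<integral>\<^sup>+z. ennreal (?k z) * ennreal ((norm z)\<^sup>2 * G) \<partial>lborel)"
    unfolding G_def by (intro nn_integral_mono mult_left_mono translation_estimate[OF s]) auto
  also have "\<dots> \<le> (\<integral>\<^sup>+z. ennreal (real DIM('a) * h\<^sup>2 * G / h ^ DIM('a)) * indicator ?Q z \<partial>lborel)"
  proof (rule nn_integral_mono)
    fix z :: 'a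
    show "ennreal (?k z) * ennreal ((norm z)\<^sup>2 * G) \<le> ennreal (real DIM('a) * h\<^sup>2 * G / h ^ DIM('a)) * indicator ?Q z"
    proof (cases "z \<in> ?Q")
      case True
      have "(norm z)\<^sup>2 * G / h ^ DIM('a) \<le> real DIM('a) * h\<^sup>2 * G / h ^ DIM('a)"
        using h G by (intro divide_right_mono mult_right_mono norm_power2_le_cube[OF True]) auto
      then show ?thesis using True h G by (simp add: ennreal_mult[symmetric] ennreal_leI)
    qed simp
  qed
  also have "\<dots> = ennreal (real DIM('a) * h\<^sup>2 * G / h ^ DIM('a)) * emeasure lborel ?Q"
    by (simp add: nn_integral_cmult_indicator)
  also have "emeasure lborel ?Q = ennreal ((2 * h) ^ DIM('a))"
  proof -
    have "prod ((\<bullet>) (h *\<^sub>R One - (- (h *\<^sub>R One)) :: 'a)) Basis = (\<Prod>i\<in>(Basis::'a set). 2 * h)"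
      by (rule prod.cong) (auto simp: inner_add_left)
    then show ?thesis
      using h by (subst emeasure_lborel_cbox) auto
  qed
  also have "ennreal (real DIM('a) * h\<^sup>2 * G / h ^ DIM('a)) * ennreal ((2 * h) ^ DIM('a))
      = ennreal (2 ^ DIM('a) * real DIM('a) * h\<^sup>2 * G)"
    using h G by (simp add: ennreal_mult[symmetric] power_mult_distrib field_simps)
  finally show ?thesis by (simp add: G_def)
qed

text \<open>Restricting to \<Omega> can only lower the error, while the gradient vanishes off K and
  so keeps its whole integral.\<close>

lemma L2_norm_cell_average_error:
  fixes \<phi> :: "'a::euclidean_space \<Rightarrow> real"
  assumes h: "h > 0" and \<Omega>: "\<Omega> \<in> lmeasurable" and s: "C1_supp K \<phi>" and K: "K \<subseteq> \<Omega>"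
  shows "(\<lambda>x. \<phi> x - cell_average h \<phi> x) \<in> L2_space \<Omega>"
    and "L2_norm \<Omega> (\<lambda>x. \<phi> x - cell_average h \<phi> x) \<le> h * (sqrt (2 ^ DIM('a) * real DIM('a)) * L2_norm \<Omega> (grad \<phi>))"
proof -
  note D = C1_suppD[OF s]
  have \<Omega>': "\<Omega> \<in> sets lebesgue" by (rule lmeasurable_imp_lebesgue[OF \<Omega>])
  have [measurable]: "\<phi> \<in> borel_measurable borel" by (rule borel_measurable_continuous_onI[OF D(2)])
  have [measurable]: "cell_average h \<phi> \<in> borel_measurable borel" by (rule cell_average_measurable) simp
  let ?d = "\<lambda>x. \<phi> x - cell_average h \<phi> x"
  let ?c = "sqrt (2 ^ DIM('a) * real DIM('a))"
  have [measurable]: "?d \<in> borel_measurable (lebesgue_on \<Omega>)"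
    by (intro borel_measurable_lebesgue_onI) measurable
  have G: "(L2_norm \<Omega> (grad \<phi>))\<^sup>2 = (LINT x|lborel. (norm (grad \<phi> x))\<^sup>2)"
    by (intro L2_norm_eq_lborel[OF \<Omega>'] borel_measurable_continuous_onI D(3) D(7)) (use K in blast)
  have "(\<integral>\<^sup>+x. ennreal ((norm (?d x))\<^sup>2) \<partial>lebesgue_on \<Omega>) = (\<integral>\<^sup>+x. ennreal ((?d x)\<^sup>2) * indicator \<Omega> x \<partial>lebesgue)"
    using \<Omega>' by (subst nn_integral_restrict_space) auto
  also have "\<dots> \<le> (\<integral>\<^sup>+x. ennreal ((?d x)\<^sup>2) \<partial>lebesgue)"
    by (intro nn_integral_mono) (auto simp: indicator_def)
  also have "\<dots> = (\<integral>\<^sup>+x. ennreal ((?d x)\<^sup>2) \<partial>lborel)"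
    by (rule nn_integral_completion)
  also have "\<dots> \<le> ennreal (2 ^ DIM('a) * real DIM('a) * h\<^sup>2 * (LINT x|lborel. (norm (grad \<phi> x))\<^sup>2))"
    by (rule cell_average_L2_error[OF h s])
  also have "2 ^ DIM('a) * real DIM('a) * h\<^sup>2 * (LINT x|lborel. (norm (grad \<phi> x))\<^sup>2) = (h * (?c * L2_norm \<Omega> (grad \<phi>)))\<^sup>2"
    unfolding G[symmetric] by (simp add: power_mult_distrib)
  finally have le: "(\<integral>\<^sup>+x. ennreal ((norm (?d x))\<^sup>2) \<partial>lebesgue_on \<Omega>) \<le> ennreal ((h * (?c * L2_norm \<Omega> (grad \<phi>)))\<^sup>2)" .
  have int: "integrable (lebesgue_on \<Omega>) (\<lambda>x. (norm (?d x))\<^sup>2)"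
  proof (rule integrableI_bounded)
    show "(\<integral>\<^sup>+x. ennreal (norm ((norm (?d x))\<^sup>2)) \<partial>lebesgue_on \<Omega>) < \<infinity>"
      using le_less_trans[OF le] by simp
  qed measurable
  then show "?d \<in> L2_space \<Omega>" unfolding L2_space_def by simp
  have "ennreal ((L2_norm \<Omega> ?d)\<^sup>2) \<le> ennreal ((h * (?c * L2_norm \<Omega> (grad \<phi>)))\<^sup>2)"
    unfolding L2_norm_power2[of \<Omega> ?d] using le by (subst nn_integral_eq_integral[OF int, symmetric]) auto
  then have "(L2_norm \<Omega> ?d)\<^sup>2 \<le> (h * (?c * L2_norm \<Omega> (grad \<phi>)))\<^sup>2"
    by (subst (asm) ennreal_le_iff) auto
  then show "L2_norm \<Omega> ?d \<le> h * (?c * L2_norm \<Omega> (grad \<phi>))"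
    by (rule power2_le_imp_le) (use h in auto)
qed

text \<open>Cauchy-Schwarz against the kernel, which is at most \<open>1 / h ^ DIM('a)\<close>. The
  bound grows as h shrinks but is uniform in x and over norm-bounded families, as required for each
  fixed grid.\<close>

lemma abs_cell_average_le:
  fixes \<phi> :: "'a::euclidean_space \<Rightarrow> real"
  assumes h: "h > 0" and \<Omega>: "\<Omega> \<in> lmeasurable" and s: "C1_supp K \<phi>" and K: "K \<subseteq> \<Omega>"
  shows "\<bar>cell_average h \<phi> x\<bar> \<le> (1 / h ^ DIM('a)) * L2_norm \<Omega> (\<lambda>x::'a. 1::real) * L2_norm \<Omega> \<phi>"
proof -
  note D = C1_suppD[OF s]
  let ?c = "1 / h ^ DIM('a)"
  have c: "?c \<ge> 0" using h by simp
  have [measurable]: "\<phi> \<in> borel_measurable borel" by (rule borel_measurable_continuous_onI[OF D(2)])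
  have k: "cell_kernel h x \<in> L2_space \<Omega>"
    using cell_kernel_bounds[OF h, of x]
    by (intro L2_space_bounded[OF \<Omega>, of _ ?c] borel_measurable_lebesgue_onI cell_kernel_measurable_snd) (simp add: abs_of_nonneg)
  have one: "(\<lambda>x::'a. 1::real) \<in> L2_space \<Omega>" by (rule L2_space_bounded[OF \<Omega>, of _ 1]) auto
  have "cell_average h \<phi> x = (LINT y|lebesgue_on \<Omega>. cell_kernel h x y * \<phi> y)"
    unfolding cell_average_def
  proof (rule integral_lebesgue_on_eq_lborel[symmetric, OF lmeasurable_imp_lebesgue[OF \<Omega>]])
    fix y assume "y \<notin> \<Omega>"
    then have "\<phi> y = 0" using K D(5) by blast
    then show "cell_kernel h x y * \<phi> y = 0" by simp
  qed simp
  then have "\<bar>cell_average h \<phi> x\<bar> \<le> L2_norm \<Omega> (cell_kernel h x) * L2_norm \<Omega> \<phi>"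
    using L2_Cauchy_Schwarz[OF k C1_supp_L2[OF \<Omega> s]] by simp
  also have "L2_norm \<Omega> (cell_kernel h x) \<le> L2_norm \<Omega> (\<lambda>y::'a. ?c *\<^sub>R (1::real))"
    using cell_kernel_bounds[OF h, of x]
    by (intro L2_norm_mono_AE(2)[OF L2_spaceD(1)[OF k] L2_space_scaleR[OF one]]) (use h in simp)
  also have "\<dots> = ?c * L2_norm \<Omega> (\<lambda>y::'a. 1::real)"
    by (subst L2_norm_scaleR) (use c in simp)
  finally show ?thesis by (simp add: mult_right_mono)
qed

theorem test_functions_L2_precompact:
  fixes \<phi> :: "nat \<Rightarrow> 'a::euclidean_space \<Rightarrow> real"
  assumes \<Omega>: "\<Omega> \<in> lmeasurable" and \<phi>: "\<And>n. \<phi> n \<in> test_functions \<Omega>"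
    and M: "\<And>n. L2_norm \<Omega> (\<phi> n) \<le> M" "\<And>n. L2_norm \<Omega> (grad (\<phi> n)) \<le> M"
  shows "\<exists>r. strict_mono r \<and> L2_Cauchy \<Omega> (\<lambda>n. \<phi> (r n))"
proof -
  interpret finite_measure "lebesgue_on \<Omega>"
    by (rule finite_measure_lebesgue_on) fact
  have M0: "M \<ge> 0" using M(1)[of 0] L2_norm_nonneg[of \<Omega> "\<phi> 0"] by linarith
  note s = test_function_C1_supp[OF \<phi>]
  have sub: "closure {x. \<phi> n x \<noteq> 0} \<subseteq> \<Omega>" for n using \<phi>[of n] unfolding test_functions_def by blast
  note err = L2_norm_cell_average_error[OF _ \<Omega> s sub]
  define C where "C h = (1 / h ^ DIM('a)) * L2_norm \<Omega> (\<lambda>x::'a. 1::real) * M" for h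
  have C: "\<bar>cell_average h (\<phi> n) x\<bar> \<le> C h" if "h > 0" for h n x
  proof -
    have "\<bar>cell_average h (\<phi> n) x\<bar> \<le> (1 / h ^ DIM('a)) * L2_norm \<Omega> (\<lambda>x::'a. 1::real) * L2_norm \<Omega> (\<phi> n)"
      by (rule abs_cell_average_le[OF that \<Omega> s sub])
    also have "\<dots> \<le> C h"
      unfolding C_def using that by (intro mult_left_mono M mult_nonneg_nonneg) auto
    finally show ?thesis .
  qed
  \<comment> \<open>All grid widths paired with all their corners: the countable index set of the
    diagonal argument.\<close>
  define D where "D = (\<Union>k. Pair (inverse (real (Suc k))) ` range (cell_corner (inverse (real (Suc k))) :: 'a \<Rightarrow> 'a))"
  have "\<exists>r. strict_mono r \<and> (\<forall>d\<in>D. convergent (\<lambda>n. (\<lambda>n (h, c). cell_average h (\<phi> n) c) (r n) d))"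
  proof (rule diagonal_convergent_subseq)
    show "countable D" unfolding D_def
      by (intro countable_UN countable_image countable_range_cell_corner) simp
    fix d assume "d \<in> D"
    then obtain h c where d: "d = (h, c)" "h > 0" unfolding D_def by auto
    then show "bounded (range (\<lambda>n. (\<lambda>n (h, c). cell_average h (\<phi> n) c) n d))"
      using C[OF d(2)] by (auto simp: bounded_iff)
  qed
  then obtain r where r: "strict_mono r" "\<And>h c. (h, c) \<in> D \<Longrightarrow> convergent (\<lambda>n. cell_average h (\<phi> (r n)) c)"
    by force
  have conv: "convergent (\<lambda>n. cell_average (inverse (real (Suc k))) (\<phi> (r n)) x)" for k x
    by (subst cell_average_corner, simp, rule r(2)) (auto simp: D_def)
  have "L2_Cauchy \<Omega> (\<lambda>n. \<phi> (r n))"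
    unfolding L2_Cauchy_def
  proof (intro allI impI)
    fix e :: real assume e: "e > 0"
    let ?c = "sqrt (2 ^ DIM('a) * real DIM('a)) * M"
    \<comment> \<open>The grid is taken so fine that replacing any member of the sequence by its
      average costs less than e / 4.\<close>
    have "(\<lambda>k. inverse (real (Suc k)) * ?c) \<longlonglongrightarrow> 0 * ?c"
      by (intro tendsto_mult tendsto_const LIMSEQ_inverse_real_of_nat)
    then have "\<forall>\<^sub>F k in sequentially. inverse (real (Suc k)) * ?c < e / 4"
      using e by (intro order_tendstoD(2)) auto
    then obtain k where k: "inverse (real (Suc k)) * ?c < e / 4"
      unfolding eventually_sequentially by blast
    define h where "h = inverse (real (Suc k))"
    have h: "h > 0" by (simp add: h_def)
    define p where "p x = lim (\<lambda>n. cell_average h (\<phi> (r n)) x)" for x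
    let ?P = "\<lambda>n. cell_average h (\<phi> (r n))"
    have Pm [measurable]: "?P n \<in> borel_measurable (lebesgue_on \<Omega>)" for n
      by (intro borel_measurable_lebesgue_onI cell_average_measurable borel_measurable_continuous_onI C1_suppD(2)[OF s])
    have [measurable]: "p \<in> borel_measurable (lebesgue_on \<Omega>)"
      unfolding p_def[abs_def] by measurable
    have lim: "(\<lambda>n. ?P n x) \<longlonglongrightarrow> p x" for x
      using conv[of k x] unfolding p_def h_def by (simp add: convergent_LIMSEQ_iff)
    have pb: "\<bar>p x\<bar> \<le> C h" for x
      by (rule tendsto_upperbound[OF tendsto_rabs[OF lim]]) (auto simp: C[OF h])
    have PL: "?P n \<in> L2_space \<Omega>" for n
      by (rule L2_space_bounded[OF \<Omega> Pm, of n "C h"]) (use C[OF h] in simp)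
    have pL: "p \<in> L2_space \<Omega>"
      by (rule L2_space_bounded[OF \<Omega>, of _ "C h"]) (use pb in auto)
    \<comment> \<open>For this fixed grid the averages converge everywhere and are uniformly
      bounded, so dominated convergence gives convergence in L2.\<close>
    have "(\<lambda>n. LINT x|lebesgue_on \<Omega>. (norm (?P n x - p x))\<^sup>2) \<longlonglongrightarrow> (LINT x|lebesgue_on \<Omega>. 0)"
    proof (rule integral_dominated_convergence)
      show "integrable (lebesgue_on \<Omega>) (\<lambda>x. (2 * C h)\<^sup>2)" by simp
      show "AE x in lebesgue_on \<Omega>. (\<lambda>n. (norm (?P n x - p x))\<^sup>2) \<longlonglongrightarrow> 0"
      proof (rule AE_I2)
        fix x
        have "(\<lambda>n. (norm (?P n x - p x))\<^sup>2) \<longlonglongrightarrow> (norm (p x - p x))\<^sup>2"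
          by (intro tendsto_power tendsto_norm tendsto_diff lim tendsto_const)
        then show "(\<lambda>n. (norm (?P n x - p x))\<^sup>2) \<longlonglongrightarrow> 0" by simp
      qed
      have "norm (?P n x - p x) \<le> 2 * C h" for n x
        using norm_triangle_ineq4[of "?P n x" "p x"] C[OF h, of "r n" x] pb[of x] by simp
      then have "(norm (?P n x - p x))\<^sup>2 \<le> (2 * C h)\<^sup>2" for n x
        by (rule power_mono) simp
      then show "AE x in lebesgue_on \<Omega>. norm ((norm (?P n x - p x))\<^sup>2) \<le> (2 * C h)\<^sup>2" for n
        by simp
    qed measurable
    then have "(\<lambda>n. sqrt (LINT x|lebesgue_on \<Omega>. (norm (?P n x - p x))\<^sup>2)) \<longlonglongrightarrow> sqrt 0"
      by (intro tendsto_real_sqrt) simp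
    then have "(\<lambda>n. L2_norm \<Omega> (\<lambda>x. ?P n x - p x)) \<longlonglongrightarrow> 0"
      by (simp add: L2_norm_def)
    then have "\<forall>\<^sub>F n in sequentially. L2_norm \<Omega> (\<lambda>x. ?P n x - p x) < e / 4"
      using e by (intro order_tendstoD(2)) auto
    then obtain N where N: "\<And>n. n \<ge> N \<Longrightarrow> L2_norm \<Omega> (\<lambda>x. ?P n x - p x) < e / 4"
      unfolding eventually_sequentially by blast
    have E: "L2_norm \<Omega> (\<lambda>x. \<phi> (r n) x - ?P n x) < e / 4" for n
    proof -
      have "L2_norm \<Omega> (\<lambda>x. \<phi> (r n) x - ?P n x) \<le> h * (sqrt (2 ^ DIM('a) * real DIM('a)) * L2_norm \<Omega> (grad (\<phi> (r n))))"
        by (rule err(2)[OF h])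
      also have "\<dots> \<le> h * ?c"
        using h by (intro mult_left_mono M) auto
      finally show ?thesis using k by (simp add: h_def)
    qed
    have \<phi>p: "L2_norm \<Omega> (\<lambda>x. \<phi> (r n) x - p x) < e / 2" if "n \<ge> N" for n
      using L2_norm_diff_triangle[OF C1_supp_L2[OF \<Omega> s] PL pL, of "r n" n] E[of n] N[OF that] by linarith
    show "\<exists>N. \<forall>m\<ge>N. \<forall>n\<ge>N. L2_norm \<Omega> (\<lambda>x. \<phi> (r m) x - \<phi> (r n) x) < e"
    proof (intro exI[of _ N] allI impI)
      fix m n assume mn: "m \<ge> N" "n \<ge> N"
      show "L2_norm \<Omega> (\<lambda>x. \<phi> (r m) x - \<phi> (r n) x) < e"
        using L2_norm_diff_triangle[OF C1_supp_L2[OF \<Omega> s] pL C1_supp_L2[OF \<Omega> s], of "r m" "r n"]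
          \<phi>p[OF mn(1)] \<phi>p[OF mn(2)] L2_norm_minus_commute[of \<Omega> p "\<phi> (r n)"] by linarith
    qed
  qed
  with r(1) show ?thesis by blast
qed

text \<open>Test functions within 1 / (n + 1) of \<open>u n\<close> inherit its bounds up to 1,
  hence have an L2-Cauchy subsequence; since the errors tend to 0, \<open>u\<close> is Cauchy along
  the same indices.\<close>

theorem Rellich_H10:
  fixes u :: "nat \<Rightarrow> 'a::euclidean_space \<Rightarrow> real"
  assumes \<Omega>: "open \<Omega>" "bounded \<Omega>" and u: "\<And>n. u n \<in> H10_space \<Omega>"
    and M: "\<And>n. L2_norm \<Omega> (u n) \<le> M" "\<And>n. L2_norm \<Omega> (weak_grad \<Omega> (u n)) \<le> M"
  shows "\<exists>r. strict_mono r \<and> L2_Cauchy \<Omega> (\<lambda>n. u (r n))"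
proof -
  note m = lmeasurable_open[OF \<Omega>(2,1)]
  note u1 = H1_spaceD[OF H10_spaceD[OF u]]
  have "\<exists>\<phi>. \<phi> \<in> test_functions \<Omega> \<and> L2_norm \<Omega> (\<lambda>x. \<phi> x - u n x) < inverse (real (Suc n)) \<and>
      L2_norm \<Omega> (\<lambda>x. weak_grad \<Omega> \<phi> x - weak_grad \<Omega> (u n) x) < inverse (real (Suc n))" for n
    using u[of n] unfolding H10_space_iff[OF \<Omega> H10_spaceD[OF u]]
    by (auto dest!: spec[of _ "inverse (real (Suc n))"])
  then obtain \<phi> where \<phi>: "\<And>n. \<phi> n \<in> test_functions \<Omega>"
    "\<And>n. L2_norm \<Omega> (\<lambda>x. \<phi> n x - u n x) < inverse (real (Suc n))"
    "\<And>n. L2_norm \<Omega> (\<lambda>x. weak_grad \<Omega> (\<phi> n) x - weak_grad \<Omega> (u n) x) < inverse (real (Suc n))"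
    by metis
  note \<phi>1 = H1_spaceD[OF test_function_H1[OF \<Omega> \<phi>(1)]]
  have inv1: "inverse (real (Suc n)) \<le> 1" for n by (simp add: inverse_le_1_iff)
  have b1: "L2_norm \<Omega> (\<phi> n) \<le> M + 1" for n
    using L2_norm_le_add_diff[OF \<phi>1(1) u1(1), of n n] M(1)[of n] \<phi>(2)[of n] inv1[of n] by linarith
  have b2: "L2_norm \<Omega> (grad (\<phi> n)) \<le> M + 1" for n
  proof -
    have "L2_norm \<Omega> (weak_grad \<Omega> (\<phi> n)) = L2_norm \<Omega> (grad (\<phi> n))"
      by (rule L2_norm_weak_grad[OF \<Omega> \<phi>1(1) test_function_weak_gradient[OF m \<phi>(1)]])
    then show ?thesis
      using L2_norm_le_add_diff[OF \<phi>1(3) u1(3), of n n] M(2)[of n] \<phi>(3)[of n] inv1[of n] by linarith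
  qed
  obtain r where r: "strict_mono r" "L2_Cauchy \<Omega> (\<lambda>n. \<phi> (r n))"
    using test_functions_L2_precompact[where \<phi>=\<phi> and M="M + 1", OF m \<phi>(1) b1 b2] by blast
  have "L2_Cauchy \<Omega> (\<lambda>n. u (r n))"
    unfolding L2_Cauchy_def
  proof (intro allI impI)
    fix e :: real assume "e > 0"
    then have "e / 3 > 0" by simp
    then obtain N where N: "\<And>m n. m \<ge> N \<Longrightarrow> n \<ge> N \<Longrightarrow> L2_norm \<Omega> (\<lambda>x. \<phi> (r m) x - \<phi> (r n) x) < e / 3"
      using r(2)[unfolded L2_Cauchy_def, rule_format, of "e / 3"] by blast
    obtain N' where N': "inverse (real (Suc N')) < e / 3"
      using reals_Archimedean[of "e / 3"] \<open>e > 0\<close> by auto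
    have close: "L2_norm \<Omega> (\<lambda>x. \<phi> (r n) x - u (r n) x) < e / 3" if "n \<ge> N'" for n
    proof -
      have "N' \<le> r n" using that seq_suble[OF r(1), of n] by linarith
      then have "inverse (real (Suc (r n))) \<le> inverse (real (Suc N'))"
        by (simp add: field_simps)
      then show ?thesis using \<phi>(2)[of "r n"] N' by linarith
    qed
    show "\<exists>N. \<forall>m\<ge>N. \<forall>n\<ge>N. L2_norm \<Omega> (\<lambda>x. u (r m) x - u (r n) x) < e"
    proof (intro exI[of _ "max N N'"] allI impI)
      fix m n assume mn: "m \<ge> max N N'" "n \<ge> max N N'"
      have "L2_norm \<Omega> (\<lambda>x. u (r m) x - u (r n) x) \<le> L2_norm \<Omega> (\<lambda>x. u (r m) x - \<phi> (r m) x) + L2_norm \<Omega> (\<lambda>x. \<phi> (r m) x - u (r n) x)"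
        by (rule L2_norm_diff_triangle[OF u1(1) \<phi>1(1) u1(1)])
      also have "L2_norm \<Omega> (\<lambda>x. \<phi> (r m) x - u (r n) x) \<le> L2_norm \<Omega> (\<lambda>x. \<phi> (r m) x - \<phi> (r n) x) + L2_norm \<Omega> (\<lambda>x. \<phi> (r n) x - u (r n) x)"
        by (rule L2_norm_diff_triangle[OF \<phi>1(1) \<phi>1(1) u1(1)])
      finally show "L2_norm \<Omega> (\<lambda>x. u (r m) x - u (r n) x) < e"
        using close[of m] close[of n] N[of m n] mn L2_norm_minus_commute[of \<Omega> "u (r m)" "\<phi> (r m)"] by auto
    qed
  qed
  with r(1) show ?thesis by blast
qed

section \<open>Lipschitz nonlinearities and the energy\<close>

lemma Caratheodory_borel_measurable:
  fixes f :: "'a \<Rightarrow> real \<Rightarrow> real"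
  assumes meas: "\<And>s. (\<lambda>x. f x s) \<in> borel_measurable M"
    and cont: "\<And>x. x \<in> space M \<Longrightarrow> continuous_on UNIV (f x)"
  shows "(\<lambda>(x, s). f x s) \<in> borel_measurable (M \<Otimes>\<^sub>M borel)"
proof -
  \<comment> \<open>Rounding s down to multiples of 1 / (n + 1) leaves countably many values, which
    gives joint measurability for each n; continuity in s carries it to the limit.\<close>
  define q where "q n s = real_of_int \<lfloor>real (Suc n) * s\<rfloor> / real (Suc n)" for n s
  have q: "(\<lambda>n. q n s) \<longlonglongrightarrow> s" for s
  proof (rule LIMSEQ_norm_0[THEN LIM_zero_cancel])
    fix n
    have "real_of_int \<lfloor>real (Suc n) * s\<rfloor> \<le> real (Suc n) * s" "real (Suc n) * s < real_of_int \<lfloor>real (Suc n) * s\<rfloor> + 1"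
      by linarith+
    then have "q n s \<le> s" "s < q n s + 1 / real (Suc n)"
      by (simp_all add: q_def field_simps del: of_nat_Suc)
    then show "norm (q n s - s) < 1 / real (Suc n)" by simp
  qed
  show ?thesis
  proof (rule borel_measurable_LIMSEQ_real[where u="\<lambda>n z. f (fst z) (q n (snd z))"])
    fix z assume "z \<in> space (M \<Otimes>\<^sub>M (borel :: real measure))"
    then have "fst z \<in> space M" by (auto simp: space_pair_measure)
    then have "isCont (f (fst z)) (snd z)" using cont by (simp add: continuous_on_eq_continuous_at)
    then have "(\<lambda>n. f (fst z) (q n (snd z))) \<longlonglongrightarrow> f (fst z) (snd z)"
      by (rule isCont_tendsto_compose[OF _ q])
    then show "(\<lambda>n. f (fst z) (q n (snd z))) \<longlonglongrightarrow> (case z of (x, s) \<Rightarrow> f x s)"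
      by (simp add: case_prod_beta)
  next
    fix n
    have "(\<lambda>z. (\<lambda>i z. f (fst z) (real_of_int i / real (Suc n))) (\<lfloor>real (Suc n) * snd z\<rfloor>) z)
        \<in> borel_measurable (M \<Otimes>\<^sub>M (borel :: real measure))"
    proof (rule measurable_compose_countable[where f="\<lambda>i z. f (fst z) (real_of_int i / real (Suc n))"])
      show "(\<lambda>z. f (fst z) (real_of_int i / real (Suc n))) \<in> borel_measurable (M \<Otimes>\<^sub>M (borel :: real measure))" for i
        by (rule measurable_compose[OF measurable_fst meas])
      show "(\<lambda>z. \<lfloor>real (Suc n) * snd z\<rfloor>) \<in> measurable (M \<Otimes>\<^sub>M (borel :: real measure)) (count_space UNIV)"
        by measurable
    qed
    then show "(\<lambda>z. f (fst z) (q n (snd z))) \<in> borel_measurable (M \<Otimes>\<^sub>M borel)"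
      by (simp add: q_def)
  qed
qed

lemma interval_integral_has_real_derivative:
  fixes g :: "real \<Rightarrow> real"
  assumes "continuous_on UNIV g"
  shows "((\<lambda>t. LBINT s=ereal 0..ereal t. g s) has_real_derivative g t) (at t)"
proof -
  \<comment> \<open>The interval from -R to R contains 0 and has t in its interior.\<close>
  let ?R = "\<bar>t\<bar> + 1"
  have "((\<lambda>t. LBINT s=ereal 0..ereal t. g s) has_vector_derivative g t) (at t within {-?R..?R})"
    by (rule interval_integral_FTC2) (auto intro: continuous_on_subset[OF assms])
  moreover have "at t within {-?R..?R} = at t"
    by (rule at_within_interior) auto
  ultimately show ?thesis by (simp add: has_real_derivative_iff_has_vector_derivative)
qed

lemma interval_integral_measurable:
  fixes f :: "'a \<Rightarrow> real \<Rightarrow> real"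
  assumes f: "(\<lambda>(x, s). f x s) \<in> borel_measurable (M \<Otimes>\<^sub>M borel)" and [measurable]: "u \<in> borel_measurable M"
  shows "(\<lambda>x. LBINT s=ereal 0..ereal (u x). f x s) \<in> borel_measurable M"
proof -
  have [measurable]: "(\<lambda>(x, s). f x s) \<in> borel_measurable (M \<Otimes>\<^sub>M lborel)"
    using f by (simp cong: measurable_cong_sets)
  \<comment> \<open>Orientation and moving end point are encoded in the integrand, so that
    measurability of parameter integrals over a fixed domain applies.\<close>
  have eq: "(LBINT s=ereal 0..ereal (u x). f x s) = (if 0 \<le> u x
      then (LINT s|lborel. (if 0 < s \<and> s < u x then f x s else 0))
      else - (LINT s|lborel. (if u x < s \<and> s < 0 then f x s else 0)))" for x
    unfolding interval_lebesgue_integral_def set_lebesgue_integral_def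
    by (auto intro!: Bochner_Integration.integral_cong simp: indicator_def)
  have [measurable]: "(\<lambda>x. LINT s|lborel. (if 0 < s \<and> s < u x then f x s else 0)) \<in> borel_measurable M"
    by (intro lborel.borel_measurable_lebesgue_integral) measurable
  have [measurable]: "(\<lambda>x. LINT s|lborel. (if u x < s \<and> s < 0 then f x s else 0)) \<in> borel_measurable M"
    by (intro lborel.borel_measurable_lebesgue_integral) measurable
  show ?thesis unfolding eq by measurable
qed

lemma abs_deriv_bound_Lipschitz:
  fixes g :: "real \<Rightarrow> real"
  assumes "\<And>s. g differentiable (at s)" "\<And>s. \<bar>deriv g s\<bar> \<le> L"
  shows "\<bar>g t - g s\<bar> \<le> L * \<bar>t - s\<bar>"
proof -
  have "(g has_field_derivative deriv g s) (at s within UNIV)" for s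
    using assms(1)[of s] by (simp add: DERIV_deriv_iff_real_differentiable)
  from field_differentiable_bound[OF convex_UNIV this, of L t s] assms(2)
  show ?thesis by simp
qed

text \<open>This one-sided remainder bound is what makes the semi-implicit step dissipative.\<close>

lemma primitive_ge_tangent_parabola:
  fixes g G :: "real \<Rightarrow> real"
  assumes G: "\<And>t. (G has_real_derivative g t) (at t)"
    and lip: "\<And>s t. \<bar>g t - g s\<bar> \<le> L * \<bar>t - s\<bar>"
  shows "G a + g a * (b - a) - L / 2 * (b - a)\<^sup>2 \<le> G b"
proof -
  \<comment> \<open>By the Lipschitz bound the derivative of H is nonnegative to the right of a and
    nonpositive to the left, so H is smallest at a.\<close>
  define H where "H t = G t - g a * (t - a) + L / 2 * (t - a)\<^sup>2" for t
  have H: "(H has_real_derivative (g t - g a + L * (t - a))) (at t)" for t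
    unfolding H_def[abs_def]
    by (auto intro!: derivative_eq_intros G simp: field_simps)
  have "H a \<le> H b"
  proof (cases "a \<le> b")
    case True
    show ?thesis
    proof (rule DERIV_nonneg_imp_nondecreasing[OF True])
      fix t assume "a \<le> t" "t \<le> b"
      then show "\<exists>y. (H has_real_derivative y) (at t) \<and> 0 \<le> y"
        using lip[of t a] by (intro exI[of _ "g t - g a + L * (t - a)"]) (auto simp: H)
    qed
  next
    case False
    then have "b \<le> a" by simp
    then show ?thesis
    proof (rule DERIV_nonpos_imp_nonincreasing)
      fix t assume t: "b \<le> t" "t \<le> a"
      have "g t - g a \<le> L * (a - t)" using lip[of t a] t by (simp add: abs_if split: if_splits)
      then show "\<exists>y. (H has_real_derivative y) (at t) \<and> y \<le> 0"
        by (intro exI[of _ "g t - g a + L * (t - a)"] conjI H) (simp add: algebra_simps)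
    qed
  qed
  then show ?thesis by (simp add: H_def)
qed

text \<open>Mean value inequality with the bound |g| \<le> |g 0| + L |t| between -|t| and |t|. This
  growth bound makes the potential integrable and the energy bounded below on L2-bounded
  sets.\<close>

lemma abs_primitive_le:
  fixes g G :: "real \<Rightarrow> real"
  assumes G: "\<And>t. (G has_real_derivative g t) (at t)" "G 0 = 0"
    and lip: "\<And>s t. \<bar>g t - g s\<bar> \<le> L * \<bar>t - s\<bar>" and L: "L \<ge> 0"
  shows "\<bar>G t\<bar> \<le> \<bar>g 0\<bar> * \<bar>t\<bar> + L * t\<^sup>2"
proof -
  have "norm (G t - G 0) \<le> (\<bar>g 0\<bar> + L * \<bar>t\<bar>) * norm (t - 0)"
  proof (rule field_differentiable_bound[where S="{-\<bar>t\<bar>..\<bar>t\<bar>}"])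
    show "(G has_field_derivative g z) (at z within {-\<bar>t\<bar>..\<bar>t\<bar>})" for z
      using G(1) by (rule has_field_derivative_at_within)
    fix z assume "z \<in> {-\<bar>t\<bar>..\<bar>t\<bar>}"
    then have "L * \<bar>z\<bar> \<le> L * \<bar>t\<bar>" using L by (intro mult_left_mono) auto
    then show "norm (g z) \<le> \<bar>g 0\<bar> + L * \<bar>t\<bar>" using lip[of z 0] by simp
  qed auto
  then show ?thesis using G(2) by (simp add: algebra_simps power2_eq_square)
qed

section \<open>Composition with f, the energy and its decay\<close>

lemma L2_norm_uminus: "L2_norm \<Omega> (\<lambda>x. - u x) = L2_norm \<Omega> u"
  by (simp add: L2_norm_def)

text \<open>The analysis of the scheme sees f only through these data; \<open>Lambda_f\<close>
  enters at the end, when one of its elements supplies L.\<close>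

locale Lipschitz_nonlinearity =
  fixes \<Omega> :: "'a::euclidean_space set" and f :: "'a \<Rightarrow> real \<Rightarrow> real" and L :: real
  assumes \<Omega>: "open \<Omega>" "bounded \<Omega>"
    and f_measurable: "\<And>s. (\<lambda>x. f x s) \<in> borel_measurable (lebesgue_on \<Omega>)"
    and f_differentiable: "\<And>x s. x \<in> \<Omega> \<Longrightarrow> f x differentiable (at s)"
    and f_0: "(\<lambda>x. f x 0) \<in> L2_space \<Omega>"
    and L_nonneg: "0 \<le> L"
    and deriv_bound: "AE x in lebesgue_on \<Omega>. \<forall>s. \<bar>deriv (f x) s\<bar> \<le> L"
begin

lemma \<Omega>_lmeasurable: "\<Omega> \<in> lmeasurable"
  using \<Omega> by (intro lmeasurable_open)

lemma f_continuous: "x \<in> \<Omega> \<Longrightarrow> continuous_on UNIV (f x)"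
  using f_differentiable
  by (auto intro!: continuous_at_imp_continuous_on differentiable_imp_continuous_within)

lemma f_joint_measurable: "(\<lambda>(x, s). f x s) \<in> borel_measurable (lebesgue_on \<Omega> \<Otimes>\<^sub>M borel)"
  by (rule Caratheodory_borel_measurable[OF f_measurable]) (simp add: f_continuous)

lemma f_comp_measurable:
  assumes "u \<in> borel_measurable (lebesgue_on \<Omega>)"
  shows "(\<lambda>x. f x (u x)) \<in> borel_measurable (lebesgue_on \<Omega>)"
  using measurable_compose[OF measurable_Pair[OF measurable_ident assms] f_joint_measurable]
  by (simp add: case_prod_beta id_def)

lemma AE_Lipschitz: "AE x in lebesgue_on \<Omega>. \<forall>s t. \<bar>f x t - f x s\<bar> \<le> L * \<bar>t - s\<bar>"
  using deriv_bound AE_space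
proof eventually_elim
  fix x assume "\<forall>s. \<bar>deriv (f x) s\<bar> \<le> L" "x \<in> space (lebesgue_on \<Omega>)"
  then show "\<forall>s t. \<bar>f x t - f x s\<bar> \<le> L * \<bar>t - s\<bar>"
    using abs_deriv_bound_Lipschitz[of "f x" L] f_differentiable by auto
qed

lemma
  assumes u: "u \<in> L2_space \<Omega>" and v: "v \<in> L2_space \<Omega>"
  shows f_comp_diff_L2: "(\<lambda>x. f x (u x) - f x (v x)) \<in> L2_space \<Omega>"
    and L2_norm_f_comp_diff: "L2_norm \<Omega> (\<lambda>x. f x (u x) - f x (v x)) \<le> L * L2_norm \<Omega> (\<lambda>x. u x - v x)"
proof -
  have [measurable]: "(\<lambda>x. f x (u x)) \<in> borel_measurable (lebesgue_on \<Omega>)"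
    "(\<lambda>x. f x (v x)) \<in> borel_measurable (lebesgue_on \<Omega>)"
    by (intro f_comp_measurable L2_spaceD(1) u v)+
  have L: "(\<lambda>x. L *\<^sub>R (u x - v x)) \<in> L2_space \<Omega>"
    by (intro L2_space_scaleR L2_space_diff u v)
  have AE: "AE x in lebesgue_on \<Omega>. norm (f x (u x) - f x (v x)) \<le> norm (L *\<^sub>R (u x - v x))"
    using AE_Lipschitz by eventually_elim (use L_nonneg in \<open>simp add: abs_mult\<close>)
  show "(\<lambda>x. f x (u x) - f x (v x)) \<in> L2_space \<Omega>"
    by (rule L2_norm_mono_AE(1)[OF _ L AE]) measurable
  have "L2_norm \<Omega> (\<lambda>x. f x (u x) - f x (v x)) \<le> L2_norm \<Omega> (\<lambda>x. L *\<^sub>R (u x - v x))"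
    by (rule L2_norm_mono_AE(2)[OF _ L AE]) measurable
  then show "L2_norm \<Omega> (\<lambda>x. f x (u x) - f x (v x)) \<le> L * L2_norm \<Omega> (\<lambda>x. u x - v x)"
    using L_nonneg by (simp only: L2_norm_scaleR abs_of_nonneg)
qed

lemma f_comp_L2:
  assumes u: "u \<in> L2_space \<Omega>"
  shows "(\<lambda>x. f x (u x)) \<in> L2_space \<Omega>"
proof -
  have "(\<lambda>x::'a. 0::real) \<in> L2_space \<Omega>"
    by (rule L2_space_bounded[OF \<Omega>_lmeasurable, of _ 0]) auto
  from L2_space_add[OF f_comp_diff_L2[OF u this] f_0] show ?thesis by simp
qed

definition potential :: "'a \<Rightarrow> real \<Rightarrow> real" where
  "potential x t = (LBINT s=ereal 0..ereal t. f x s)"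

lemma potential_has_derivative: "x \<in> \<Omega> \<Longrightarrow> (potential x has_real_derivative f x t) (at t)"
  unfolding potential_def[abs_def] by (intro interval_integral_has_real_derivative f_continuous)

lemma potential_0: "potential x 0 = 0"
  by (simp add: potential_def)

lemma AE_potential_bounds:
  "AE x in lebesgue_on \<Omega>. (\<forall>a b. potential x a + f x a * (b - a) - L / 2 * (b - a)\<^sup>2 \<le> potential x b) \<and>
    (\<forall>t. \<bar>potential x t\<bar> \<le> \<bar>f x 0\<bar> * \<bar>t\<bar> + L * t\<^sup>2)"
  using AE_Lipschitz AE_space
proof eventually_elim
  fix x assume lip: "\<forall>s t. \<bar>f x t - f x s\<bar> \<le> L * \<bar>t - s\<bar>" and x: "x \<in> space (lebesgue_on \<Omega>)"
  then have G: "(potential x has_real_derivative f x t) (at t)" for t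
    by (intro potential_has_derivative) simp
  show "(\<forall>a b. potential x a + f x a * (b - a) - L / 2 * (b - a)\<^sup>2 \<le> potential x b) \<and>
      (\<forall>t. \<bar>potential x t\<bar> \<le> \<bar>f x 0\<bar> * \<bar>t\<bar> + L * t\<^sup>2)"
    using primitive_ge_tangent_parabola[OF G, of L] abs_primitive_le[OF G potential_0 _ L_nonneg] lip
    by blast
qed

lemma potential_comp_measurable:
  assumes "u \<in> borel_measurable (lebesgue_on \<Omega>)"
  shows "(\<lambda>x. potential x (u x)) \<in> borel_measurable (lebesgue_on \<Omega>)"
  unfolding potential_def by (rule interval_integral_measurable[OF f_joint_measurable assms])

lemma potential_growth_integrable:
  assumes u: "u \<in> L2_space \<Omega>"
  shows "integrable (lebesgue_on \<Omega>) (\<lambda>x. \<bar>f x 0\<bar> * \<bar>u x\<bar> + L * (u x)\<^sup>2)"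
proof -
  have "integrable (lebesgue_on \<Omega>) (\<lambda>x. \<bar>f x 0 * u x\<bar>)"
    by (intro integrable_abs L2_mult_integrable f_0 u)
  then show ?thesis using L2_spaceD(2)[OF u] by (simp add: abs_mult)
qed

lemma potential_comp_integrable:
  assumes u: "u \<in> L2_space \<Omega>"
  shows "integrable (lebesgue_on \<Omega>) (\<lambda>x. potential x (u x))"
proof (rule Bochner_Integration.integrable_bound[OF potential_growth_integrable[OF u]])
  show "(\<lambda>x. potential x (u x)) \<in> borel_measurable (lebesgue_on \<Omega>)"
    by (intro potential_comp_measurable L2_spaceD(1) u)
  show "AE x in lebesgue_on \<Omega>. norm (potential x (u x)) \<le> norm (\<bar>f x 0\<bar> * \<bar>u x\<bar> + L * (u x)\<^sup>2)"
    using AE_potential_bounds by eventually_elim (auto intro: order_trans[OF _ abs_ge_self])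
qed

lemma energy_eq:
  "energy \<Omega> f u = 1 / 2 * (L2_norm \<Omega> (weak_grad \<Omega> u))\<^sup>2 - (LINT x|lebesgue_on \<Omega>. potential x (u x))"
  by (simp add: energy_def L2_norm_power2 potential_def)

text \<open>Coercivity controls the energy only where the norm is large; on bounded sets the
  quadratic growth of the potential bounds it below.\<close>

lemma energy_ge:
  assumes u: "u \<in> L2_space \<Omega>" "L2_norm \<Omega> u \<le> M"
  shows "- (L2_norm \<Omega> (\<lambda>x. f x 0) * M + L * M\<^sup>2) \<le> energy \<Omega> f u"
proof -
  have "(LINT x|lebesgue_on \<Omega>. potential x (u x)) \<le> (LINT x|lebesgue_on \<Omega>. \<bar>f x 0\<bar> * \<bar>u x\<bar> + L * (u x)\<^sup>2)"
  proof (intro integral_mono_AE potential_comp_integrable potential_growth_integrable u)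
    show "AE x in lebesgue_on \<Omega>. potential x (u x) \<le> \<bar>f x 0\<bar> * \<bar>u x\<bar> + L * (u x)\<^sup>2"
      using AE_potential_bounds by eventually_elim (auto intro: order_trans[OF abs_ge_self])
  qed
  also have "\<dots> = (LINT x|lebesgue_on \<Omega>. \<bar>f x 0\<bar> * \<bar>u x\<bar>) + L * (L2_norm \<Omega> u)\<^sup>2"
  proof -
    have "integrable (lebesgue_on \<Omega>) (\<lambda>x. \<bar>f x 0 * u x\<bar>)"
      by (intro integrable_abs L2_mult_integrable f_0 u)
    then show ?thesis using L2_spaceD(2)[OF u(1)] by (simp add: abs_mult L2_norm_power2)
  qed
  also have "(LINT x|lebesgue_on \<Omega>. \<bar>f x 0\<bar> * \<bar>u x\<bar>) \<le> L2_norm \<Omega> (\<lambda>x. f x 0) * L2_norm \<Omega> u"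
  proof -
    have "(\<lambda>x. \<bar>f x 0\<bar>) \<in> L2_space \<Omega>" "(\<lambda>x. \<bar>u x\<bar>) \<in> L2_space \<Omega>"
      using f_0 u(1) by (auto simp: L2_space_def)
    from L2_Cauchy_Schwarz[OF this] show ?thesis by (simp add: L2_norm_def)
  qed
  also have "L2_norm \<Omega> (\<lambda>x. f x 0) * L2_norm \<Omega> u + L * (L2_norm \<Omega> u)\<^sup>2 \<le> L2_norm \<Omega> (\<lambda>x. f x 0) * M + L * M\<^sup>2"
    by (intro add_mono mult_left_mono power_mono u L_nonneg L2_norm_nonneg)
  finally show ?thesis
    unfolding energy_eq using zero_le_power2[of "L2_norm \<Omega> (weak_grad \<Omega> u)"] by linarith
qed

lemma B_form_eq:
  assumes "u \<in> H1_space \<Omega>" "v \<in> H1_space \<Omega>"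
  shows "B_form \<Omega> l u v = l * (LINT x|lebesgue_on \<Omega>. weak_grad \<Omega> u x \<bullet> weak_grad \<Omega> v x)
    + (LINT x|lebesgue_on \<Omega>. u x * v x)"
  unfolding B_form_def
  using L2_space_inner_integrable[OF H1_spaceD(3)[OF assms(1)] H1_spaceD(3)[OF assms(2)]]
    L2_mult_integrable[OF H1_spaceD(1)[OF assms(1)] H1_spaceD(1)[OF assms(2)]] by simp

lemma ell_form_eq:
  assumes "y \<in> L2_space \<Omega>" "v \<in> L2_space \<Omega>"
  shows "ell_form \<Omega> f l y v = (LINT x|lebesgue_on \<Omega>. y x * v x)
    + l * (LINT x|lebesgue_on \<Omega>. f x (y x) * v x)"
  unfolding ell_form_def
  using L2_mult_integrable[OF assms] L2_mult_integrable[OF f_comp_L2[OF assms(1)] assms(2)]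
  by (simp add: distrib_right mult.assoc)

text \<open>With d = v - u, the gradient energies differ by (grad v, grad d) - |grad d|^2 / 2. The
  scheme evaluates the first term as (f(u), d) - |d|^2 / \<tau>, and the tangent parabola of the
  potential cancels (f(u), d) at the cost of L / 2 |d|^2.\<close>

lemma energy_decay:
  assumes u: "u \<in> H1_space \<Omega>" and v: "v \<in> H1_space \<Omega>" and "\<tau> > 0"
    and step: "B_form \<Omega> \<tau> v (\<lambda>x. v x - u x) = ell_form \<Omega> f \<tau> u (\<lambda>x. v x - u x)"
  shows "energy \<Omega> f v \<le> energy \<Omega> f u - (1 / \<tau> - L / 2) * (L2_norm \<Omega> (\<lambda>x. v x - u x))\<^sup>2
    - 1 / 2 * (L2_norm \<Omega> (weak_grad \<Omega> (\<lambda>x. v x - u x)))\<^sup>2"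
proof -
  note uD = H1_spaceD[OF u] and vD = H1_spaceD[OF v]
  let ?d = "\<lambda>x. v x - u x"
  note d = H1_diff[OF \<Omega> v u]
  note dD = H1_spaceD[OF d]
  let ?I = "\<lambda>g. LINT x|lebesgue_on \<Omega>. g x :: real"
  let ?gv = "weak_grad \<Omega> v" and ?gu = "weak_grad \<Omega> u" and ?gd = "weak_grad \<Omega> ?d"
  have [measurable]: "?gv \<in> borel_measurable (lebesgue_on \<Omega>)" "?gu \<in> borel_measurable (lebesgue_on \<Omega>)"
    "?gd \<in> borel_measurable (lebesgue_on \<Omega>)"
    using uD vD dD by (auto dest: L2_spaceD)
  have AEd: "AE x in lebesgue_on \<Omega>. ?gd x = ?gv x - ?gu x" by (rule weak_grad_diff[OF \<Omega> v u])
  \<comment> \<open>Expanding around v, as u = v - d, produces the pairing of grad v with grad d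
    that the implicit side of the scheme contains.\<close>
  have "L2_norm \<Omega> ?gu = L2_norm \<Omega> (\<lambda>x. ?gv x + (- ?gd x))"
    by (rule L2_norm_cong_AE) (use AEd in auto)
  then have "(L2_norm \<Omega> ?gu)\<^sup>2 = (L2_norm \<Omega> ?gv)\<^sup>2 + 2 * (LINT x|lebesgue_on \<Omega>. ?gv x \<bullet> (- ?gd x)) + (L2_norm \<Omega> (\<lambda>x. - ?gd x))\<^sup>2"
    by (simp only: L2_norm_add_power2[OF vD(3) L2_space_uminus[OF dD(3)]])
  then have grad: "(L2_norm \<Omega> ?gu)\<^sup>2 = (L2_norm \<Omega> ?gv)\<^sup>2 - 2 * (LINT x|lebesgue_on \<Omega>. ?gv x \<bullet> ?gd x) + (L2_norm \<Omega> ?gd)\<^sup>2"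
    by (simp add: L2_norm_uminus)
  have dd: "?I (\<lambda>x. v x * ?d x) - ?I (\<lambda>x. u x * ?d x) = (L2_norm \<Omega> ?d)\<^sup>2"
  proof -
    have "?I (\<lambda>x. v x * ?d x) - ?I (\<lambda>x. u x * ?d x) = ?I (\<lambda>x. v x * ?d x - u x * ?d x)"
      by (intro Bochner_Integration.integral_diff[symmetric] L2_mult_integrable uD vD dD)
    also have "\<dots> = ?I (\<lambda>x. (norm (?d x))\<^sup>2)"
      by (intro Bochner_Integration.integral_cong) (auto simp: power2_eq_square algebra_simps)
    finally show ?thesis by (simp only: L2_norm_power2)
  qed
  have "\<tau> * (LINT x|lebesgue_on \<Omega>. ?gv x \<bullet> ?gd x) = \<tau> * ?I (\<lambda>x. f x (u x) * ?d x) - (L2_norm \<Omega> ?d)\<^sup>2"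
    using step dd unfolding B_form_eq[OF v d] ell_form_eq[OF uD(1) dD(1)] by linarith
  then have gvd: "(LINT x|lebesgue_on \<Omega>. ?gv x \<bullet> ?gd x) = ?I (\<lambda>x. f x (u x) * ?d x) - 1 / \<tau> * (L2_norm \<Omega> ?d)\<^sup>2"
    using \<open>\<tau> > 0\<close> by (simp add: field_simps)
  have i1: "integrable (lebesgue_on \<Omega>) (\<lambda>x. potential x (u x))" "integrable (lebesgue_on \<Omega>) (\<lambda>x. potential x (v x))"
    by (intro potential_comp_integrable uD vD)+
  have i2: "integrable (lebesgue_on \<Omega>) (\<lambda>x. f x (u x) * ?d x)"
    by (intro L2_mult_integrable f_comp_L2 uD dD)
  have i3: "integrable (lebesgue_on \<Omega>) (\<lambda>x. (?d x)\<^sup>2)"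
    using L2_spaceD(2)[OF dD(1)] by simp
  have "?I (\<lambda>x. potential x (u x) + f x (u x) * ?d x - L / 2 * (?d x)\<^sup>2) \<le> ?I (\<lambda>x. potential x (v x))"
  proof (rule integral_mono_AE)
    show "AE x in lebesgue_on \<Omega>. potential x (u x) + f x (u x) * ?d x - L / 2 * (?d x)\<^sup>2 \<le> potential x (v x)"
      using AE_potential_bounds by eventually_elim blast
  qed (use i1 i2 i3 in auto)
  then have pot: "?I (\<lambda>x. potential x (u x)) + ?I (\<lambda>x. f x (u x) * ?d x) - L / 2 * (L2_norm \<Omega> ?d)\<^sup>2 \<le> ?I (\<lambda>x. potential x (v x))"
    using i1 i2 i3 by (simp add: L2_norm_power2)
  show ?thesis
    unfolding energy_eq left_diff_distrib using grad gvd pot by linarith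
qed

end

section \<open>Convergence of the iteration\<close>

lemma closed_subspaceD:
  assumes "closed_subspace \<Omega> W"
  shows "v \<in> W \<Longrightarrow> v \<in> H10_space \<Omega>"
    and "v \<in> W \<Longrightarrow> w \<in> W \<Longrightarrow> (\<lambda>x. v x + w x) \<in> W"
    and "v \<in> W \<Longrightarrow> (\<lambda>x. c * v x) \<in> W"
    and "(\<And>n. a n \<in> W) \<Longrightarrow> v \<in> H10_space \<Omega> \<Longrightarrow>
      (\<lambda>n. lam_norm \<Omega> 1 (\<lambda>x. a n x - v x)) \<longlonglongrightarrow> 0 \<Longrightarrow> v \<in> W"
proof -
  note D = assms[unfolded closed_subspace_def]
  show "v \<in> W \<Longrightarrow> v \<in> H10_space \<Omega>" by (rule subsetD[OF D[THEN conjunct1]])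
  note D = D[THEN conjunct2, THEN conjunct2]
  show "v \<in> W \<Longrightarrow> w \<in> W \<Longrightarrow> (\<lambda>x. v x + w x) \<in> W" by (rule D[THEN conjunct1, rule_format])
  note D = D[THEN conjunct2]
  show "v \<in> W \<Longrightarrow> (\<lambda>x. c * v x) \<in> W" by (rule D[THEN conjunct1, rule_format])
  note D = D[THEN conjunct2, rule_format]
  show "(\<And>n. a n \<in> W) \<Longrightarrow> v \<in> H10_space \<Omega> \<Longrightarrow>
      (\<lambda>n. lam_norm \<Omega> 1 (\<lambda>x. a n x - v x)) \<longlonglongrightarrow> 0 \<Longrightarrow> v \<in> W"
    by (rule D[where w=a])
qed

lemma closed_subspace_diff:
  assumes "closed_subspace \<Omega> W" "v \<in> W" "w \<in> W"
  shows "(\<lambda>x. v x - w x) \<in> W"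
  using closed_subspaceD(2)[OF assms(1,2) closed_subspaceD(3)[OF assms(1,3), of "-1"]] by simp

lemma weakly_converges_in_of_norm:
  assumes W: "closed_subspace \<Omega> W" and v: "\<And>n. v n \<in> W" "w \<in> W"
    and lim: "(\<lambda>n. lam_norm \<Omega> 1 (\<lambda>x. v n x - w x)) \<longlonglongrightarrow> 0"
  shows "weakly_converges_in \<Omega> W v w"
  unfolding weakly_converges_in_def
proof (intro conjI allI impI v)
  fix F assume F: "bounded_functional_on \<Omega> W F"
  then obtain C where C: "\<And>z. z \<in> W \<Longrightarrow> \<bar>F z\<bar> \<le> C * lam_norm \<Omega> 1 z"
    unfolding bounded_functional_on_def by blast
  have add: "F (\<lambda>x. a x + b x) = F a + F b" if "a \<in> W" "b \<in> W" for a b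
    using that by (rule F[unfolded bounded_functional_on_def, THEN conjunct1, rule_format])
  have d: "(\<lambda>x. v n x - w x) \<in> W" for n
    by (rule closed_subspace_diff[OF W v])
  have "F (v n) = F (\<lambda>x. v n x - w x) + F w" for n
    using add[OF d[of n] v(2)] by simp
  then have bound: "norm (F (v n) - F w) \<le> C * lam_norm \<Omega> 1 (\<lambda>x. v n x - w x)" for n
    using C[OF d[of n]] by simp
  have "(\<lambda>n. C * lam_norm \<Omega> 1 (\<lambda>x. v n x - w x)) \<longlonglongrightarrow> C * 0"
    by (intro tendsto_mult tendsto_const lim)
  then have "(\<lambda>n. F (v n) - F w) \<longlonglongrightarrow> 0"
    by (intro Lim_null_comparison[OF always_eventually[OF allI[OF bound]]]) simp
  then show "(\<lambda>n. F (v n)) \<longlonglongrightarrow> F w" by (simp add: LIM_zero_iff)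
qed

text \<open>Every \<open>l \<in> Lambda_f \<Omega> f \<rho>\<close> gives the Lipschitz constant \<open>\<rho> + 2 / l\<close>, and letting \<open>l\<close> approach
  \<open>Sup (Lambda_f \<Omega> f \<rho>)\<close> turns the strict inequality on the step size into strict dissipation.\<close>

lemma Lambda_f_deriv_bound:
  assumes "l \<in> Lambda_f \<Omega> f \<rho>"
  shows "AE x in lebesgue_on \<Omega>. \<forall>s. \<bar>deriv (f x) s\<bar> \<le> \<rho> + 2 / l"
proof -
  have l: "l > 0" "sigma_f \<Omega> f l < ereal (\<rho> + 1 / l)" using assms by (auto simp: Lambda_f_def)
  have "AE x in lebesgue_on \<Omega>. (SUP u. ereal \<bar>deriv (f x) u + 1 / l\<bar>) \<le> sigma_f \<Omega> f l"
    unfolding sigma_f_def by (rule esssup_AE)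
  then show ?thesis
  proof eventually_elim
    fix x assume *: "(SUP u. ereal \<bar>deriv (f x) u + 1 / l\<bar>) \<le> sigma_f \<Omega> f l"
    show "\<forall>s. \<bar>deriv (f x) s\<bar> \<le> \<rho> + 2 / l"
    proof
      fix s
      have "ereal \<bar>deriv (f x) s + 1 / l\<bar> \<le> (SUP u. ereal \<bar>deriv (f x) u + 1 / l\<bar>)"
        by (rule SUP_upper) simp
      also note *
      also note l(2)
      finally have "\<bar>deriv (f x) s + 1 / l\<bar> < \<rho> + 1 / l" by simp
      \<comment> \<open>Undoing the shift by 1 / l costs a second 1 / l.\<close>
      moreover have "1 / l > 0" "2 / l = 1 / l + 1 / l" using l(1) by auto
      ultimately show "\<bar>deriv (f x) s\<bar> \<le> \<rho> + 2 / l" by linarith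
    qed
  qed
qed

text \<open>In both cases of its definition \<open>mu_f\<close> is the infimum of 1 / l over the
  set: the reciprocal of a positive finite supremum, or 0 when l is unbounded.\<close>

lemma Lambda_f_approx_mu_f:
  assumes ne: "Lambda_f \<Omega> f \<rho> \<noteq> {}" and g: "mu_f \<Omega> f \<rho> < g"
  shows "\<exists>l\<in>Lambda_f \<Omega> f \<rho>. 1 / l < g"
proof -
  let ?S = "Lambda_f \<Omega> f \<rho>"
  have pos: "l > 0" if "l \<in> ?S" for l using that by (simp add: Lambda_f_def)
  show ?thesis
  proof (cases "bdd_above ?S")
    case True
    obtain l0 where l0: "l0 \<in> ?S" using ne by blast
    have S: "Sup ?S > 0" using cSup_upper[OF l0 True] pos[OF l0] by linarith
    have "inverse (Sup ?S) < g" using g True by (simp add: mu_f_def)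
    then have "g > 0"
      using S positive_imp_inverse_positive[of "Sup ?S"] by linarith
    then have "1 / g < Sup ?S"
      using S \<open>inverse (Sup ?S) < g\<close> by (simp add: field_simps)
    then obtain l where "l \<in> ?S" "1 / g < l" using less_cSupD[OF ne] by blast
    then show ?thesis using \<open>g > 0\<close> pos by (intro bexI[of _ l]) (auto simp: field_simps)
  next
    case False
    then have "g > 0" using g by (simp add: mu_f_def)
    obtain l where "l \<in> ?S" "1 / g < l" using False unfolding bdd_above_def by (meson not_le)
    then show ?thesis using \<open>g > 0\<close> pos by (intro bexI[of _ l]) (auto simp: field_simps)
  qed
qed

lemma decseq_bounded_below_diff_tendsto_0:
  fixes E :: "nat \<Rightarrow> real"
  assumes "\<And>n. E (Suc n) \<le> E n" "\<And>n. B \<le> E n"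
  shows "(\<lambda>n. E n - E (Suc n)) \<longlonglongrightarrow> 0"
proof -
  have "decseq E" using assms(1) by (simp add: decseq_Suc_iff)
  then obtain l where "E \<longlonglongrightarrow> l" using decseq_convergent[of E B] assms(2) by blast
  then have "(\<lambda>n. E n - E (Suc n)) \<longlonglongrightarrow> l - l"
    by (intro tendsto_diff LIMSEQ_Suc)
  then show ?thesis by simp
qed

section \<open>Compactness of the iterates and passage to the limit\<close>

context Lipschitz_nonlinearity
begin

text \<open>The scheme transfers strong \<open>L\<^sup>2\<close> convergence of \<open>u\<^sup>n\<close> to strong \<open>H\<^sup>1\<close> convergence of \<open>u\<^sup>n\<^sup>+\<^sup>1\<close>.\<close>

lemma weak_grad_diff_estimate:
  assumes y: "y \<in> L2_space \<Omega>" "z \<in> L2_space \<Omega>" and a: "a \<in> H1_space \<Omega>" and b: "b \<in> H1_space \<Omega>"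
    and \<tau>: "\<tau> > 0"
    and A: "B_form \<Omega> \<tau> a (\<lambda>x. a x - b x) = ell_form \<Omega> f \<tau> y (\<lambda>x. a x - b x)"
    and B: "B_form \<Omega> \<tau> b (\<lambda>x. a x - b x) = ell_form \<Omega> f \<tau> z (\<lambda>x. a x - b x)"
  shows "\<tau> * (L2_norm \<Omega> (\<lambda>x. weak_grad \<Omega> a x - weak_grad \<Omega> b x))\<^sup>2
    \<le> (1 + \<tau> * L) * L2_norm \<Omega> (\<lambda>x. y x - z x) * L2_norm \<Omega> (\<lambda>x. a x - b x)"
proof -
  note aD = H1_spaceD[OF a] and bD = H1_spaceD[OF b]
  let ?d = "\<lambda>x. a x - b x"
  note d = H1_diff[OF \<Omega> a b]
  note dD = H1_spaceD[OF d]
  let ?I = "\<lambda>g. LINT x|lebesgue_on \<Omega>. g x :: real"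
  let ?ga = "weak_grad \<Omega> a" and ?gb = "weak_grad \<Omega> b" and ?gd = "weak_grad \<Omega> ?d"
  have [measurable]: "?ga \<in> borel_measurable (lebesgue_on \<Omega>)" "?gb \<in> borel_measurable (lebesgue_on \<Omega>)"
    "?gd \<in> borel_measurable (lebesgue_on \<Omega>)"
    using aD bD dD by (auto dest: L2_spaceD)
  have AEd: "AE x in lebesgue_on \<Omega>. ?gd x = ?ga x - ?gb x" by (rule weak_grad_diff[OF \<Omega> a b])
  have g2: "?I (\<lambda>x. ?ga x \<bullet> ?gd x) - ?I (\<lambda>x. ?gb x \<bullet> ?gd x) = (L2_norm \<Omega> (\<lambda>x. ?ga x - ?gb x))\<^sup>2"
  proof -
    have "?I (\<lambda>x. ?ga x \<bullet> ?gd x) - ?I (\<lambda>x. ?gb x \<bullet> ?gd x) = ?I (\<lambda>x. ?ga x \<bullet> ?gd x - ?gb x \<bullet> ?gd x)"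
      by (intro Bochner_Integration.integral_diff[symmetric] L2_space_inner_integrable aD bD dD)
    also have "\<dots> = ?I (\<lambda>x. (norm (?ga x - ?gb x))\<^sup>2)"
    proof (rule integral_cong_AE)
      show "AE x in lebesgue_on \<Omega>. ?ga x \<bullet> ?gd x - ?gb x \<bullet> ?gd x = (norm (?ga x - ?gb x))\<^sup>2"
        using AEd by eventually_elim (simp add: power2_norm_eq_inner inner_diff_left)
    qed measurable
    finally show ?thesis by (simp only: L2_norm_power2)
  qed
  have d2: "?I (\<lambda>x. a x * ?d x) - ?I (\<lambda>x. b x * ?d x) = (L2_norm \<Omega> ?d)\<^sup>2"
  proof -
    have "?I (\<lambda>x. a x * ?d x) - ?I (\<lambda>x. b x * ?d x) = ?I (\<lambda>x. a x * ?d x - b x * ?d x)"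
      by (intro Bochner_Integration.integral_diff[symmetric] L2_mult_integrable aD bD dD)
    also have "\<dots> = ?I (\<lambda>x. (norm (?d x))\<^sup>2)"
      by (intro Bochner_Integration.integral_cong) (auto simp: power2_eq_square algebra_simps)
    finally show ?thesis by (simp only: L2_norm_power2)
  qed
  have CS: "?I (\<lambda>x. g x * ?d x) - ?I (\<lambda>x. h x * ?d x) \<le> L2_norm \<Omega> (\<lambda>x. g x - h x) * L2_norm \<Omega> ?d"
    if "g \<in> L2_space \<Omega>" "h \<in> L2_space \<Omega>" for g h :: "'a \<Rightarrow> real"
  proof -
    have "?I (\<lambda>x. g x * ?d x) - ?I (\<lambda>x. h x * ?d x) = ?I (\<lambda>x. g x * ?d x - h x * ?d x)"
      by (intro Bochner_Integration.integral_diff[symmetric] L2_mult_integrable that dD)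
    also have "\<dots> = ?I (\<lambda>x. (g x - h x) \<bullet> ?d x)"
      by (intro Bochner_Integration.integral_cong) (auto simp: left_diff_distrib)
    finally show ?thesis
      using L2_Cauchy_Schwarz[OF L2_space_diff[OF that] dD(1)] by linarith
  qed
  let ?n = "L2_norm \<Omega> (\<lambda>x. y x - z x)" and ?m = "L2_norm \<Omega> ?d"
  have "?I (\<lambda>x. f x (y x) * ?d x) - ?I (\<lambda>x. f x (z x) * ?d x) \<le> L2_norm \<Omega> (\<lambda>x. f x (y x) - f x (z x)) * ?m"
    by (rule CS[OF f_comp_L2[OF y(1)] f_comp_L2[OF y(2)]])
  also have "\<dots> \<le> (L * ?n) * ?m"
    by (intro mult_right_mono L2_norm_f_comp_diff y) simp
  finally have "\<tau> * (?I (\<lambda>x. f x (y x) * ?d x) - ?I (\<lambda>x. f x (z x) * ?d x)) \<le> \<tau> * ((L * ?n) * ?m)"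
    using \<tau> by (intro mult_left_mono) auto
  \<comment> \<open>The difference of the two steps, both tested with a - b.\<close>
  moreover have "\<tau> * (?I (\<lambda>x. ?ga x \<bullet> ?gd x) - ?I (\<lambda>x. ?gb x \<bullet> ?gd x)) + (?I (\<lambda>x. a x * ?d x) - ?I (\<lambda>x. b x * ?d x))
      = (?I (\<lambda>x. y x * ?d x) - ?I (\<lambda>x. z x * ?d x)) + \<tau> * (?I (\<lambda>x. f x (y x) * ?d x) - ?I (\<lambda>x. f x (z x) * ?d x))"
    using A B unfolding B_form_eq[OF a d] B_form_eq[OF b d] ell_form_eq[OF y(1) dD(1)] ell_form_eq[OF y(2) dD(1)]
      right_diff_distrib by linarith
  \<comment> \<open>The squared L2 norm of a - b on the left is nonnegative and is dropped.\<close>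
  ultimately have "\<tau> * (L2_norm \<Omega> (\<lambda>x. ?ga x - ?gb x))\<^sup>2 \<le> ?n * ?m + \<tau> * ((L * ?n) * ?m)"
    using CS[OF y] zero_le_power2[of ?m] unfolding g2 d2 by linarith
  then show ?thesis by (simp add: algebra_simps)
qed

theorem energy_stable_iteration_subsequence:
  fixes W :: "('a \<Rightarrow> real) set" and u :: "nat \<Rightarrow> 'a \<Rightarrow> real"
  assumes P: "poincare_constant \<Omega> C\<^sub>P" and W: "closed_subspace \<Omega> W"
    and \<tau>: "\<tau> > 0" and gap: "L / 2 < 1 / \<tau> + 1 / (2 * C\<^sub>P)"
    and lam: "lam > 0" and coercive: "weakly_coercive \<Omega> lam (energy \<Omega> f)"
    and u0: "u 0 \<in> W"
    and step: "\<And>n. u (Suc n) \<in> W \<and> (\<forall>v\<in>W. B_form \<Omega> \<tau> (u (Suc n)) v = ell_form \<Omega> f \<tau> (u n) v)"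
  shows "\<exists>r w. strict_mono r \<and> weakly_converges_in \<Omega> W (\<lambda>n. u (r n)) w \<and>
    strongly_converges_L2 \<Omega> (\<lambda>n. u (r n)) w \<and> is_weak_solution_in \<Omega> f W w"
proof -
  have uW: "u n \<in> W" for n by (cases n) (use u0 step in auto)
  have WH: "v \<in> H10_space \<Omega>" if "v \<in> W" for v by (rule closed_subspaceD(1)[OF W that])
  note u10 = WH[OF uW]
  note u1 = H10_spaceD[OF u10]
  note uD = H1_spaceD[OF u1]
  have dW: "(\<lambda>x. a x - b x) \<in> W" if "a \<in> W" "b \<in> W" for a b
    by (rule closed_subspace_diff[OF W that])
  have st: "B_form \<Omega> \<tau> (u (Suc n)) v = ell_form \<Omega> f \<tau> (u n) v" if "v \<in> W" for n v
    using step that by blast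
  let ?E = "\<lambda>n. energy \<Omega> f (u n)"
  let ?\<delta> = "\<lambda>n. L2_norm \<Omega> (\<lambda>x. u (Suc n) x - u n x)"
  \<comment> \<open>The margin: the implicit step gains 1 / \<tau>, half the squared gradient of the
    increment gains the Poincare term, and the remainder of the potential costs L / 2.\<close>
  define c where "c = 1 / \<tau> + 1 / (2 * C\<^sub>P) - L / 2"
  have c: "c > 0" using gap by (simp add: c_def)
  have CP: "C\<^sub>P > 0" using P by (simp add: poincare_constant_def)
  have decay: "c * (?\<delta> n)\<^sup>2 \<le> ?E n - ?E (Suc n)" for n
  proof -
    let ?d = "\<lambda>x. u (Suc n) x - u n x"
    have "?E (Suc n) \<le> ?E n - (1 / \<tau> - L / 2) * (?\<delta> n)\<^sup>2 - 1 / 2 * (L2_norm \<Omega> (weak_grad \<Omega> ?d))\<^sup>2"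
      by (rule energy_decay[where u="u n" and v="u (Suc n)", OF u1 u1 \<tau> st[OF dW[OF uW uW]]])
    moreover have "(?\<delta> n)\<^sup>2 \<le> C\<^sub>P * (L2_norm \<Omega> (weak_grad \<Omega> ?d))\<^sup>2"
      using P WH[OF dW[OF uW uW]] unfolding poincare_constant_def by blast
    then have "1 / (2 * C\<^sub>P) * (?\<delta> n)\<^sup>2 \<le> 1 / 2 * (L2_norm \<Omega> (weak_grad \<Omega> ?d))\<^sup>2"
      using CP by (simp add: field_simps)
    ultimately show ?thesis unfolding c_def left_diff_distrib distrib_right by linarith
  qed
  have dec: "?E (Suc n) \<le> ?E n" for n
  proof -
    have "0 \<le> c * (?\<delta> n)\<^sup>2" using c by simp
    then show ?thesis using decay[of n] by linarith
  qed
  have E0: "?E n \<le> ?E 0" for n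
    by (induction n) (use dec in \<open>auto intro: order_trans\<close>)
  \<comment> \<open>The added 1 makes the coercivity bound contradict the decay of the energy, so R
    bounds every iterate.\<close>
  obtain R where R: "\<And>v. v \<in> H10_space \<Omega> \<Longrightarrow> lam_norm \<Omega> lam v \<ge> R \<Longrightarrow> energy \<Omega> f v \<ge> ?E 0 + 1"
    using coercive unfolding weakly_coercive_def by blast
  have uR: "lam_norm \<Omega> lam (u n) \<le> R" for n
    using R[OF u10[of n]] E0[of n] by linarith
  \<comment> \<open>The weighted norm controls the function directly, but the gradient only up to
    the factor \<open>sqrt lam\<close>.\<close>
  define M where "M = max R (R / sqrt lam)"
  have M1: "L2_norm \<Omega> (u n) \<le> M" for n
    using L2_norm_le_lam_norm(1)[of lam \<Omega> "u n"] uR[of n] lam by (simp add: M_def)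
  have M2: "L2_norm \<Omega> (weak_grad \<Omega> (u n)) \<le> M" for n
  proof -
    have "sqrt lam * L2_norm \<Omega> (weak_grad \<Omega> (u n)) \<le> R"
      using L2_norm_le_lam_norm(2)[of lam \<Omega> "u n"] uR[of n] lam by linarith
    then have "L2_norm \<Omega> (weak_grad \<Omega> (u n)) \<le> R / sqrt lam"
      using lam by (simp add: field_simps)
    then show ?thesis by (simp add: M_def)
  qed
  have M0: "M \<ge> 0" using M1[of 0] L2_norm_nonneg[of \<Omega> "u 0"] by linarith
  have "(\<lambda>n. ?E n - ?E (Suc n)) \<longlonglongrightarrow> 0"
    by (rule decseq_bounded_below_diff_tendsto_0[where E="?E", OF dec energy_ge[OF uD(1) M1]])
  then have "(\<lambda>n. (?E n - ?E (Suc n)) / c) \<longlonglongrightarrow> 0 / c"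
    by (intro tendsto_divide tendsto_const) (use c in auto)
  then have lim_c: "(\<lambda>n. (?E n - ?E (Suc n)) / c) \<longlonglongrightarrow> 0" by simp
  have "(?\<delta> n)\<^sup>2 \<le> (?E n - ?E (Suc n)) / c" for n
    using decay[of n] c by (simp add: field_simps)
  then have "(\<lambda>n. (?\<delta> n)\<^sup>2) \<longlonglongrightarrow> 0"
    by (intro tendsto_sandwich[OF _ _ tendsto_const lim_c]) (auto intro!: always_eventually)
  then have "(\<lambda>n. sqrt ((?\<delta> n)\<^sup>2)) \<longlonglongrightarrow> sqrt 0" by (rule tendsto_real_sqrt)
  then have \<delta>: "?\<delta> \<longlonglongrightarrow> 0" by simp
  obtain r where r: "strict_mono r" and rC: "L2_Cauchy \<Omega> (\<lambda>n. u (r n))"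
    using Rellich_H10[where u=u and M=M, OF \<Omega> u10 M1 M2] by blast
  have \<delta>r: "(\<lambda>n. ?\<delta> (r n)) \<longlonglongrightarrow> 0"
    using LIMSEQ_subseq_LIMSEQ[OF \<delta> r] by (simp add: o_def)
  obtain w where w: "w \<in> L2_space \<Omega>" "(\<lambda>n. L2_norm \<Omega> (\<lambda>x. u (r n) x - w x)) \<longlonglongrightarrow> 0"
    using L2_complete[where u="\<lambda>n. u (r n)", OF \<Omega>_lmeasurable uD(1) rC] by blast
  \<comment> \<open>The shifted iterates: the scheme expresses their gradients through
    \<open>u (r n)\<close>, whose L2 convergence is known.\<close>
  define v where "v n = u (Suc (r n))" for n
  have v10: "v n \<in> H10_space \<Omega>" for n by (simp add: v_def u10)
  note v1 = H10_spaceD[OF v10]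
  note vD = H1_spaceD[OF v1]
  have vW: "v n \<in> W" for n by (simp add: v_def uW)
  have tri: "L2_norm \<Omega> (\<lambda>x. v m x - v n x) \<le> ?\<delta> (r m) + L2_norm \<Omega> (\<lambda>x. u (r m) x - u (r n) x) + ?\<delta> (r n)" for m n
    using L2_norm_diff_triangle[OF vD(1)[of m] uD(1)[of "r m"] vD(1)[of n]]
      L2_norm_diff_triangle[OF uD(1)[of "r m"] uD(1)[of "r n"] vD(1)[of n]]
      L2_norm_minus_commute[of \<Omega> "u (r n)" "v n"] by (simp add: v_def)
  have vC: "L2_Cauchy \<Omega> v"
    unfolding L2_Cauchy_def
  proof (intro allI impI)
    fix e :: real assume "e > 0"
    then have e: "e / 3 > 0" by simp
    obtain N1 where N1: "\<And>m n. m \<ge> N1 \<Longrightarrow> n \<ge> N1 \<Longrightarrow> L2_norm \<Omega> (\<lambda>x. u (r m) x - u (r n) x) < e / 3"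
      using rC[unfolded L2_Cauchy_def, rule_format, OF e] by blast
    obtain N2 where N2: "\<And>n. n \<ge> N2 \<Longrightarrow> ?\<delta> (r n) < e / 3"
      using order_tendstoD(2)[OF \<delta>r e] unfolding eventually_sequentially by blast
    show "\<exists>N. \<forall>m\<ge>N. \<forall>n\<ge>N. L2_norm \<Omega> (\<lambda>x. v m x - v n x) < e"
    proof (intro exI[of _ "max N1 N2"] allI impI)
      fix m n assume "m \<ge> max N1 N2" "n \<ge> max N1 N2"
      then show "L2_norm \<Omega> (\<lambda>x. v m x - v n x) < e"
        using tri[of m n] N1[of m n] N2[of m] N2[of n] by auto
    qed
  qed
  have vM: "L2_norm \<Omega> (\<lambda>x. v m x - v n x) \<le> 2 * M" for m n
    using L2_norm_triangle[OF vD(1)[of m] L2_space_uminus[OF vD(1)[of n]]] M1[of "Suc (r m)"] M1[of "Suc (r n)"]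
    by (simp add: L2_norm_uminus v_def)
  let ?g = "\<lambda>m n. L2_norm \<Omega> (\<lambda>x. weak_grad \<Omega> (v m) x - weak_grad \<Omega> (v n) x)"
  have grad_le: "\<tau> * (?g m n)\<^sup>2 \<le> (1 + \<tau> * L) * L2_norm \<Omega> (\<lambda>x. u (r m) x - u (r n) x) * (2 * M)" for m n
  proof -
    have "\<tau> * (?g m n)\<^sup>2 \<le> (1 + \<tau> * L) * L2_norm \<Omega> (\<lambda>x. u (r m) x - u (r n) x) * L2_norm \<Omega> (\<lambda>x. v m x - v n x)"
    proof (rule weak_grad_diff_estimate[where y="u (r m)" and z="u (r n)" and a="v m" and b="v n",
          OF uD(1) uD(1) v1 v1 \<tau>])
      have d: "(\<lambda>x. v m x - v n x) \<in> W" by (rule dW[OF vW vW])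
      show "B_form \<Omega> \<tau> (v m) (\<lambda>x. v m x - v n x) = ell_form \<Omega> f \<tau> (u (r m)) (\<lambda>x. v m x - v n x)"
        using st[OF d, of "r m"] by (simp only: v_def)
      show "B_form \<Omega> \<tau> (v n) (\<lambda>x. v m x - v n x) = ell_form \<Omega> f \<tau> (u (r n)) (\<lambda>x. v m x - v n x)"
        using st[OF d, of "r n"] by (simp only: v_def)
    qed
    also have "\<dots> \<le> (1 + \<tau> * L) * L2_norm \<Omega> (\<lambda>x. u (r m) x - u (r n) x) * (2 * M)"
      using \<tau> L_nonneg by (intro mult_left_mono vM mult_nonneg_nonneg) auto
    finally show ?thesis .
  qed
  have gC: "L2_Cauchy \<Omega> (\<lambda>n. weak_grad \<Omega> (v n))"
    unfolding L2_Cauchy_def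
  proof (intro allI impI)
    fix e :: real assume e: "e > 0"
    \<comment> \<open>The summand 1 keeps K positive even when M is 0.\<close>
    define K where "K = (1 + \<tau> * L) * (2 * M) + 1"
    have K: "K > 0" using \<tau> L_nonneg M0 by (auto simp: K_def intro!: add_nonneg_pos mult_nonneg_nonneg)
    have "\<tau> * e\<^sup>2 / K > 0" using \<tau> e K by simp
    then obtain N where N: "\<And>m n. m \<ge> N \<Longrightarrow> n \<ge> N \<Longrightarrow> L2_norm \<Omega> (\<lambda>x. u (r m) x - u (r n) x) < \<tau> * e\<^sup>2 / K"
      using rC[unfolded L2_Cauchy_def, rule_format, of "\<tau> * e\<^sup>2 / K"] by blast
    show "\<exists>N. \<forall>m\<ge>N. \<forall>n\<ge>N. ?g m n < e"
    proof (intro exI[of _ N] allI impI)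
      fix m n assume mn: "m \<ge> N" "n \<ge> N"
      let ?n = "L2_norm \<Omega> (\<lambda>x. u (r m) x - u (r n) x)"
      have "\<tau> * (?g m n)\<^sup>2 \<le> (K - 1) * ?n"
        using grad_le[of m n] by (simp add: K_def algebra_simps)
      also have "\<dots> \<le> K * ?n" by (intro mult_right_mono) auto
      also have "\<dots> < \<tau> * e\<^sup>2"
        using N[OF mn] K by (simp add: field_simps)
      finally have "(?g m n)\<^sup>2 < e\<^sup>2" using \<tau> by simp
      then show "?g m n < e" by (rule power2_less_imp_less) (use e in simp)
    qed
  qed
  obtain z where z: "z \<in> H10_space \<Omega>" and vz: "(\<lambda>n. lam_norm \<Omega> 1 (\<lambda>x. v n x - z x)) \<longlonglongrightarrow> 0"
    using H10_complete[where u=v, OF \<Omega> v10 vC gC] by blast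
  note z1 = H10_spaceD[OF z]
  note zD = H1_spaceD[OF z1]
  have zW: "z \<in> W" by (rule closed_subspaceD(4)[OF W vW z vz])
  have lim: "(\<lambda>n. L2_norm \<Omega> (\<lambda>x. v n x - z x)) \<longlonglongrightarrow> 0"
    "(\<lambda>n. L2_norm \<Omega> (\<lambda>x. weak_grad \<Omega> (v n) x - weak_grad \<Omega> z x)) \<longlonglongrightarrow> 0"
    using lam_norm_diff_tendsto_0_iff[where u=v and w=z, OF \<Omega> v1 z1] vz by auto
  have uz: "(\<lambda>n. L2_norm \<Omega> (\<lambda>x. u (r n) x - z x)) \<longlonglongrightarrow> 0"
  proof (rule tendsto_sandwich[OF _ _ tendsto_const])
    show "\<forall>\<^sub>F n in sequentially. L2_norm \<Omega> (\<lambda>x. u (r n) x - z x) \<le> ?\<delta> (r n) + L2_norm \<Omega> (\<lambda>x. v n x - z x)"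
    proof (intro always_eventually allI)
      fix n
      show "L2_norm \<Omega> (\<lambda>x. u (r n) x - z x) \<le> ?\<delta> (r n) + L2_norm \<Omega> (\<lambda>x. v n x - z x)"
        using L2_norm_diff_triangle[OF uD(1)[of "r n"] vD(1)[of n] zD(1)]
          L2_norm_minus_commute[of \<Omega> "u (r n)" "v n"] by (simp add: v_def)
    qed
    show "(\<lambda>n. ?\<delta> (r n) + L2_norm \<Omega> (\<lambda>x. v n x - z x)) \<longlonglongrightarrow> 0"
      using tendsto_add[OF \<delta>r lim(1)] by simp
  qed simp
  have fuz: "(\<lambda>n. L2_norm \<Omega> (\<lambda>x. f x (u (r n) x) - f x (z x))) \<longlonglongrightarrow> 0"
  proof (rule tendsto_sandwich[OF _ _ tendsto_const])
    show "\<forall>\<^sub>F n in sequentially. L2_norm \<Omega> (\<lambda>x. f x (u (r n) x) - f x (z x)) \<le> L * L2_norm \<Omega> (\<lambda>x. u (r n) x - z x)"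
      by (intro always_eventually allI L2_norm_f_comp_diff uD zD)
    show "(\<lambda>n. L * L2_norm \<Omega> (\<lambda>x. u (r n) x - z x)) \<longlonglongrightarrow> 0"
      using tendsto_mult[OF tendsto_const[of L] uz] by simp
  qed simp
  have sol: "(LINT x|lebesgue_on \<Omega>. weak_grad \<Omega> z x \<bullet> weak_grad \<Omega> y x) = (LINT x|lebesgue_on \<Omega>. f x (z x) * y x)"
    if y: "y \<in> W" for y
  proof -
    note y1 = H10_spaceD[OF WH[OF y]]
    note yD = H1_spaceD[OF y1]
    have 1: "(\<lambda>n. LINT x|lebesgue_on \<Omega>. weak_grad \<Omega> (v n) x \<bullet> weak_grad \<Omega> y x)
        \<longlonglongrightarrow> (LINT x|lebesgue_on \<Omega>. weak_grad \<Omega> z x \<bullet> weak_grad \<Omega> y x)"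
      by (rule L2_inner_tendsto[OF vD(3) yD(3) zD(3) yD(3) lim(2)]) simp
    have 2: "(\<lambda>n. LINT x|lebesgue_on \<Omega>. v n x * y x) \<longlonglongrightarrow> (LINT x|lebesgue_on \<Omega>. z x * y x)"
      using L2_inner_tendsto[OF vD(1) yD(1) zD(1) yD(1) lim(1)] by simp
    have 3: "(\<lambda>n. LINT x|lebesgue_on \<Omega>. u (r n) x * y x) \<longlonglongrightarrow> (LINT x|lebesgue_on \<Omega>. z x * y x)"
      using L2_inner_tendsto[OF uD(1) yD(1) zD(1) yD(1) uz] by simp
    have 4: "(\<lambda>n. LINT x|lebesgue_on \<Omega>. f x (u (r n) x) * y x) \<longlonglongrightarrow> (LINT x|lebesgue_on \<Omega>. f x (z x) * y x)"
      using L2_inner_tendsto[OF f_comp_L2[OF uD(1)] yD(1) f_comp_L2[OF zD(1)] yD(1) fuz] by simp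
    have eq: "\<tau> * (LINT x|lebesgue_on \<Omega>. weak_grad \<Omega> (v n) x \<bullet> weak_grad \<Omega> y x) + (LINT x|lebesgue_on \<Omega>. v n x * y x)
        = (LINT x|lebesgue_on \<Omega>. u (r n) x * y x) + \<tau> * (LINT x|lebesgue_on \<Omega>. f x (u (r n) x) * y x)" for n
      using st[OF y, of "r n"] B_form_eq[OF v1 y1, of \<tau> n] ell_form_eq[OF uD(1) yD(1), of \<tau> "r n"]
      by (simp add: v_def)
    \<comment> \<open>Both zero-order terms have the limit (z, y), so they cancel and \<tau> can be
      divided out.\<close>
    have "\<tau> * (LINT x|lebesgue_on \<Omega>. weak_grad \<Omega> z x \<bullet> weak_grad \<Omega> y x) + (LINT x|lebesgue_on \<Omega>. z x * y x)
        = (LINT x|lebesgue_on \<Omega>. z x * y x) + \<tau> * (LINT x|lebesgue_on \<Omega>. f x (z x) * y x)"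
    proof (rule LIMSEQ_unique)
      show "(\<lambda>n. \<tau> * (LINT x|lebesgue_on \<Omega>. weak_grad \<Omega> (v n) x \<bullet> weak_grad \<Omega> y x) + (LINT x|lebesgue_on \<Omega>. v n x * y x))
          \<longlonglongrightarrow> \<tau> * (LINT x|lebesgue_on \<Omega>. weak_grad \<Omega> z x \<bullet> weak_grad \<Omega> y x) + (LINT x|lebesgue_on \<Omega>. z x * y x)"
        by (intro tendsto_add tendsto_mult tendsto_const 1 2)
      show "(\<lambda>n. \<tau> * (LINT x|lebesgue_on \<Omega>. weak_grad \<Omega> (v n) x \<bullet> weak_grad \<Omega> y x) + (LINT x|lebesgue_on \<Omega>. v n x * y x))
          \<longlonglongrightarrow> (LINT x|lebesgue_on \<Omega>. z x * y x) + \<tau> * (LINT x|lebesgue_on \<Omega>. f x (z x) * y x)"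
        unfolding eq by (intro tendsto_add tendsto_mult tendsto_const 3 4)
    qed
    then show ?thesis using \<tau> by simp
  qed
  \<comment> \<open>The subsequence delivered is the shifted one, since it is the one known to
    converge in H^1.\<close>
  have "strict_mono (\<lambda>n. Suc (r n))" using r by (simp add: strict_mono_def)
  moreover have "weakly_converges_in \<Omega> W (\<lambda>n. u (Suc (r n))) z"
    using weakly_converges_in_of_norm[OF W vW zW vz] by (simp add: v_def[abs_def])
  moreover have "strongly_converges_L2 \<Omega> (\<lambda>n. u (Suc (r n))) z"
    using uD(1) zD(1) lim(1) by (simp add: strongly_converges_L2_def v_def)
  moreover have "is_weak_solution_in \<Omega> f W z"
    using zW sol by (simp add: is_weak_solution_in_def)
  ultimately show ?thesis by blast
qed

end

theorem theorem3p10: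
  fixes \<Omega> :: "(real ^ 'd) set"
    and f :: "real ^ 'd \<Rightarrow> real \<Rightarrow> real"
    and W :: "(real ^ 'd \<Rightarrow> real) set"
    and u :: "nat \<Rightarrow> real ^ 'd \<Rightarrow> real"
    and \<rho> C\<^sub>P \<Delta>t lam :: real
  assumes "CARD('d) \<in> {1, 2, 3}"
    and "polytopal_domain \<Omega>"
    and "poincare_constant \<Omega> C\<^sub>P"
    and "\<And>s. (\<lambda>x. f x s) \<in> borel_measurable (lebesgue_on \<Omega>)"
    and "\<rho> > 0"
    and "assumption_A \<Omega> f \<rho>"
    and "closed_subspace \<Omega> W"
    and "\<Delta>t > 0"
    and "1 / \<Delta>t > kappa_f \<Omega> f \<rho> C\<^sub>P"
    and "lam > 0"
    and "weakly_coercive \<Omega> lam (energy \<Omega> f)"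
    and "u 0 \<in> W"
    and "\<And>n. u (Suc n) \<in> W \<and>
            (\<forall>v\<in>W. B_form \<Omega> \<Delta>t (u (Suc n)) v = ell_form \<Omega> f \<Delta>t (u n) v)"
  shows "\<exists>r w. strict_mono r \<and>
           weakly_converges_in \<Omega> W (\<lambda>n. u (r n)) w \<and>
           strongly_converges_L2 \<Omega> (\<lambda>n. u (r n)) w \<and>
           is_weak_solution_in \<Omega> f W w"
proof -
  note A = assms(6)[unfolded assumption_A_def]
  \<comment> \<open>The maximum in \<open>kappa_f\<close> is at least its first entry.\<close>
  have "mu_f \<Omega> f \<rho> < 1 / \<Delta>t + 1 / (2 * C\<^sub>P) - \<rho> / 2"
    using assms(9) unfolding kappa_f_def by simp
  then obtain l where l: "l \<in> Lambda_f \<Omega> f \<rho>" "1 / l < 1 / \<Delta>t + 1 / (2 * C\<^sub>P) - \<rho> / 2"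
    using Lambda_f_approx_mu_f A by blast
  have "l > 0" using l(1) by (simp add: Lambda_f_def)
  interpret Lipschitz_nonlinearity \<Omega> f "\<rho> + 2 / l"
  proof
    show "open \<Omega>" "bounded \<Omega>" using assms(2) by (auto simp: polytopal_domain_def)
    show "(\<lambda>x. f x s) \<in> borel_measurable (lebesgue_on \<Omega>)" for s by (rule assms(4))
    show "f x differentiable at s" if "x \<in> \<Omega>" for x s using A that by blast
    show "(\<lambda>x. f x 0) \<in> L2_space \<Omega>" using A by blast
    show "0 \<le> \<rho> + 2 / l" using assms(5) \<open>l > 0\<close> by simp
    show "AE x in lebesgue_on \<Omega>. \<forall>s. \<bar>deriv (f x) s\<bar> \<le> \<rho> + 2 / l"
      by (rule Lambda_f_deriv_bound[OF l(1)])
  qed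
  show ?thesis
  proof (rule energy_stable_iteration_subsequence[OF assms(3,7,8) _ assms(10,11,12,13)])
    \<comment> \<open>Decay involves half the Lipschitz constant, so l enters as 1 / l, exactly the
      quantity that was bounded when l was chosen.\<close>
    have "(\<rho> + 2 / l) / 2 = \<rho> / 2 + 1 / l" by (simp add: add_divide_distrib)
    then show "(\<rho> + 2 / l) / 2 < 1 / \<Delta>t + 1 / (2 * C\<^sub>P)" using l(2) by linarith
  qed
qed

end
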